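(* Let $X=\{x_1,\ldots,x_n\}\subset\mathbb R^d$ be a pointset with aspect ratio $\Phi$ and let $\epsilon>0$. Let $\Lambda=O(\log(d\log\Phi/\epsilon))$ and $L=\log\Phi+\Lambda$. There is a randomized algorithm that runs in time $\tilde O(ndL)$ and produces a sketch (bit string) of size $O(nd\Lambda+n\log n)$ bits such that, with high probability, for every pair $i,j\in[n]$ the distance $\|x_i-x_j\|$ can be recovered from the sketch (given $i,j$) up to distortion $1\pm\epsilon$, i.e. a value in $[(1-\epsilon)\|x_i-x_j\|,(1+\epsilon)\|x_i-x_j\|]$.
   Context: Norms are Euclidean, logarithms are base 2, $[n]=\{1,\ldots,n\}$, and $\tilde O$ suppresses polylogarithmic factors. The aspect ratio is $\Phi=\max_{i<j}\|x_i-x_j\|/\min_{i<j}\|x_i-x_j\|$ (points assumed distinct).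
   Formalization: For minimum distance m, a term log(1+|log m|) is added to the sketch size and to ndL in the running time (0 if m=1), since bounds independent of scale fail for {0,s,2s}; logarithms inside the O(·) defining Λ are read as at least 1, and n≥2. *)

theory Defs
  imports "HOL-Probability.Probability"
begin

section \<open>Pointsets\<close>

text \<open>The points are \<open>x 0, \<dots>, x (n - 1)\<close>, and the coordinates of \<open>x i\<close> are
  \<open>x i 0, \<dots>, x i (d - 1)\<close>; values of \<open>x\<close> outside these ranges are never used. Dimension and number
  of points are ordinary natural numbers, since one algorithm has to work for all of them.\<close>

definition pdist :: "nat \<Rightarrow> (nat \<Rightarrow> real) \<Rightarrow> (nat \<Rightarrow> real) \<Rightarrow> real" where
  "pdist d p q = L2_set (\<lambda>k. p k - q k) {..<d}"

definition pointset :: "nat \<Rightarrow> nat \<Rightarrow> (nat \<Rightarrow> nat \<Rightarrow> real) \<Rightarrow> bool" where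
  "pointset n d x \<longleftrightarrow> (\<forall>i j. i < j \<and> j < n \<longrightarrow> (\<exists>k<d. x i k \<noteq> x j k))"

definition pair_dists :: "nat \<Rightarrow> nat \<Rightarrow> (nat \<Rightarrow> nat \<Rightarrow> real) \<Rightarrow> real set" where
  "pair_dists n d x = {pdist d (x i) (x j) | i j. i < j \<and> j < n}"

definition min_dist :: "nat \<Rightarrow> nat \<Rightarrow> (nat \<Rightarrow> nat \<Rightarrow> real) \<Rightarrow> real" where
  "min_dist n d x = Min (pair_dists n d x)"

definition aspect_ratio :: "nat \<Rightarrow> nat \<Rightarrow> (nat \<Rightarrow> nat \<Rightarrow> real) \<Rightarrow> real" where
  "aspect_ratio n d x = Max (pair_dists n d x) / min_dist n d x"


section \<open>The quantities in the bounds\<close>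

text \<open>Inside an \<open>O(\<dots>)\<close>, a logarithm is read as being at least 1; otherwise
  \<open>log (d log \<Phi> / \<epsilon>)\<close> would be meaningless for \<open>\<Phi> = 1\<close> and negative for large \<open>\<epsilon>\<close>.\<close>

definition lg :: "real \<Rightarrow> real" where
  "lg y = max 1 (log 2 y)"

definition lambda_bound :: "nat \<Rightarrow> real \<Rightarrow> real \<Rightarrow> real" where
  "lambda_bound d \<Phi> \<epsilon> = lg (real d * lg \<Phi> / \<epsilon>)"

text \<open>Up to a constant, the number of bits needed to write down the binary exponent of a length \<open>m\<close>.
  It is 0 for \<open>m = 1\<close>, that is, when the pointset is scaled to have minimum distance 1. Some such
  term is unavoidable for pointsets of arbitrary scale: neither \<open>\<Phi>\<close> nor \<open>\<epsilon>\<close> changes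
  under scaling, but a bit string of bounded length cannot tell infinitely many scales apart.\<close>

definition scale_bits :: "real \<Rightarrow> real" where
  "scale_bits m = log 2 (1 + \<bar>log 2 m\<bar>)"


section \<open>Randomized real RAM\<close>

text \<open>Memory consists of arrays of natural numbers and arrays of reals; a program names
  finitely many arrays by constants, and addresses the cells of an array by computed natural numbers.
  The primitives are those of the usual real RAM: exact field arithmetic, square roots and comparisons
  on reals; addition, subtraction and comparison on naturals. There are no real constants other than
  the naturals, and there is no rounding of reals to integers. The only source of randomness are fair
  coin flips, read from \<open>coins\<close>. The bits in \<open>outbits\<close> are in the order in which they were emitted.\<close>

record store =
  nats :: "nat \<Rightarrow> nat \<Rightarrow> nat"
  reals :: "nat \<Rightarrow> nat \<Rightarrow> real"
  outbits :: "bool list"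
  coins :: "bool stream"

datatype nexp =
    NConst nat
  | NCell nat nexp
  | NAdd nexp nexp
  | NSub nexp nexp

datatype rexp =
    RCell nat nexp
  | ROfNat nexp
  | RAdd rexp rexp
  | RSub rexp rexp
  | RMul rexp rexp
  | RDiv rexp rexp
  | RSqrt rexp

datatype bexp =
    NLe nexp nexp
  | RLe rexp rexp
  | BNot bexp
  | BAnd bexp bexp

primrec nval :: "nexp \<Rightarrow> store \<Rightarrow> nat" where
  "nval (NConst c) s = c"
| "nval (NCell a e) s = nats s a (nval e s)"
| "nval (NAdd e f) s = nval e s + nval f s"
| "nval (NSub e f) s = nval e s - nval f s"

primrec rval :: "rexp \<Rightarrow> store \<Rightarrow> real" where
  "rval (RCell a e) s = reals s a (nval e s)"
| "rval (ROfNat e) s = real (nval e s)"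
| "rval (RAdd e f) s = rval e s + rval f s"
| "rval (RSub e f) s = rval e s - rval f s"
| "rval (RMul e f) s = rval e s * rval f s"
| "rval (RDiv e f) s = rval e s / rval f s"
| "rval (RSqrt e) s = sqrt (rval e s)"

primrec bval :: "bexp \<Rightarrow> store \<Rightarrow> bool" where
  "bval (NLe e f) s \<longleftrightarrow> nval e s \<le> nval f s"
| "bval (RLe e f) s \<longleftrightarrow> rval e s \<le> rval f s"
| "bval (BNot b) s \<longleftrightarrow> \<not> bval b s"
| "bval (BAnd b b') s \<longleftrightarrow> bval b s \<and> bval b' s"

datatype com =
    Skip
  | NAssign nat nexp nexp
  | RAssign nat nexp rexp
  | Flip nat nexp
  | Emit bexp
  | Seq com com
  | Cond bexp com com
  | While bexp com

definition set_cell :: "(nat \<Rightarrow> nat \<Rightarrow> 'v) \<Rightarrow> nat \<Rightarrow> nat \<Rightarrow> 'v \<Rightarrow> nat \<Rightarrow> nat \<Rightarrow> 'v" where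
  "set_cell m a i v = m(a := (m a)(i := v))"

text \<open>\<open>runs c s t s'\<close>: started in \<open>s\<close>, program \<open>c\<close> halts in \<open>s'\<close> after \<open>t\<close> steps. Every assignment, coin
  flip, output and test counts as one step. The expressions in it have a size that is fixed by the
  program, so counting single arithmetic operations would change \<open>t\<close> by a constant factor only.\<close>

inductive runs :: "com \<Rightarrow> store \<Rightarrow> nat \<Rightarrow> store \<Rightarrow> bool" where
  Skip: "runs Skip s 1 s"
| NAssign: "runs (NAssign a e f) s 1 (s\<lparr>nats := set_cell (nats s) a (nval e s) (nval f s)\<rparr>)"
| RAssign: "runs (RAssign a e f) s 1 (s\<lparr>reals := set_cell (reals s) a (nval e s) (rval f s)\<rparr>)"
| Flip: "runs (Flip a e) s 1
    (s\<lparr>nats := set_cell (nats s) a (nval e s) (of_bool (shd (coins s))), coins := stl (coins s)\<rparr>)"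
| Emit: "runs (Emit b) s 1 (s\<lparr>outbits := outbits s @ [bval b s]\<rparr>)"
| Seq: "runs c s t s' \<Longrightarrow> runs c' s' t' s'' \<Longrightarrow> runs (Seq c c') s (t + t') s''"
| CondTrue: "bval b s \<Longrightarrow> runs c s t s' \<Longrightarrow> runs (Cond b c c') s (Suc t) s'"
| CondFalse: "\<not> bval b s \<Longrightarrow> runs c' s t s' \<Longrightarrow> runs (Cond b c c') s (Suc t) s'"
| WhileFalse: "\<not> bval b s \<Longrightarrow> runs (While b c) s 1 s"
| WhileTrue: "bval b s \<Longrightarrow> runs c s t s' \<Longrightarrow> runs (While b c) s' t' s'' \<Longrightarrow>
    runs (While b c) s (Suc (t + t')) s''"

inductive_cases SkipE: "runs Skip s t s'"
inductive_cases NAssignE: "runs (NAssign a e f) s t s'"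
inductive_cases RAssignE: "runs (RAssign a e f) s t s'"
inductive_cases FlipE: "runs (Flip a e) s t s'"
inductive_cases EmitE: "runs (Emit b) s t s'"
inductive_cases SeqE: "runs (Seq c c') s t s'"
inductive_cases CondE: "runs (Cond b c c') s t s'"
inductive_cases WhileE: "runs (While b c) s t s'"

lemma runs_deterministic:
  "runs c s t s' \<Longrightarrow> runs c s u s'' \<Longrightarrow> u = t \<and> s'' = s'"
proof (induction arbitrary: u s'' rule: runs.induct)
  case (Skip s)
  then show ?case by (rule SkipE) simp
next
  case (NAssign a e f s)
  then show ?case by (rule NAssignE) simp
next
  case (RAssign a e f s)
  then show ?case by (rule RAssignE) simp
next
  case (Flip a e s)
  then show ?case by (rule FlipE) simp
next
  case (Emit b s)
  then show ?case by (rule EmitE) simp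
next
  case (Seq c s t s' c' t' s2)
  from Seq.prems show ?case by (rule SeqE) (metis Seq.IH)
next
  case (CondTrue b s c t s' c')
  from CondTrue.prems show ?case by (rule CondE) (use CondTrue.hyps CondTrue.IH in metis)+
next
  case (CondFalse b s c' t s' c)
  from CondFalse.prems show ?case by (rule CondE) (use CondFalse.hyps CondFalse.IH in metis)+
next
  case (WhileFalse b s c)
  from WhileFalse.prems show ?case by (rule WhileE) (use WhileFalse.hyps in simp_all)
next
  case (WhileTrue b s c t s' t' s2)
  from WhileTrue.prems show ?case by (rule WhileE) (use WhileTrue.hyps(1) WhileTrue.IH in metis)+
qed

definition coin_flips :: "bool stream measure" where
  "coin_flips = stream_space (measure_pmf (bernoulli_pmf (1 / 2)))"


section \<open>Sketching and recovery\<close>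

text \<open>The sketching algorithm is given \<open>n\<close>, \<open>d\<close>, \<open>\<epsilon>\<close> and the points, as a row-major array, but
  neither \<open>\<Phi>\<close> nor \<open>\<Lambda>\<close> nor \<open>L\<close>. Its output is the sketch.\<close>

definition sketch_input :: "nat \<Rightarrow> nat \<Rightarrow> real \<Rightarrow> (nat \<Rightarrow> nat \<Rightarrow> real) \<Rightarrow> bool stream \<Rightarrow> store" where
  "sketch_input n d \<epsilon> x \<omega> = \<lparr>
     nats = set_cell (set_cell (\<lambda>_ _. 0) 0 0 n) 0 1 d,
     reals = (\<lambda>a p. if a = 0 \<and> p = 0 then \<epsilon>
                    else if a = 1 \<and> p < n * d then x (p div d) (p mod d)
                    else 0),
     outbits = [],
     coins = \<omega>\<rparr>"

text \<open>The recovery algorithm is given the sketch (with its length) and \<open>i\<close>, \<open>j\<close>, and nothing else.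
  It is deterministic: the coins it could read are constant.\<close>

definition recovery_input :: "bool list \<Rightarrow> nat \<Rightarrow> nat \<Rightarrow> store" where
  "recovery_input b i j = \<lparr>
     nats = (\<lambda>a p. if a = 0 then (if p = 0 then length b else if p = 1 then i else if p = 2 then j else 0)
                   else if a = 1 \<and> p < length b then of_bool (b ! p)
                   else 0),
     reals = (\<lambda>_ _. 0),
     outbits = [],
     coins = sconst False\<rparr>"

definition recovers :: "com \<Rightarrow> bool list \<Rightarrow> nat \<Rightarrow> nat \<Rightarrow> real \<Rightarrow> bool" where
  "recovers dec b i j v \<longleftrightarrow> (\<exists>t s. runs dec (recovery_input b i j) t s \<and> reals s 0 0 = v)"

definition good_sketch ::
  "com \<Rightarrow> bool list \<Rightarrow> nat \<Rightarrow> nat \<Rightarrow> (nat \<Rightarrow> nat \<Rightarrow> real) \<Rightarrow> real \<Rightarrow> bool" where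
  "good_sketch dec b n d x \<epsilon> \<longleftrightarrow>
     (\<forall>i<n. \<forall>j<n. \<exists>v. recovers dec b i j v \<and>
        v \<in> {(1 - \<epsilon>) * pdist d (x i) (x j) .. (1 + \<epsilon>) * pdist d (x i) (x j)})"

end

theory Submission
  imports Defs "HOL-Number_Theory.Cong"
begin

text \<open>No randomness is needed. The points are scaled into a cube and written in binary, all coordinates
  shifted by a common \<open>j / M\<close>; interleaving the digits of the \<open>d\<close> coordinates level by level turns
  each point into a bit string. For odd \<open>M\<close>, multiplication by powers of 2 permutes the residues
  modulo \<open>M\<close>, so a given coordinate lies close to the grid of a given level for at most two of the \<open>M\<close>
  shifts. With \<open>M = 4 d H + 1\<close> for \<open>H\<close> levels, some shift therefore keeps more than half of the points
  away from all grid lines; it is found by counting, for every shift, the bad incidences.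

  A round stores, for every string but the first, a pointer to an earlier string with a longest common
  prefix, the length of that prefix, and the \<open>d \<Lambda>\<close> bits that follow it in both strings. Bits that are not
  stored are the same unknown bits for all strings that agree up to there, so they cancel in differences.
  Hence the distance of two points is known up to about \<open>2 ^ - \<Lambda>\<close> times the side of the last common cell,
  which is small against the distance itself if one of the points is away from the grid lines. The
  remaining points, fewer than half, go to the next round, so that the sizes form a geometric series.
  The number of levels is doubled until the grid separates all points.\<close>

section \<open>Weakest preconditions with step counts\<close>

text \<open>Keeping a few levels below the place where two strings part does not suffice by itself:
  very close points may lie on opposite sides of a coarse grid line, and an error measured in coarse
  cells would then dwarf their distance. A margin of 1 / M of a cell at one endpoint excludes this,
  so each pair is answered in the first round in which one endpoint has the margin. The price is a
  factor M = O(d H) in the required precision; its logarithm is the source of log d and log log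
  \<Phi> in \<Lambda>. The 4 in M is 2 bad shifts per level and coordinate, times 2 for losing less
  than half of the points.

  Two features of the machine shape the programs: without a floor, digits and exponents are found by
  comparison, doubling and repeated squaring; and since \<Phi> is not part of the input, the number
  of levels is searched for. For \<epsilon> \<ge> 1 the answer 0 is always acceptable and the sketch
  is empty; this avoids the range in which \<Lambda> no longer controls log d.\<close>

definition wp :: "com \<Rightarrow> (store \<Rightarrow> nat \<Rightarrow> bool) \<Rightarrow> store \<Rightarrow> nat \<Rightarrow> bool" where
  "wp c Q s k \<longleftrightarrow> (\<exists>t s'. runs c s t s' \<and> Q s' (k + t))"

lemma wp_Skip: "wp Skip Q s k \<longleftrightarrow> Q s (k + 1)"
  unfolding wp_def by (metis runs.Skip SkipE)

lemma wp_NAssign: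
  "wp (NAssign a e f) Q s k \<longleftrightarrow> Q (s\<lparr>nats := set_cell (nats s) a (nval e s) (nval f s)\<rparr>) (k + 1)"
  unfolding wp_def by (metis runs.NAssign NAssignE)

lemma wp_RAssign:
  "wp (RAssign a e f) Q s k \<longleftrightarrow> Q (s\<lparr>reals := set_cell (reals s) a (nval e s) (rval f s)\<rparr>) (k + 1)"
  unfolding wp_def by (metis runs.RAssign RAssignE)

lemma wp_Emit: "wp (Emit b) Q s k \<longleftrightarrow> Q (s\<lparr>outbits := outbits s @ [bval b s]\<rparr>) (k + 1)"
  unfolding wp_def by (metis runs.Emit EmitE)

text \<open>The step count runs along with the store, so a postcondition speaks about the total time
  and sequencing is mere composition of \<open>wp\<close>.\<close>

lemma wp_Seq: "wp (Seq c c') Q s k \<longleftrightarrow> wp c (wp c' Q) s k"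
proof
  assume "wp (Seq c c') Q s k"
  then obtain t s' where "runs (Seq c c') s t s'" and Q: "Q s' (k + t)"
    unfolding wp_def by blast
  then show "wp c (wp c' Q) s k"
    unfolding wp_def by (auto elim!: SeqE) (metis add.assoc)
next
  assume "wp c (wp c' Q) s k"
  then obtain t s' t' s'' where "runs c s t s'" "runs c' s' t' s''" "Q s'' (k + t + t')"
    unfolding wp_def by blast
  then show "wp (Seq c c') Q s k"
    unfolding wp_def by (metis runs.Seq add.assoc)
qed

lemma wp_Cond:
  "wp (Cond b c c') Q s k \<longleftrightarrow> (if bval b s then wp c Q s (k + 1) else wp c' Q s (k + 1))"
proof (cases "bval b s")
  case True
  then have "runs (Cond b c c') s t s' \<longleftrightarrow> (\<exists>u. t = Suc u \<and> runs c s u s')" for t s'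
    by (blast intro: runs.CondTrue elim: CondE)
  with True show ?thesis unfolding wp_def by (metis add_Suc_right add_Suc plus_1_eq_Suc Suc_eq_plus1)
next
  case False
  then have "runs (Cond b c c') s t s' \<longleftrightarrow> (\<exists>u. t = Suc u \<and> runs c' s u s')" for t s'
    by (blast intro: runs.CondFalse elim: CondE)
  with False show ?thesis unfolding wp_def by (metis add_Suc_right add_Suc plus_1_eq_Suc Suc_eq_plus1)
qed

lemma wp_While_unfold:
  "wp (While b c) Q s k \<longleftrightarrow> (if bval b s then wp c (wp (While b c) Q) s (k + 1) else Q s (k + 1))"
proof (cases "bval b s")
  case True
  have "wp (While b c) Q s k \<longleftrightarrow> (\<exists>t t' s' s''. runs c s t s' \<and> runs (While b c) s' t' s'' \<and>
      Q s'' (k + Suc (t + t')))"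
    unfolding wp_def using True by (blast intro: runs.WhileTrue elim: WhileE)
  then show ?thesis
    using True unfolding wp_def by (force simp: add.assoc)
next
  case False
  then show ?thesis
    unfolding wp_def by (metis WhileE WhileFalse)
qed

lemmas wp_simps = wp_Skip wp_NAssign wp_RAssign wp_Emit wp_Seq wp_Cond

section \<open>Frame conditions\<close>

primrec nmods :: "com \<Rightarrow> nat set" where
  "nmods Skip = {}"
| "nmods (NAssign a e f) = {a}"
| "nmods (RAssign a e f) = {}"
| "nmods (Flip a e) = {a}"
| "nmods (Emit b) = {}"
| "nmods (Seq c c') = nmods c \<union> nmods c'"
| "nmods (Cond b c c') = nmods c \<union> nmods c'"
| "nmods (While b c) = nmods c"

primrec rmods :: "com \<Rightarrow> nat set" where
  "rmods Skip = {}"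
| "rmods (NAssign a e f) = {}"
| "rmods (RAssign a e f) = {a}"
| "rmods (Flip a e) = {}"
| "rmods (Emit b) = {}"
| "rmods (Seq c c') = rmods c \<union> rmods c'"
| "rmods (Cond b c c') = rmods c \<union> rmods c'"
| "rmods (While b c) = rmods c"

primrec emits :: "com \<Rightarrow> bool" where
  "emits Skip = False"
| "emits (NAssign a e f) = False"
| "emits (RAssign a e f) = False"
| "emits (Flip a e) = False"
| "emits (Emit b) = True"
| "emits (Seq c c') = (emits c \<or> emits c')"
| "emits (Cond b c c') = (emits c \<or> emits c')"
| "emits (While b c) = emits c"

text \<open>Whole arrays are the unit of framing. As every scalar has an array of its own, this is
  fine enough to carry all untouched variables across a subprogram without naming them in its
  specification.\<close>

definition same :: "com \<Rightarrow> store \<Rightarrow> store \<Rightarrow> bool" where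
  "same c s s' \<longleftrightarrow> (\<forall>a. a \<notin> nmods c \<longrightarrow> nats s' a = nats s a) \<and>
     (\<forall>a. a \<notin> rmods c \<longrightarrow> reals s' a = reals s a) \<and> (\<not> emits c \<longrightarrow> outbits s' = outbits s)"

lemma same_nats: "same c s s' \<Longrightarrow> a \<notin> nmods c \<Longrightarrow> nats s' a = nats s a"
  and same_reals: "same c s s' \<Longrightarrow> a \<notin> rmods c \<Longrightarrow> reals s' a = reals s a"
  and same_outbits: "same c s s' \<Longrightarrow> \<not> emits c \<Longrightarrow> outbits s' = outbits s"
  unfolding same_def by auto

lemma same_refl: "same c s s"
  unfolding same_def by simp

lemma same_trans: "same c s s' \<Longrightarrow> same c s' s'' \<Longrightarrow> same c s s''"
  unfolding same_def by simp

lemma same_mono: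
  "same c s s' \<Longrightarrow> nmods c \<subseteq> nmods c' \<Longrightarrow> rmods c \<subseteq> rmods c' \<Longrightarrow> (emits c \<Longrightarrow> emits c') \<Longrightarrow> same c' s s'"
  unfolding same_def by blast

lemma runs_same: "runs c s t s' \<Longrightarrow> same c s s'"
proof (induction rule: runs.induct)
  case (Seq c s t s' c' t' s'')
  then show ?case unfolding same_def by simp
next
  case (CondTrue b s c t s' c')
  then show ?case unfolding same_def by simp
next
  case (CondFalse b s c' t s' c)
  then show ?case unfolding same_def by simp
next
  case (WhileTrue b s c t s' t' s'')
  then show ?case unfolding same_def by simp
qed (auto simp: same_def set_cell_def)

text \<open>The form in which specifications of subprograms are applied: the frame of
  \<open>c\<close> comes for free, so a specification lists only what \<open>c\<close>
  establishes.\<close>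

lemma wp_use:
  assumes "wp c P s k" and "\<And>s' k'. P s' k' \<Longrightarrow> same c s s' \<Longrightarrow> Q s' k'"
  shows "wp c Q s k"
  using assms unfolding wp_def by (metis runs_same)

lemma wp_mono: "wp c P s k \<Longrightarrow> (\<And>s' k'. P s' k' \<Longrightarrow> Q s' k') \<Longrightarrow> wp c Q s k"
  unfolding wp_def by blast

text \<open>Termination comes from the iteration count, which stays below \<open>B\<close> as long
  as the test holds; the induction is on \<open>B - i\<close>. The frame is taken relative to a
  fixed store \<open>s0\<close>, so that it accumulates over the iterations.\<close>

lemma wp_While_gen:
  assumes I: "I i s k" and "same (While b c) s0 s"
    and step: "\<And>i s' k'. I i s' k' \<Longrightarrow> same (While b c) s0 s' \<Longrightarrow> bval b s' \<Longrightarrow>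
      i < B \<and> wp c (\<lambda>s'' k''. I (Suc i) s'' k'') s' (k' + 1)"
    and fin: "\<And>i s' k'. I i s' k' \<Longrightarrow> same (While b c) s0 s' \<Longrightarrow> \<not> bval b s' \<Longrightarrow> Q s' (k' + 1)"
  shows "wp (While b c) Q s k"
  using I assms(2)
proof (induction "B - i" arbitrary: i s k rule: less_induct)
  case less
  show ?case
  proof (cases "bval b s")
    case True
    from step[OF less.prems True] have B: "i < B"
      and w: "wp c (\<lambda>s'' k''. I (Suc i) s'' k'') s (k + 1)" by auto
    have "wp c (wp (While b c) Q) s (k + 1)"
    proof (rule wp_use[OF w])
      fix s' k'
      assume "I (Suc i) s' k'" and sm: "same c s s'"
      moreover have "same (While b c) s s'"
        using sm by (rule same_mono) auto
      ultimately show "wp (While b c) Q s' k'"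
        using B less.prems(2) by (intro less.hyps) (auto intro: same_trans)
    qed
    with True show ?thesis by (simp add: wp_While_unfold[of b])
  next
    case False
    then show ?thesis
      using fin[OF less.prems] by (simp add: wp_While_unfold)
  qed
qed

lemma wp_While:
  assumes "I 0 s"
    and "\<And>i s' k'. I i s' \<Longrightarrow> same (While b c) s s' \<Longrightarrow> bval b s' \<Longrightarrow>
      i < B \<and> wp c (\<lambda>s'' k''. I (Suc i) s'' \<and> k'' \<le> k' + tb) s' k'"
    and "\<And>i s' k'. I i s' \<Longrightarrow> same (While b c) s s' \<Longrightarrow> \<not> bval b s' \<Longrightarrow> k' \<le> k + i * (tb + 1) + 1 \<Longrightarrow> Q s' k'"
  shows "wp (While b c) Q s k"
  by (rule wp_While_gen[where s = s and ?s0.0 = s and i = 0 and B = B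
        and I = "\<lambda>i s' k'. I i s' \<and> k' \<le> k + i * (tb + 1)"])
    (use assms in \<open>auto simp: same_refl intro!: wp_mono[OF conjunct2[OF assms(2)]]\<close>)

section \<open>Counting loops\<close>

definition For :: "nat \<Rightarrow> nexp \<Rightarrow> com \<Rightarrow> com" where
  "For v e c = Seq (NAssign v (NConst 0) (NConst 0))
     (While (BNot (NLe e (NCell v (NConst 0))))
       (Seq c (NAssign v (NConst 0) (NAdd (NCell v (NConst 0)) (NConst 1)))))"

lemma nmods_For [simp]: "nmods (For v e c) = insert v (nmods c)"
  and rmods_For [simp]: "rmods (For v e c) = rmods c"
  and emits_For [simp]: "emits (For v e c) = emits c"
  unfolding For_def by auto

text \<open>The loop evaluates \<open>e\<close> anew before each pass; hence its value has to be
  \<open>N\<close> in every store that differs only in what the loop may write. The two increments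
  of the time in each pass are the test and the update of the counter.\<close>

lemma wp_For_gen:
  assumes I: "I 0 (s\<lparr>nats := set_cell (nats s) v 0 0\<rparr>) (k + 1)"
    and N: "\<And>s'. same (For v e c) s s' \<Longrightarrow> nval e s' = N"
    and v: "v \<notin> nmods c"
    and step: "\<And>i s' k'. i < N \<Longrightarrow> I i s' k' \<Longrightarrow> nats s' v 0 = i \<Longrightarrow> same (For v e c) s s' \<Longrightarrow>
      wp c (\<lambda>s'' k''. I (Suc i) (s''\<lparr>nats := set_cell (nats s'') v 0 (Suc i)\<rparr>) (k'' + 1)) s' (k' + 1)"
    and fin: "\<And>s' k'. I N s' k' \<Longrightarrow> nats s' v 0 = N \<Longrightarrow> same (For v e c) s s' \<Longrightarrow> Q s' (k' + 1)"
  shows "wp (For v e c) Q s k"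
  unfolding For_def wp_Seq wp_NAssign
  apply simp
proof (rule wp_While_gen[where i = 0 and B = N
      and I = "\<lambda>i s' k'. I i s' k' \<and> nats s' v 0 = i \<and> i \<le> N"])
  let ?s = "s\<lparr>nats := set_cell (nats s) v 0 0\<rparr>"
  let ?w = "While (BNot (NLe e (NCell v (NConst 0))))
       (Seq c (NAssign v (NConst 0) (NAdd (NCell v (NConst 0)) (NConst (Suc 0)))))"
  have sm: "same (For v e c) s s'" if "same ?w ?s s'" for s'
    using that unfolding same_def by (auto simp: set_cell_def)
  show "I 0 ?s (Suc k) \<and> nats ?s v 0 = 0 \<and> 0 \<le> N"
    using I by (simp add: set_cell_def)
  show "same ?w ?s ?s"
    by (rule same_refl)
  fix i s' k'
  assume a: "I i s' k' \<and> nats s' v 0 = i \<and> i \<le> N" and b: "same ?w ?s s'"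
  show "i < N \<and> wp (Seq c (NAssign v (NConst 0) (NAdd (NCell v (NConst 0)) (NConst (Suc 0)))))
      (\<lambda>s'' k''. I (Suc i) s'' k'' \<and> nats s'' v 0 = Suc i \<and> Suc i \<le> N) s' (k' + 1)"
    if c: "bval (BNot (NLe e (NCell v (NConst 0)))) s'"
  proof -
    have iN: "i < N" using c N[OF sm[OF b]] a by simp
    show ?thesis
      unfolding wp_Seq wp_NAssign
    proof (rule conjI[OF iN wp_use[OF step[OF iN _ _ sm[OF b]]]])
      fix s'' k''
      assume "I (Suc i) (s''\<lparr>nats := set_cell (nats s'') v 0 (Suc i)\<rparr>) (k'' + 1)" "same c s' s''"
      moreover from this have "nats s'' v = nats s' v"
        using v by (simp add: same_nats)
      ultimately show "I (Suc i) (s''\<lparr>nats := set_cell (nats s'') v (nval (NConst 0) s'')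
            (nval (NAdd (NCell v (NConst 0)) (NConst (Suc 0))) s'')\<rparr>) (k'' + 1) \<and>
          nats (s''\<lparr>nats := set_cell (nats s'') v (nval (NConst 0) s'')
            (nval (NAdd (NCell v (NConst 0)) (NConst (Suc 0))) s'')\<rparr>) v 0 = Suc i \<and> Suc i \<le> N"
        using a iN by (simp add: set_cell_def)
    qed (use a in auto)
  qed
  show "Q s' (k' + 1)" if "\<not> bval (BNot (NLe e (NCell v (NConst 0)))) s'"
    using that N[OF sm[OF b]] a fin[OF _ _ sm[OF b], of k'] by auto
qed

lemma wp_For:
  assumes "I 0 (s\<lparr>nats := set_cell (nats s) v 0 0\<rparr>)"
    and "\<And>s'. same (For v e c) s s' \<Longrightarrow> nval e s' = N"
    and "v \<notin> nmods c"
    and step: "\<And>i s' k'. i < N \<Longrightarrow> I i s' \<Longrightarrow> nats s' v 0 = i \<Longrightarrow> same (For v e c) s s' \<Longrightarrow>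
      wp c (\<lambda>s'' k''. I (Suc i) (s''\<lparr>nats := set_cell (nats s'') v 0 (Suc i)\<rparr>) \<and> k'' \<le> k' + tb) s' k'"
    and fin: "\<And>s' k'. I N s' \<Longrightarrow> nats s' v 0 = N \<Longrightarrow> same (For v e c) s s' \<Longrightarrow>
      k' \<le> k + N * (tb + 2) + 2 \<Longrightarrow> Q s' k'"
  shows "wp (For v e c) Q s k"
proof (rule wp_For_gen[where N = N and I = "\<lambda>i s' k'. I i s' \<and> k' \<le> k + i * (tb + 2) + 1"])
  fix i s' k'
  assume "i < N" "I i s' \<and> k' \<le> k + i * (tb + 2) + 1" "nats s' v 0 = i" "same (For v e c) s s'"
  then show "wp c (\<lambda>s'' k''. I (Suc i) (s''\<lparr>nats := set_cell (nats s'') v 0 (Suc i)\<rparr>) \<and>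
      k'' + 1 \<le> k + Suc i * (tb + 2) + 1) s' (k' + 1)"
    by (intro wp_mono[OF step]) auto
qed (use assms in auto)

text \<open>For the recovery program, on whose running time nothing is claimed.\<close>

lemma wp_ForU:
  assumes "I 0 (s\<lparr>nats := set_cell (nats s) v 0 0\<rparr>)"
    and "\<And>s'. same (For v e c) s s' \<Longrightarrow> nval e s' = N"
    and "v \<notin> nmods c"
    and "\<And>i s' k'. i < N \<Longrightarrow> I i s' \<Longrightarrow> nats s' v 0 = i \<Longrightarrow> same (For v e c) s s' \<Longrightarrow>
      wp c (\<lambda>s'' k''. I (Suc i) (s''\<lparr>nats := set_cell (nats s'') v 0 (Suc i)\<rparr>)) s' k'"
    and "\<And>s' k'. I N s' \<Longrightarrow> nats s' v 0 = N \<Longrightarrow> same (For v e c) s s' \<Longrightarrow> Q s' k'"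
  shows "wp (For v e c) Q s k"
  by (rule wp_For_gen[where N = N and I = "\<lambda>i s' k'. I i s'"]) (use assms in auto)

section \<open>Binary strings and the accuracy of partially known digits\<close>

definition agree :: "(nat \<Rightarrow> nat \<Rightarrow> bool) \<Rightarrow> nat \<Rightarrow> nat \<Rightarrow> nat \<Rightarrow> bool" where
  "agree s T p i \<longleftrightarrow> (\<forall>t<T. s p t = s i t)"

text \<open>The class of strings that share \<open>T\<close> bits with string \<open>i\<close> is
  named by its least member. Indices beyond the pointset may belong to the class but cannot name it
  when \<open>i\<close> is in range, since the name is at most \<open>i\<close>.\<close>

definition lab :: "(nat \<Rightarrow> nat \<Rightarrow> bool) \<Rightarrow> nat \<Rightarrow> nat \<Rightarrow> nat" where
  "lab s T i = (LEAST p. agree s T p i)"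

lemma agree_refl: "agree s T i i"
  and agree_sym: "agree s T p i \<Longrightarrow> agree s T i p"
  and agree_trans: "agree s T p i \<Longrightarrow> agree s T i j \<Longrightarrow> agree s T p j"
  and agree_mono: "agree s T p i \<Longrightarrow> T' \<le> T \<Longrightarrow> agree s T' p i"
  and agree_Suc: "agree s (Suc T) p i \<longleftrightarrow> agree s T p i \<and> s p T = s i T"
  unfolding agree_def by (auto simp: less_Suc_eq)

lemma agree_lab: "agree s T (lab s T i) i"
  unfolding lab_def by (rule LeastI) (rule agree_refl)

lemma lab_le: "agree s T p i \<Longrightarrow> lab s T i \<le> p"
  unfolding lab_def by (rule Least_le)

lemma lab_le_self: "lab s T i \<le> i"
  by (simp add: lab_le agree_refl)

lemma lab_eqI: "agree s T p i \<Longrightarrow> (\<And>q. agree s T q i \<Longrightarrow> p \<le> q) \<Longrightarrow> lab s T i = p"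
  unfolding lab_def by (rule Least_equality)

lemma lab_cong: "agree s T i j \<Longrightarrow> lab s T i = lab s T j"
  by (rule lab_eqI) (auto intro: agree_trans agree_lab agree_sym lab_le)

lemma lab_eq_iff: "lab s T i = lab s T j \<longleftrightarrow> agree s T i j"
  by (metis agree_lab agree_sym agree_trans lab_cong)

lemma lab_lab: "lab s T (lab s T i) = lab s T i"
  by (rule lab_cong) (rule agree_lab)

lemma lab_0: "lab s 0 i = 0"
  using lab_le[of s 0 0 i] by (simp add: agree_def)

lemma lab_mono: "T \<le> T' \<Longrightarrow> lab s T i \<le> lab s T' i"
  by (meson agree_lab agree_mono lab_le)

text \<open>Classes only shrink as \<open>T\<close> grows, so a string that names its class
  continues to do so. Hence a string starts to be a name at no more than one position, its branching
  position.\<close>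

lemma lab_fix_mono: "lab s T i = i \<Longrightarrow> T \<le> T' \<Longrightarrow> lab s T' i = i"
  by (metis antisym lab_le_self lab_mono)

text \<open>One step of partition refinement: the members that share the next bit with the naming
  string keep the name, and the first of the others names the class that is split off.\<close>

lemma lab_Suc:
  "lab s (Suc T) i = (if s i T = s (lab s T i) T then lab s T i
     else (LEAST p. lab s T p = lab s T i \<and> s p T \<noteq> s (lab s T i) T))"
proof -
  let ?o = "lab s T i"
  show ?thesis
  proof (cases "s i T = s ?o T")
    case True
    have "lab s (Suc T) i = ?o"
      by (rule lab_eqI) (use True in \<open>auto simp: agree_Suc agree_lab lab_le\<close>)
    with True show ?thesis by simp
  next
    case False
    then have "agree s (Suc T) p i \<longleftrightarrow> lab s T p = ?o \<and> s p T \<noteq> s ?o T" for p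
      by (auto simp: agree_Suc lab_eq_iff)
    with False show ?thesis
      unfolding lab_def[of s "Suc T"] by simp
  qed
qed

section \<open>Branching positions, pointers and known bits\<close>

definition splits :: "(nat \<Rightarrow> nat \<Rightarrow> bool) \<Rightarrow> nat \<Rightarrow> nat \<Rightarrow> (nat \<Rightarrow> nat) \<Rightarrow> (nat \<Rightarrow> nat) \<Rightarrow> bool" where
  "splits s n D par m \<longleftrightarrow> m 0 = 0 \<and> (\<forall>i. 0 < i \<and> i < n \<longrightarrow> m i < D \<and> lab s (m i) i \<noteq> i \<and>
     lab s (Suc (m i)) i = i \<and> par i = lab s (m i) i)"

text \<open>The string whose cells are consulted for bit \<open>t\<close>: pointers are followed
  until the branching position is at most \<open>t\<close>. The test \<open>i \<le> par i\<close>
  makes the recursion terminate for arbitrary \<open>par\<close>; genuine pointers lead to smaller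
  indices.\<close>

function own :: "(nat \<Rightarrow> nat) \<Rightarrow> (nat \<Rightarrow> nat) \<Rightarrow> nat \<Rightarrow> nat \<Rightarrow> nat" where
  "own par m i t = (if m i \<le> t \<or> i \<le> par i then i else own par m (par i) t)"
  by auto
termination by (relation "Wellfounded.measure (\<lambda>(par, m, i, t). i)") auto

declare own.simps [simp del]

text \<open>While \<open>t < m i\<close>, string \<open>i\<close> and the target of its pointer
  agree through bit \<open>t\<close>, so moving to the target does not change the class; once
  \<open>m i \<le> t\<close>, string \<open>i\<close> names that class. Strings that agree through
  bit \<open>t\<close> therefore consult the same cell, whatever it contains.\<close>

lemma own_eq_lab:
  assumes "splits s n D par m" "i < n"
  shows "own par m i t = lab s (Suc t) i"
  using assms(2)
proof (induction i rule: less_induct)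
  case (less i)
  show ?case
  proof (cases "i = 0")
    case True
    then show ?thesis
      using lab_le_self[of s "Suc t" 0] assms(1) by (simp add: own.simps splits_def)
  next
    case False
    then have m: "lab s (m i) i \<noteq> i" "lab s (Suc (m i)) i = i" "par i = lab s (m i) i"
      using assms(1) less.prems unfolding splits_def by auto
    then have p: "par i < i"
      using lab_le_self[of s "m i" i] by simp
    show ?thesis
    proof (cases "m i \<le> t")
      case True
      then show ?thesis
        using lab_fix_mono[OF m(2), of "Suc t"] by (simp add: own.simps)
    next
      case f: False
      have "agree s (Suc t) (par i) i"
        unfolding m(3) by (rule agree_mono[OF agree_lab]) (use f in simp)
      then have "lab s (Suc t) i = lab s (Suc t) (par i)"
        by (metis lab_cong)
      then show ?thesis
        using less.IH[OF p] p less.prems f by (subst own.simps) simp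
    qed
  qed
qed

text \<open>\<open>v\<close> stands for the table rebuilt by the decoder. Outside the stored windows
  its entries are left open.\<close>

definition covers :: "(nat \<Rightarrow> nat \<Rightarrow> bool) \<Rightarrow> nat \<Rightarrow> nat \<Rightarrow> (nat \<Rightarrow> nat) \<Rightarrow> (nat \<Rightarrow> nat) \<Rightarrow>
    (nat \<Rightarrow> nat \<Rightarrow> nat) \<Rightarrow> bool" where
  "covers s n W par m v \<longleftrightarrow> (\<forall>i r. 0 < i \<and> i < n \<and> r < W \<longrightarrow>
     v i (m i + r) = of_bool (s i (m i + r)) \<and> v (par i) (m i + r) = of_bool (s (par i) (m i + r)))"

text \<open>The owner \<open>a\<close> of bit \<open>t\<close> of string \<open>i\<close> either branched off after position \<open>T\<close>, and then the bit is in
  its own block, or it was the first string with this \<open>T\<close>-bit prefix, and then the first string to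
  branch off from it after \<open>T\<close> has caused the bit to be written down.\<close>

lemma known_bit:
  assumes sp: "splits s n D par m" and cov: "covers s n W par m v"
    and i: "i < n" and j: "j < n" and ag: "agree s T i j" and ne: "s i T \<noteq> s j T"
    and t: "T \<le> t" "t < T + W"
  shows "v (own par m i t) t = of_bool (s i t)"
proof -
  define a where "a = lab s (Suc t) i"
  have own: "own par m i t = a"
    unfolding a_def by (rule own_eq_lab[OF sp i])
  have ai: "agree s (Suc t) a i"
    unfolding a_def by (rule agree_lab)
  then have sa: "s a t = s i t" by (simp add: agree_Suc)
  have fix_a: "lab s (Suc t) a = a"
    unfolding a_def by (rule lab_lab)
  have an: "a < n"
    using i lab_le_self[of s "Suc t" i] unfolding a_def by simp
  have sp': "m r < D \<and> lab s (m r) r \<noteq> r \<and> lab s (Suc (m r)) r = r \<and> par r = lab s (m r) r"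
    if "0 < r" "r < n" for r
    using sp that unfolding splits_def by blast
  have cov': "v r t = of_bool (s r t) \<and> v (par r) t = of_bool (s (par r) t)"
    if "0 < r" "r < n" "m r \<le> t" "t < m r + W" for r
  proof -
    have "t - m r < W" "m r + (t - m r) = t" using that by auto
    then show ?thesis using cov that unfolding covers_def by metis
  qed
  have uniq: "m r = T'" if "0 < r" "r < n" "lab s T' r \<noteq> r" "lab s (Suc T') r = r" for r T'
  proof (rule ccontr)
    assume "m r \<noteq> T'"
    then consider "Suc (m r) \<le> T'" | "Suc T' \<le> m r" by linarith
    then show False
      using sp'[OF that(1,2)] that(3,4) lab_fix_mono by cases blast+
  qed
  show ?thesis
  proof (cases "a \<noteq> 0 \<and> T \<le> m a")
    case True
    have "m a \<le> t"
    proof (rule ccontr)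
      assume "\<not> m a \<le> t"
      then have "lab s (m a) a = a" using fix_a lab_fix_mono by (metis Suc_le_eq not_le)
      then show False using sp'[of a] True an by simp
    qed
    then show ?thesis
      using cov'[of a] True an t sa own by simp
  next
    case False
    have fixT: "lab s T a = a"
    proof (cases "a = 0")
      case True
      then show ?thesis using lab_le_self[of s T 0] by simp
    next
      case a0: False
      then show ?thesis
        using False sp'[of a] an lab_fix_mono[of s "Suc (m a)" a T] by simp
    qed
    \<comment> \<open>\<open>R\<close> collects the strings that share \<open>T\<close> bits with
      the owner but part from it by bit \<open>t\<close>; \<open>j\<close> is one of them. The least
      such string points to the owner, and its window, which starts between \<open>T\<close> and
      \<open>t\<close>, contains bit \<open>t\<close>.\<close>
    define R where "R r \<longleftrightarrow> agree s T r a \<and> \<not> agree s (Suc t) r a" for r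
    have aiT: "agree s T a i" using ai t by (auto intro: agree_mono)
    have Rj: "R j"
    proof -
      have "agree s T j a" using ag aiT by (metis agree_sym agree_trans)
      moreover have "\<not> agree s (Suc t) j a"
      proof
        assume "agree s (Suc t) j a"
        then have "agree s (Suc T) j i" using ai t by (metis agree_trans agree_mono Suc_le_mono)
        then show False using ne by (simp add: agree_Suc)
      qed
      ultimately show ?thesis unfolding R_def by simp
    qed
    define r where "r = (LEAST r. R r)"
    have Rr: "R r" unfolding r_def using Rj by (rule LeastI)
    have rn: "r < n" using Least_le[of R j] Rj j unfolding r_def by simp
    have min: "\<not> R p" if "p < r" for p using that not_less_Least unfolding r_def by blast
    define T' where "T' = (LEAST T'. \<not> agree s (Suc T') r a)"
    have T'1: "\<not> agree s (Suc T') r a"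
      unfolding T'_def by (rule LeastI[of "\<lambda>T'. \<not> agree s (Suc T') r a" t]) (use Rr in \<open>simp add: R_def\<close>)
    have T't: "T' \<le> t"
      unfolding T'_def by (rule Least_le) (use Rr in \<open>simp add: R_def\<close>)
    have T'2: "agree s T' r a"
    proof (cases T')
      case (Suc T'')
      then show ?thesis using not_less_Least[of T'' "\<lambda>T'. \<not> agree s (Suc T') r a"] T'_def by auto
    qed (simp add: agree_def)
    have TT': "T \<le> T'"
    proof (rule ccontr)
      assume "\<not> T \<le> T'"
      then have "agree s (Suc T') r a" using Rr unfolding R_def by (auto intro: agree_mono)
      then show False using T'1 by simp
    qed
    have l1: "lab s T' r = a"
    proof (rule lab_eqI)
      show "agree s T' a r" using T'2 by (rule agree_sym)
      fix q assume "agree s T' q r"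
      then have "agree s T q a" using T'2 TT' by (metis agree_trans agree_mono)
      then show "a \<le> q" using lab_le fixT by metis
    qed
    have l2: "lab s (Suc T') r = r"
    proof (rule lab_eqI)
      show "agree s (Suc T') r r" by (rule agree_refl)
      fix q assume q: "agree s (Suc T') q r"
      then have "agree s T' q a" using T'2 by (metis agree_trans agree_mono le_SucI order_refl)
      then have "agree s T q a" using TT' by (rule agree_mono)
      moreover have "\<not> agree s (Suc T') q a" using q T'1 by (metis agree_sym agree_trans)
      then have "\<not> agree s (Suc t) q a" using T't by (meson agree_mono Suc_le_mono)
      ultimately have "R q" unfolding R_def by simp
      then show "r \<le> q" using min by (meson not_le)
    qed
    have ra: "r \<noteq> a" using T'1 agree_refl by metis
    then have "0 < r" using l1 lab_le_self[of s T' r] by simp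
    with uniq[of r T'] rn l1 l2 ra have "m r = T'" by auto
    moreover have "par r = a" using sp'[of r] \<open>0 < r\<close> rn l1 \<open>m r = T'\<close> by simp
    ultimately show ?thesis
      using cov'[of r] \<open>0 < r\<close> rn T't TT' t sa own by simp
  qed
qed

section \<open>Binary digits, grid cells and accuracy\<close>

definition dig :: "real \<Rightarrow> nat \<Rightarrow> bool" where
  "dig y h \<longleftrightarrow> 1 \<le> 2 * frac (2 ^ h * y)"

text \<open>Doubling a fractional part and subtracting 1 on overflow is how digits are produced on a
  machine without a floor; the loops over levels repeat exactly this step.\<close>

lemma frac_double:
  fixes z :: real
  shows "frac (2 * z) = 2 * frac z - of_bool (1 \<le> 2 * frac z)"
    and "\<lfloor>2 * z\<rfloor> = 2 * \<lfloor>z\<rfloor> + of_bool (1 \<le> 2 * frac z)"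
proof -
  have z: "z = of_int \<lfloor>z\<rfloor> + frac z" by (simp add: frac_def)
  have f: "0 \<le> frac z" "frac z < 1" by (auto simp: frac_lt_1)
  show fl: "\<lfloor>2 * z\<rfloor> = 2 * \<lfloor>z\<rfloor> + of_bool (1 \<le> 2 * frac z)"
    by (rule floor_unique) (use z f in \<open>auto simp: of_bool_def\<close>)
  show "frac (2 * z) = 2 * frac z - of_bool (1 \<le> 2 * frac z)"
    unfolding frac_def[of "2 * z"] fl using z by (simp add: of_bool_def)
qed

lemma frac_pow_Suc:
  fixes y :: real
  shows "frac (2 ^ Suc h * y) = 2 * frac (2 ^ h * y) - of_bool (dig y h)"
    and "\<lfloor>2 ^ Suc h * y\<rfloor> = 2 * \<lfloor>2 ^ h * y\<rfloor> + of_bool (dig y h)"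
  using frac_double[of "2 ^ h * y"] unfolding dig_def by (auto simp: mult.assoc)

lemma digit_expansion:
  fixes y :: real
  assumes "0 \<le> y" "y < 1"
  shows "y = (\<Sum>h<Q. of_bool (dig y h) / 2 ^ Suc h) + frac (2 ^ Q * y) / 2 ^ Q"
proof (induction Q)
  case 0
  then show ?case using assms by (simp add: frac_eq)
next
  case (Suc Q)
  have "frac (2 ^ Q * y) / 2 ^ Q = of_bool (dig y Q) / 2 ^ Suc Q + frac (2 ^ Suc Q * y) / 2 ^ Suc Q"
    unfolding frac_pow_Suc(1) by (simp add: field_simps)
  then show ?case using Suc by simp
qed

lemma L2_set_sqrt: "L2_set f {..<d} = sqrt (\<Sum>k<d. (f k)\<^sup>2)"
  by (simp add: L2_set_def)

lemma L2_set_le_const: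
  assumes "\<And>k. k < d \<Longrightarrow> \<bar>f k\<bar> \<le> e" "0 \<le> e"
  shows "L2_set f {..<d} \<le> sqrt (real d) * e"
proof -
  have "(\<Sum>k<d. (f k)\<^sup>2) \<le> (\<Sum>k<d. e\<^sup>2)"
    by (rule sum_mono) (metis assms abs_le_square_iff abs_of_nonneg lessThan_iff)
  then have "sqrt (\<Sum>k<d. (f k)\<^sup>2) \<le> sqrt (real d * e\<^sup>2)" by simp
  then show ?thesis using assms(2) by (simp add: L2_set_sqrt real_sqrt_mult)
qed

lemma sqrt_nat_le: "sqrt (real d) \<le> real d"
proof (cases "d = 0")
  case False
  then have "real d * 1 \<le> real d * real d" by (intro mult_left_mono) auto
  then show ?thesis by (intro real_le_lsqrt) (auto simp: power2_eq_square)
qed simp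

lemma L2_set_diff: "\<bar>L2_set f A - L2_set g A\<bar> \<le> L2_set (\<lambda>k. f k - g k) A"
proof -
  have "L2_set f A \<le> L2_set (\<lambda>k. f k - g k) A + L2_set g A" for f g :: "'a \<Rightarrow> real"
    using L2_set_triangle_ineq[of "\<lambda>k. f k - g k" g A] by simp
  from this[of f g] this[of g f] show ?thesis
    by (simp add: L2_set_def power2_commute abs_le_iff)
qed

text \<open>The error that remains when all levels before \<open>A\<close> cancel: a digit of a
  difference is off by at most 2, and what follows after level \<open>Q\<close> amounts to at most
  one unit of that level.\<close>

lemma geometric_tail:
  assumes "A \<le> Q"
  shows "(\<Sum>h=A..<Q. 2 / 2 ^ Suc h) + 1 / 2 ^ Q \<le> (2::real) / 2 ^ A"
proof -
  have "(\<Sum>h=A..<Q. 2 / 2 ^ Suc h) + 2 / 2 ^ Q = (2::real) / 2 ^ A"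
    using assms by (induction Q rule: dec_induct) (simp_all add: field_simps)
  moreover have "(1::real) / 2 ^ Q \<le> 2 / 2 ^ Q" by (simp add: divide_right_mono)
  ultimately show ?thesis by linarith
qed

text \<open>\<open>y\<close> keeps a distance of at least 1 / M of the cell side from the grid lines
  of the levels 1 to \<open>H\<close>. The exponent is \<open>Suc h\<close> because digit
  \<open>h\<close> is decided by the lines of level \<open>Suc h\<close>.\<close>

definition good_num :: "nat \<Rightarrow> nat \<Rightarrow> real \<Rightarrow> bool" where
  "good_num M H y \<longleftrightarrow> (\<forall>h<H. 1 \<le> real M * frac (2 ^ Suc h * y) \<and> real M * frac (2 ^ Suc h * y) \<le> real M - 1)"

text \<open>The digit is the parity of the floor, so \<open>y\<close> and \<open>z\<close> lie in
  different cells of level \<open>Suc h\<close>, and the segment between them crosses the margin on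
  one side of \<open>y\<close>. Nothing is asked of \<open>z\<close>, which is why one good point in
  a pair is enough.\<close>

lemma good_num_separated:
  assumes g: "good_num M H y" and h: "h < H" and ne: "dig y h \<noteq> dig z h"
  shows "1 \<le> real M * 2 ^ Suc h * \<bar>y - z\<bar>"
proof -
  define Y where "Y = 2 ^ Suc h * y"
  define Z where "Z = 2 ^ Suc h * z"
  have "\<lfloor>Y\<rfloor> \<noteq> \<lfloor>Z\<rfloor>"
    unfolding Y_def Z_def frac_pow_Suc(2) using ne by (cases "dig y h"; cases "dig z h"; simp; presburger)
  then have "Z < of_int \<lfloor>Y\<rfloor> \<or> of_int \<lfloor>Y\<rfloor> + 1 \<le> Z" by linarith
  moreover have "1 \<le> real M * frac Y" "real M * frac Y \<le> real M - 1"
    using g h unfolding good_num_def Y_def by auto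
  moreover have "Y = of_int \<lfloor>Y\<rfloor> + frac Y" by (simp add: frac_def)
  ultimately have "frac Y \<le> \<bar>Y - Z\<bar> \<or> 1 - frac Y \<le> \<bar>Y - Z\<bar>" by linarith
  then have "real M * frac Y \<le> real M * \<bar>Y - Z\<bar> \<or> real M * (1 - frac Y) \<le> real M * \<bar>Y - Z\<bar>"
    by (auto intro: mult_left_mono)
  then have "1 \<le> real M * \<bar>Y - Z\<bar>"
    using \<open>1 \<le> real M * frac Y\<close> \<open>real M * frac Y \<le> real M - 1\<close>
    unfolding right_diff_distrib by linarith
  also have "\<bar>Y - Z\<bar> = 2 ^ Suc h * \<bar>y - z\<bar>"
    unfolding Y_def Z_def by (simp add: right_diff_distrib[symmetric] abs_mult)
  finally show ?thesis by (simp add: mult.assoc)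
qed

definition est :: "nat \<Rightarrow> nat \<Rightarrow> (nat \<Rightarrow> nat \<Rightarrow> nat) \<Rightarrow> (nat \<Rightarrow> nat \<Rightarrow> nat) \<Rightarrow> nat \<Rightarrow> nat \<Rightarrow> real" where
  "est d Q v w i j = L2_set (\<lambda>k. \<Sum>h<Q. (real (v (w i (h * d + k)) (h * d + k)) -
     real (v (w j (h * d + k)) (h * d + k))) / 2 ^ Suc h) {..<d}"

text \<open>Let the strings first differ at level \<open>l\<close>. The margin gives a distance of
  at least 1 / (M 2^(l+1)). Levels before l + \<Lambda> contribute no error, so each coordinate is
  off by at most 2 / 2^(l+\<Lambda>) and the norm by at most \<open>d\<close> times this. The
  quotient of the two is 4 M d / 2^\<Lambda>, which explains the hypothesis on \<Lambda>.\<close>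

theorem est_accurate:
  assumes d: "0 < d" and M: "0 < M" and eps: "0 < \<epsilon>" and Lam: "4 * real M * real d \<le> 2 ^ \<Lambda> * \<epsilon>"
    and y: "\<And>i k. i < n \<Longrightarrow> k < d \<Longrightarrow> 0 \<le> y i k \<and> y i k < 1"
    and s: "\<And>i h k. i < n \<Longrightarrow> k < d \<Longrightarrow> s i (h * d + k) = dig (y i k) h"
    and sp: "splits s n (d * H) par m"
    and cov: "covers s n (d * \<Lambda>) par m v"
    and v: "\<And>p t. v p t \<le> 1"
    and ij: "i < n" "j < n" "i \<noteq> j"
    and good: "(\<forall>k<d. good_num M H (y i k)) \<or> (\<forall>k<d. good_num M H (y j k))"
  shows "\<bar>est d (H + \<Lambda>) v (own par m) i j - pdist d (y i) (y j)\<bar> \<le> \<epsilon> * pdist d (y i) (y j)"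
proof -
  define T where "T = (LEAST T. s i T \<noteq> s j T)"
  \<comment> \<open>The larger of the two indices names its own class after \<open>d * H\<close>
    bits, so the smaller one cannot belong to that class.\<close>
  have "\<exists>T<d * H. s i T \<noteq> s j T"
  proof (rule ccontr)
    assume "\<not> ?thesis"
    then have ag: "agree s (d * H) i j" by (auto simp: agree_def)
    have *: "False" if "a < b" "b < n" "agree s (d * H) a b" for a b
    proof -
      have "m b < d * H" "lab s (Suc (m b)) b = b"
        using sp that unfolding splits_def by auto
      then have "lab s (d * H) b = b" by (metis lab_fix_mono Suc_leI)
      then show False using lab_le[OF that(3)] that(1) by simp
    qed
    show False using *[of i j] *[of j i] ag ij agree_sym by (metis nat_neq_iff)
  qed
  then obtain T0 where T0: "T0 < d * H" "s i T0 \<noteq> s j T0" by blast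
  have T: "s i T \<noteq> s j T" unfolding T_def by (rule LeastI) (rule T0)
  have TdH: "T < d * H" using T0 Least_le[of "\<lambda>T. s i T \<noteq> s j T" T0] unfolding T_def by simp
  have ag: "agree s T i j" unfolding agree_def T_def using not_less_Least by blast
  define l k0 where "l = T div d" and "k0 = T mod d"
  have k0: "k0 < d" and Teq: "T = l * d + k0" using d unfolding l_def k0_def by auto
  have lH: "l < H" unfolding l_def using TdH by (simp add: less_mult_imp_div_less mult.commute)
  have dne: "dig (y i k0) l \<noteq> dig (y j k0) l"
    using T s[of i k0 l] s[of j k0 l] ij k0 Teq by simp
  have sep: "1 \<le> real M * 2 ^ Suc l * \<bar>y i k0 - y j k0\<bar>"
    using good
  proof
    assume "\<forall>k<d. good_num M H (y i k)"
    then show ?thesis using good_num_separated[of M H "y i k0" l "y j k0"] lH dne k0 by simp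
  next
    assume "\<forall>k<d. good_num M H (y j k)"
    then have "1 \<le> real M * 2 ^ Suc l * \<bar>y j k0 - y i k0\<bar>"
      using good_num_separated[of M H "y j k0" l "y i k0"] lH dne k0 by simp
    then show ?thesis by (simp add: abs_minus_commute)
  qed
  define D where "D = pdist d (y i) (y j)"
  have "\<bar>y i k0 - y j k0\<bar> \<le> D"
    unfolding D_def pdist_def using member_le_L2_set[of "{..<d}" k0 "\<lambda>k. \<bar>y i k - y j k\<bar>"] k0
    by (simp add: L2_set_def)
  then have D: "1 \<le> real M * 2 ^ Suc l * D"
    using sep by (smt (verit) mult_left_mono of_nat_0_le_iff zero_le_power mult_nonneg_nonneg)
  define Q where "Q = H + \<Lambda>"
  define ei where "ei k h = real (v (own par m i (h * d + k)) (h * d + k)) - of_bool (s i (h * d + k))" for k h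
  define ej where "ej k h = real (v (own par m j (h * d + k)) (h * d + k)) - of_bool (s j (h * d + k))" for k h
  \<comment> \<open>Single digits may well be wrong; what vanishes is the difference of the two
    errors. Before \<open>T\<close> both strings consult the same cell, and from \<open>T\<close> on
    the windows make both digits correct.\<close>
  have e0: "ei k h - ej k h = 0" if hk: "h < l + \<Lambda>" "k < d" for k h
  proof -
    let ?t = "h * d + k"
    have "?t < (h + 1) * d" using that by simp
    also have "\<dots> \<le> (l + \<Lambda>) * d" using that by (intro mult_right_mono) auto
    also have "\<dots> \<le> T + d * \<Lambda>" unfolding Teq by (simp add: algebra_simps)
    finally have tW: "?t < T + d * \<Lambda>" .
    show ?thesis
    proof (cases "?t < T")
      case True
      then have "agree s (Suc ?t) i j" using ag by (auto intro: agree_mono)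
      then have "own par m i ?t = own par m j ?t" "s i ?t = s j ?t"
        using own_eq_lab[OF sp] ij by (auto simp: lab_eq_iff agree_Suc)
      then show ?thesis unfolding ei_def ej_def by simp
    next
      case False
      then have "T \<le> ?t" by simp
      with known_bit[OF sp cov ij(1,2) ag T this tW]
        known_bit[OF sp cov ij(2,1) agree_sym[OF ag] T[symmetric] this tW]
      show ?thesis unfolding ei_def ej_def by simp
    qed
  qed
  have e1: "\<bar>ei k h - ej k h\<bar> \<le> 2" for k h
    unfolding ei_def ej_def using v[of "own par m i (h * d + k)" "h * d + k"]
      v[of "own par m j (h * d + k)" "h * d + k"]
    by (cases "s i (h * d + k)"; cases "s j (h * d + k)"; simp)
  define f where "f k = (\<Sum>h<Q. (real (v (own par m i (h * d + k)) (h * d + k)) -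
     real (v (own par m j (h * d + k)) (h * d + k))) / 2 ^ Suc h)" for k
  have err: "\<bar>f k - (y i k - y j k)\<bar> \<le> 2 / 2 ^ (l + \<Lambda>)" if k: "k < d" for k
  proof -
    have y1: "y i k = (\<Sum>h<Q. of_bool (s i (h * d + k)) / 2 ^ Suc h) + frac (2 ^ Q * y i k) / 2 ^ Q"
      using digit_expansion[of "y i k" Q] y[OF ij(1) k] s[OF ij(1) k] by simp
    have y2: "y j k = (\<Sum>h<Q. of_bool (s j (h * d + k)) / 2 ^ Suc h) + frac (2 ^ Q * y j k) / 2 ^ Q"
      using digit_expansion[of "y j k" Q] y[OF ij(2) k] s[OF ij(2) k] by simp
    have "f k - (y i k - y j k) = (\<Sum>h<Q. (ei k h - ej k h) / 2 ^ Suc h) -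
        (frac (2 ^ Q * y i k) - frac (2 ^ Q * y j k)) / 2 ^ Q"
      unfolding f_def ei_def ej_def
      by (subst y1, subst y2) (simp add: sum_subtractf diff_divide_distrib)
    also have "(\<Sum>h<Q. (ei k h - ej k h) / 2 ^ Suc h) = (\<Sum>h=l + \<Lambda>..<Q. (ei k h - ej k h) / 2 ^ Suc h)"
      by (rule sum.mono_neutral_right) (use e0[OF _ k] in auto)
    finally have "\<bar>f k - (y i k - y j k)\<bar> \<le> \<bar>\<Sum>h=l + \<Lambda>..<Q. (ei k h - ej k h) / 2 ^ Suc h\<bar> +
        \<bar>(frac (2 ^ Q * y i k) - frac (2 ^ Q * y j k)) / 2 ^ Q\<bar>"
      by linarith
    also have "\<dots> \<le> (\<Sum>h=l + \<Lambda>..<Q. 2 / 2 ^ Suc h) + 1 / 2 ^ Q"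
    proof (rule add_mono)
      show "\<bar>\<Sum>h=l + \<Lambda>..<Q. (ei k h - ej k h) / 2 ^ Suc h\<bar> \<le> (\<Sum>h=l + \<Lambda>..<Q. 2 / 2 ^ Suc h)"
        by (rule order_trans[OF sum_abs sum_mono])
          (use e1 in \<open>simp add: abs_divide divide_le_eq del: power_Suc\<close>)
      have "\<bar>frac (2 ^ Q * y i k) - frac (2 ^ Q * y j k)\<bar> \<le> 1"
        using frac_lt_1[of "2 ^ Q * y i k"] frac_lt_1[of "2 ^ Q * y j k"]
          frac_ge_0[of "2 ^ Q * y i k"] frac_ge_0[of "2 ^ Q * y j k"] by linarith
      then show "\<bar>(frac (2 ^ Q * y i k) - frac (2 ^ Q * y j k)) / 2 ^ Q\<bar> \<le> 1 / 2 ^ Q"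
        by (simp add: divide_right_mono)
    qed
    also have "\<dots> \<le> 2 / 2 ^ (l + \<Lambda>)"
      by (rule geometric_tail) (use lH in \<open>simp add: Q_def\<close>)
    finally show ?thesis .
  qed
  have "\<bar>est d Q v (own par m) i j - D\<bar> \<le> L2_set (\<lambda>k. f k - (y i k - y j k)) {..<d}"
    unfolding est_def D_def pdist_def f_def by (rule L2_set_diff)
  also have "\<dots> \<le> sqrt (real d) * (2 / 2 ^ (l + \<Lambda>))"
    by (rule L2_set_le_const) (use err in auto)
  also have "\<dots> \<le> real d * (2 / 2 ^ (l + \<Lambda>))"
    by (rule mult_right_mono[OF sqrt_nat_le]) auto
  also have "\<dots> \<le> real d * (2 / 2 ^ (l + \<Lambda>)) * (real M * 2 ^ Suc l * D)"
    using D by (metis mult.right_neutral mult_left_mono mult_nonneg_nonneg of_nat_0_le_iff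
        divide_nonneg_nonneg zero_le_numeral zero_le_power)
  also have "\<dots> = (4 * real M * real d) / 2 ^ \<Lambda> * D"
    by (simp add: power_add field_simps)
  also have "\<dots> \<le> \<epsilon> * D"
  proof (rule mult_right_mono)
    show "4 * real M * real d / 2 ^ \<Lambda> \<le> \<epsilon>"
      using Lam by (simp add: field_simps)
    show "0 \<le> D" unfolding D_def pdist_def by simp
  qed
  finally show ?thesis unfolding Q_def D_def .
qed

section \<open>Choosing a shift\<close>

definition subm :: "nat \<Rightarrow> nat \<Rightarrow> nat \<Rightarrow> nat" where
  "subm M a b = (if b \<le> a then a - b else a + M - b)"

text \<open>Division by 2 modulo \<open>M\<close>, given as a table: the machine has neither
  multiplication nor division on naturals.\<close>

definition halving :: "nat \<Rightarrow> (nat \<Rightarrow> nat) \<Rightarrow> bool" where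
  "halving M hf \<longleftrightarrow> (\<forall>v<M. hf v < M \<and> (2 * hf v) mod M = v)"

primrec wseq :: "(nat \<Rightarrow> nat) \<Rightarrow> nat \<Rightarrow> nat" where
  "wseq hf 0 = 1"
| "wseq hf (Suc h) = hf (wseq hf h)"

text \<open>Modulo \<open>M\<close>, \<open>jseq M hf u h\<close> is \<open>- \<lfloor>2 ^ h u\<rfloor> / 2 ^ h\<close> and \<open>wseq hf h\<close> is \<open>1 / 2 ^ h\<close>.\<close>

primrec jseq :: "nat \<Rightarrow> (nat \<Rightarrow> nat) \<Rightarrow> real \<Rightarrow> nat \<Rightarrow> nat" where
  "jseq M hf u 0 = 0"
| "jseq M hf u (Suc h) = (if dig u h then subm M (jseq M hf u h) (wseq hf (Suc h)) else jseq M hf u h)"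

lemma subm_less: "a < M \<Longrightarrow> b < M \<Longrightarrow> subm M a b < M"
  unfolding subm_def by auto

lemma subm_cong: "b < M \<Longrightarrow> [int (subm M a b) = int a - int b] (mod int M)"
  unfolding subm_def by (auto simp: of_nat_diff cong_iff_dvd_diff)

lemma wseq_less: "halving M hf \<Longrightarrow> 1 < M \<Longrightarrow> wseq hf h < M"
  by (induction h) (auto simp: halving_def)

lemma wseq_double: "halving M hf \<Longrightarrow> 1 < M \<Longrightarrow> [2 * int (wseq hf (Suc h)) = int (wseq hf h)] (mod int M)"
proof -
  assume "halving M hf" "1 < M"
  then have "[2 * wseq hf (Suc h) = wseq hf h] (mod M)"
    using wseq_less[of M hf h] unfolding halving_def by (simp add: cong_def)
  then show ?thesis by (simp flip: cong_int_iff)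
qed

lemma wseq_inverse: "halving M hf \<Longrightarrow> 1 < M \<Longrightarrow> [2 ^ h * int (wseq hf h) = 1] (mod int M)"
proof (induction h)
  case (Suc h)
  have "[2 ^ h * (2 * int (wseq hf (Suc h))) = 2 ^ h * int (wseq hf h)] (mod int M)"
    by (rule cong_mult[OF cong_refl wseq_double]) (use Suc in auto)
  with Suc show ?case by (auto simp: mult.assoc mult.left_commute intro: cong_trans)
qed auto

lemma jseq_less: "halving M hf \<Longrightarrow> 1 < M \<Longrightarrow> jseq M hf u h < M"
proof (induction h)
  case (Suc h)
  then show ?case using wseq_less[of M hf "Suc h"] by (auto intro: subm_less)
qed auto

lemma jseq_cong:
  assumes "halving M hf" "1 < M" "0 \<le> u" "u < 1"
  shows "[int (jseq M hf u h) = - \<lfloor>2 ^ h * u\<rfloor> * int (wseq hf h)] (mod int M)"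
proof (induction h)
  case 0
  have "\<lfloor>u\<rfloor> = 0" using assms by linarith
  then show ?case by simp
next
  case (Suc h)
  let ?w = "int (wseq hf (Suc h))"
  have 1: "[int (jseq M hf u (Suc h)) = int (jseq M hf u h) - of_bool (dig u h) * ?w] (mod int M)"
    using subm_cong[of "wseq hf (Suc h)" M "jseq M hf u h"] wseq_less[OF assms(1,2), of "Suc h"] by auto
  have "[int (jseq M hf u h) = - \<lfloor>2 ^ h * u\<rfloor> * (2 * ?w)] (mod int M)"
    using Suc cong_mult[OF cong_refl wseq_double[OF assms(1,2), THEN cong_sym]] cong_trans by blast
  then have "[int (jseq M hf u (Suc h)) = - \<lfloor>2 ^ h * u\<rfloor> * (2 * ?w) - of_bool (dig u h) * ?w] (mod int M)"
    using 1 cong_diff[OF _ cong_refl] cong_trans by blast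
  moreover have "- \<lfloor>2 ^ h * u\<rfloor> * (2 * ?w) - of_bool (dig u h) * ?w = - \<lfloor>2 ^ Suc h * u\<rfloor> * ?w"
    unfolding frac_pow_Suc(2) by (simp add: algebra_simps del: wseq.simps)
  ultimately show ?case by simp
qed

text \<open>With \<open>A = \<lfloor>2 ^ h * u\<rfloor> + 2 ^ h * j\<close>, the scaled fractional
  part is \<open>A mod M\<close> plus a number in [0, 1). It falls outside [1, M - 1] only if
  \<open>A\<close> is 0 or -1 modulo \<open>M\<close>. Multiplying by the inverse of
  \<open>2 ^ h\<close> leaves one value of \<open>j\<close> in either case.\<close>

lemma bad_shift:
  assumes hf: "halving M hf" and M: "1 < M" and u: "0 \<le> u" "u < 1" and j: "j < M"
    and bad: "\<not> (1 \<le> real M * frac (2 ^ h * ((u + real j) / real M)) \<and>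
      real M * frac (2 ^ h * ((u + real j) / real M)) \<le> real M - 1)"
  shows "j = jseq M hf u h \<or> j = subm M (jseq M hf u h) (wseq hf h)"
proof -
  define Z where "Z = \<lfloor>2 ^ h * u\<rfloor>"
  define \<phi> where "\<phi> = frac (2 ^ h * u)"
  define A where "A = Z + 2 ^ h * int j"
  define r where "r = A mod int M"
  define q where "q = A div int M"
  have \<phi>: "0 \<le> \<phi>" "\<phi> < 1" unfolding \<phi>_def by (auto simp: frac_lt_1)
  have r: "0 \<le> r" "r < int M" unfolding r_def using M by auto
  have A: "A = q * int M + r" unfolding q_def r_def by simp
  have r': "real_of_int r \<le> real M - 1" using r(2) by linarith
  have "2 ^ h * ((u + real j) / real M) = (of_int A + \<phi>) / real M"
    unfolding A_def \<phi>_def Z_def frac_def by (simp add: field_simps)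
  also have "\<dots> = of_int q + (of_int r + \<phi>) / real M"
    unfolding A using M by (simp add: field_simps)
  finally have "frac (2 ^ h * ((u + real j) / real M)) = frac ((of_int r + \<phi>) / real M)"
    by (simp add: frac_def)
  also have "\<dots> = (of_int r + \<phi>) / real M"
    using r r' \<phi> M by (subst frac_eq) (auto simp: divide_less_eq)
  finally have "real M * frac (2 ^ h * ((u + real j) / real M)) = of_int r + \<phi>"
    using M by simp
  with bad have "of_int r + \<phi> < 1 \<or> real M - 1 < of_int r + \<phi>" by auto
  then have "r = 0 \<or> r = int M - 1"
  proof
    assume "of_int r + \<phi> < 1"
    then have "r < 1" using \<phi> by linarith
    then show ?thesis using r by simp
  next
    assume "real M - 1 < of_int r + \<phi>"
    then have "int M - 1 < r + 1" using \<phi> by linarith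
    then show ?thesis using r by simp
  qed
  moreover have "[A = r] (mod int M)" unfolding r_def by simp
  moreover have "[A = -1] (mod int M)" if "[A = int M - 1] (mod int M)"
    using cong_trans[OF that, of "-1"] by (simp add: cong_iff_dvd_diff)
  ultimately have "[A = 0] (mod int M) \<or> [A = -1] (mod int M)"
    by auto
  \<comment> \<open>Both residues are written as \<open>- e\<close>, so that one computation serves
    them: \<open>e = 0\<close> leads to \<open>jseq\<close>, and \<open>e = 1\<close> subtracts
    \<open>wseq\<close> once more.\<close>
  then obtain e where e: "[A = - int e] (mod int M)" "e = 0 \<or> e = 1"
    by (elim disjE) (metis (no_types) int_ops(1) minus_zero, metis (no_types) int_ops(2))
  let ?w = "int (wseq hf h)"
  have "[int j = 2 ^ h * ?w * int j] (mod int M)"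
    using cong_mult[OF wseq_inverse[OF hf M, of h, THEN cong_sym] cong_refl, of "int j"] by simp
  also have "2 ^ h * ?w * int j = A * ?w - Z * ?w" unfolding A_def by (simp add: algebra_simps)
  also have "[A * ?w - Z * ?w = - int e * ?w - Z * ?w] (mod int M)"
    using e by (intro cong_diff cong_mult) auto
  also have "- int e * ?w - Z * ?w = - Z * ?w - int e * ?w" by simp
  also have "[- Z * ?w - int e * ?w = int (jseq M hf u h) - int e * ?w] (mod int M)"
    using jseq_cong[OF hf M u, of h] unfolding Z_def by (intro cong_diff) (auto intro: cong_sym)
  finally have c: "[int j = int (jseq M hf u h) - int e * ?w] (mod int M)" .
  from e(2) show ?thesis
  proof
    assume "e = 0"
    with c have "[j = jseq M hf u h] (mod M)" by (simp add: cong_int_iff)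
    then show ?thesis using j jseq_less[OF hf M] by (simp add: cong_def)
  next
    assume "e = 1"
    with c have "[int j = int (subm M (jseq M hf u h) (wseq hf h))] (mod int M)"
      using subm_cong[OF wseq_less[OF hf M], of "jseq M hf u h" h] by (auto intro: cong_trans cong_sym)
    then have "[j = subm M (jseq M hf u h) (wseq hf h)] (mod M)" by (simp add: cong_int_iff)
    then show ?thesis
      using j subm_less[OF jseq_less[OF hf M] wseq_less[OF hf M]]
      by (simp add: cong_def)
  qed
qed

lemma double_mod_inj:
  fixes a b M :: nat
  assumes "odd M" "a < M" "b < M" "(2 * a) mod M = (2 * b) mod M"
  shows "a = b"
proof -
  have "[2 * a = 2 * b] (mod M)" using assms by (simp add: cong_def)
  then have "[a = b] (mod M)" using assms(1) by (metis cong_mult_lcancel_nat coprime_left_2_iff_odd)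
  then show ?thesis using assms by (simp add: cong_def)
qed

text \<open>Doubling is injective on the residues of an odd modulus, hence a permutation of them; a
  table filled at the doubled positions therefore has no gaps.\<close>

lemma halving_exists:
  assumes "odd M" "\<And>v. v < M \<Longrightarrow> hf ((2 * v) mod M) = v"
  shows "halving M hf"
proof -
  have inj: "inj_on (\<lambda>v. (2 * v) mod M) {..<M}"
  proof (rule inj_onI)
    fix a b assume "a \<in> {..<M}" "b \<in> {..<M}" "(2 * a) mod M = (2 * b) mod M"
    then show "a = b" using double_mod_inj[OF assms(1), of a b] by simp
  qed
  have "(\<lambda>v. (2 * v) mod M) ` {..<M} = {..<M}"
    by (rule endo_inj_surj) (use inj in auto)
  then show ?thesis
    unfolding halving_def using assms(2)
    by (metis (mono_tags, lifting) imageE lessThan_iff)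
qed

text \<open>An upper bound for the number of bad levels of \<open>u\<close> under shift
  \<open>j\<close>. It is phrased through the two candidates of each level, so that it can be
  counted without testing every shift.\<close>

definition bads :: "nat \<Rightarrow> (nat \<Rightarrow> nat) \<Rightarrow> nat \<Rightarrow> real \<Rightarrow> nat \<Rightarrow> nat" where
  "bads M hf H u j = (\<Sum>h<H. of_bool (jseq M hf u (Suc h) = j) +
     of_bool (subm M (jseq M hf u (Suc h)) (wseq hf (Suc h)) = j))"

lemma sum_bads:
  assumes "halving M hf" "1 < M"
  shows "(\<Sum>j<M. bads M hf H u j) = 2 * H"
proof -
  have one: "(\<Sum>j<M. of_bool (a = j)) = (1::nat)" if "a < M" for a
    using that by (simp add: of_bool_def)
  have "(\<Sum>j<M. bads M hf H u j) = (\<Sum>h<H. (\<Sum>j<M. of_bool (jseq M hf u (Suc h) = j)) +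
     (\<Sum>j<M. of_bool (subm M (jseq M hf u (Suc h)) (wseq hf (Suc h)) = j)))"
    unfolding bads_def by (subst sum.swap) (simp only: sum.distrib)
  also have "\<dots> = (\<Sum>h<H. 1 + 1)"
    by (intro sum.cong refl arg_cong2[where f = "(+)"] one subm_less jseq_less wseq_less assms)
  finally show ?thesis by simp
qed

lemma bads_pos:
  assumes "halving M hf" "1 < M" "0 \<le> u" "u < 1" "j < M"
    and "\<not> good_num M H ((u + real j) / real M)"
  shows "1 \<le> bads M hf H u j"
proof -
  obtain h where h: "h < H" "j = jseq M hf u (Suc h) \<or> j = subm M (jseq M hf u (Suc h)) (wseq hf (Suc h))"
    using assms(6) bad_shift[OF assms(1-5)] unfolding good_num_def by blast
  have "1 \<le> (of_bool (jseq M hf u (Suc h) = j) +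
     of_bool (subm M (jseq M hf u (Suc h)) (wseq hf (Suc h)) = j) :: nat)"
    using h(2) by (elim disjE) (simp_all del: jseq.simps wseq.simps)
  also have "\<dots> \<le> bads M hf H u j"
    unfolding bads_def by (rule member_le_sum[of h]) (use h in auto)
  finally show ?thesis .
qed

text \<open>Averaging: all shifts together have \<open>2 * n * d * H\<close> incidences, so the best
  of the \<open>M > 4 * d * H\<close> shifts has fewer than n / 2 of them, and a point with a bad
  coordinate accounts for at least one.\<close>

lemma few_bad_points:
  assumes hf: "halving M hf" and M: "M = 4 * d * H + 1" and d: "0 < d" and H: "0 < H" and n: "0 < n"
    and u: "\<And>p. p < n * d \<Longrightarrow> 0 \<le> u p \<and> u p < 1"
    and j: "j < M" and min: "\<And>j'. j' < M \<Longrightarrow> (\<Sum>p<n * d. bads M hf H (u p) j) \<le> (\<Sum>p<n * d. bads M hf H (u p) j')"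
  shows "2 * card {i. i < n \<and> \<not> (\<forall>k<d. good_num M H ((u (i * d + k) + real j) / real M))} < n"
proof -
  let ?B = "\<lambda>j. \<Sum>p<n * d. bads M hf H (u p) j"
  have M1: "1 < M" using M d H by simp
  have "M * ?B j = (\<Sum>j'<M. ?B j)" by simp
  also have "\<dots> \<le> (\<Sum>j'<M. ?B j')" by (rule sum_mono) (use min in auto)
  also have "\<dots> = (\<Sum>p<n * d. \<Sum>j'<M. bads M hf H (u p) j')" by (rule sum.swap)
  also have "\<dots> = n * d * (2 * H)" by (simp add: sum_bads[OF hf M1])
  finally have *: "M * ?B j \<le> n * d * (2 * H)" .
  have "2 * ?B j < n"
  proof (rule ccontr)
    assume "\<not> ?thesis"
    then have "M * n \<le> M * (2 * ?B j)" by simp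
    also have "\<dots> = 2 * (M * ?B j)" by simp
    also have "\<dots> \<le> 2 * (n * d * (2 * H))" using * by (rule mult_left_mono) simp
    also have "\<dots> = n * d * (4 * H)" by simp
    also have "\<dots> < M * n" using n unfolding M by (simp add: algebra_simps)
    finally show False by simp
  qed
  moreover have "card {i. i < n \<and> \<not> (\<forall>k<d. good_num M H ((u (i * d + k) + real j) / real M))} \<le> ?B j"
  proof -
    let ?bad = "\<lambda>i. \<not> (\<forall>k<d. good_num M H ((u (i * d + k) + real j) / real M))"
    have "card {i. i < n \<and> ?bad i} = (\<Sum>i<n. of_bool (?bad i))"
      by (simp add: of_bool_def sum.If_cases Int_def lessThan_def)
    also have "\<dots> \<le> (\<Sum>i<n. \<Sum>p=i*d..<i*d+d. bads M hf H (u p) j)"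
    proof (rule sum_mono)
      fix i assume i: "i \<in> {..<n}"
      show "of_bool (?bad i) \<le> (\<Sum>p=i*d..<i*d+d. bads M hf H (u p) j)"
      proof (cases "?bad i")
        case True
        then obtain k where k: "k < d" "\<not> good_num M H ((u (i * d + k) + real j) / real M)" by blast
        have "i * d + k < (i + 1) * d" using k by simp
        also have "\<dots> \<le> n * d" using i by (intro mult_right_mono) auto
        finally have "1 \<le> bads M hf H (u (i * d + k)) j"
          using bads_pos[OF hf M1 _ _ j k(2)] u by blast
        also have "\<dots> \<le> (\<Sum>p=i*d..<i*d+d. bads M hf H (u p) j)"
          by (rule member_le_sum[of "i*d+k"]) (use k in auto)
        finally show ?thesis using True by simp
      qed simp
    qed
    also have "\<dots> = ?B j" by (rule sum.nat_group)
    finally show ?thesis .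
  qed
  ultimately show ?thesis by linarith
qed

section \<open>The format of the sketch\<close>

definition unary :: "nat \<Rightarrow> bool list" where
  "unary g = replicate g True @ [False]"

definition binary :: "nat \<Rightarrow> nat \<Rightarrow> bool list" where
  "binary w v = map (\<lambda>r. odd (v div 2 ^ (w - Suc r))) [0..<w]"

definition block :: "(nat \<Rightarrow> bool) \<Rightarrow> nat \<Rightarrow> nat \<Rightarrow> bool list" where
  "block S st W = map (\<lambda>r. S (st + r)) [0..<W]"

definition record_bits ::
  "nat \<Rightarrow> nat \<Rightarrow> (nat \<Rightarrow> nat \<Rightarrow> bool) \<Rightarrow> (nat \<Rightarrow> nat) \<Rightarrow> (nat \<Rightarrow> nat) \<Rightarrow> nat \<Rightarrow> bool list" where
  "record_bits w W S par m i =
     binary w (par i) @ binary w (m i) @ block (S i) (m i) W @ block (S (par i)) (m i) W"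

text \<open>Unary fields delimit themselves. The size of the pointset is not part of a round: after
  the first round the decoder gets it by counting the unset flags of the round before. A record
  contains the window of the target as well, since these bits of the target may occur nowhere
  else.\<close>

definition round_bits :: "nat \<Rightarrow> nat \<Rightarrow> nat \<Rightarrow> nat \<Rightarrow> nat \<Rightarrow> (nat \<Rightarrow> bool) \<Rightarrow> (nat \<Rightarrow> nat \<Rightarrow> bool) \<Rightarrow>
    (nat \<Rightarrow> nat) \<Rightarrow> (nat \<Rightarrow> nat) \<Rightarrow> bool list" where
  "round_bits d n g \<Lambda> w fl S par m = unary g @ unary \<Lambda> @ unary w @ map fl [0..<n] @
     concat (map (\<lambda>i. record_bits w (d * \<Lambda>) S par m (Suc i)) [0..<n - 1])"

text \<open>The power of 2 whose exponent has the binary digits \<open>e\<close>, most significant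
  first, as a product of repeated squares. This spends only \<open>K\<close> bits, doubly
  logarithmic in the scale.\<close>

definition pow_bits :: "nat \<Rightarrow> (nat \<Rightarrow> bool) \<Rightarrow> real" where
  "pow_bits K e = (\<Prod>r<K. if e r then 2 ^ 2 ^ (K - Suc r) else 1)"

definition scale :: "bool \<Rightarrow> real \<Rightarrow> real" where
  "scale sg P = (if sg then 4 * P else 4 / P)"

definition header_bits :: "bool \<Rightarrow> nat \<Rightarrow> (nat \<Rightarrow> bool) \<Rightarrow> nat \<Rightarrow> nat \<Rightarrow> bool list" where
  "header_bits sg K e d n = sg # unary K @ map e [0..<K] @ unary d @ unary n"

text \<open>For a point that is passed on, its index in the next round; at \<open>n\<close>, the
  size of the next round.\<close>

definition rank :: "(nat \<Rightarrow> bool) \<Rightarrow> nat \<Rightarrow> nat" where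
  "rank fl i = card {p. p < i \<and> \<not> fl p}"

lemma rank_0 [simp]: "rank fl 0 = 0"
  unfolding rank_def by simp

lemma rank_Suc: "rank fl (Suc i) = (if fl i then rank fl i else Suc (rank fl i))"
proof -
  have "{p. p < Suc i \<and> \<not> fl p} = (if fl i then {} else {i}) \<union> {p. p < i \<and> \<not> fl p}"
    by (auto simp: less_Suc_eq)
  then show ?thesis unfolding rank_def by simp
qed

lemma rank_mono: "i \<le> j \<Longrightarrow> rank fl i \<le> rank fl j"
  unfolding rank_def by (rule card_mono) auto

lemma rank_less: "i < j \<Longrightarrow> \<not> fl i \<Longrightarrow> rank fl i < rank fl j"
  using rank_mono[of "Suc i" j fl] by (simp add: rank_Suc)

lemma rank_le: "rank fl i \<le> i"
  by (induction i) (auto simp: rank_Suc)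

lemma rank_surj: "r < rank fl n \<Longrightarrow> \<exists>i<n. \<not> fl i \<and> rank fl i = r"
proof (induction n)
  case (Suc n)
  then show ?case by (cases "r < rank fl n") (auto simp: rank_Suc less_Suc_eq split: if_splits)
qed auto

text \<open>The contract between encoder and decoder. It covers every table of bits in which the
  stored windows are right, so leftovers of earlier rounds in the decoder's memory are harmless. The
  factor \<open>4 * d * H + 1\<close> is the modulus by which the shifted points were
  divided.\<close>

definition accurate :: "real \<Rightarrow> nat \<Rightarrow> nat \<Rightarrow> (nat \<Rightarrow> nat \<Rightarrow> real) \<Rightarrow> nat \<Rightarrow> nat \<Rightarrow> (nat \<Rightarrow> bool) \<Rightarrow>
    (nat \<Rightarrow> nat \<Rightarrow> bool) \<Rightarrow> (nat \<Rightarrow> nat) \<Rightarrow> (nat \<Rightarrow> nat) \<Rightarrow> bool" where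
  "accurate \<epsilon> d n U H \<Lambda> fl S par m \<longleftrightarrow> (\<forall>v i j. (\<forall>p t. v p t \<le> 1) \<longrightarrow> covers S n (d * \<Lambda>) par m v \<longrightarrow>
     i < n \<longrightarrow> j < n \<longrightarrow> i \<noteq> j \<longrightarrow> fl i \<or> fl j \<longrightarrow>
     \<bar>real (4 * d * H + 1) * est d (H + \<Lambda>) v (own par m) i j - pdist d (U i) (U j)\<bar>
       \<le> \<epsilon> * pdist d (U i) (U j))"

text \<open>Field values, strings and flags of a round are existential witnesses, so the decoder is
  verified against any encoder that meets the contract. With at most one point there is no pair left
  to answer, and any bits may follow.\<close>

inductive valid :: "real \<Rightarrow> nat \<Rightarrow> nat \<Rightarrow> (nat \<Rightarrow> nat \<Rightarrow> real) \<Rightarrow> bool list \<Rightarrow> bool" for \<epsilon> d where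
  valid_last: "n \<le> 1 \<Longrightarrow> valid \<epsilon> d n U bs"
| valid_round: "m 0 = 0 \<Longrightarrow>
    (\<And>i. 0 < i \<Longrightarrow> i < n \<Longrightarrow> par i < i \<and> m i < d * 2 ^ g \<and> par i < 2 ^ w \<and> m i < 2 ^ w) \<Longrightarrow>
    accurate \<epsilon> d n U (2 ^ g) \<Lambda> fl S par m \<Longrightarrow>
    (\<And>i k. i < n \<Longrightarrow> k < d \<Longrightarrow> \<not> fl i \<Longrightarrow> U' (rank fl i) k = U i k) \<Longrightarrow>
    valid \<epsilon> d (rank fl n) U' rest \<Longrightarrow>
    valid \<epsilon> d n U (round_bits d n g \<Lambda> w fl S par m @ rest)"

definition holds_at :: "(nat \<Rightarrow> nat) \<Rightarrow> nat \<Rightarrow> bool list \<Rightarrow> bool" where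
  "holds_at A p bs \<longleftrightarrow> (\<forall>r<length bs. A (p + r) = of_bool (bs ! r))"

lemma holds_at_Nil: "holds_at A p []"
  and holds_at_Cons: "holds_at A p (b # bs) \<longleftrightarrow> A p = of_bool b \<and> holds_at A (Suc p) bs"
  unfolding holds_at_def by (auto simp: less_Suc_eq_0_disj)

lemma holds_at_append: "holds_at A p (xs @ ys) \<longleftrightarrow> holds_at A p xs \<and> holds_at A (p + length xs) ys"
  by (induction xs arbitrary: p) (auto simp: holds_at_Nil holds_at_Cons)

lemma holds_at_map: "holds_at A p (map f [0..<n]) \<longleftrightarrow> (\<forall>r<n. A (p + r) = of_bool (f r))"
  unfolding holds_at_def by simp

lemma holds_at_replicate: "holds_at A p (replicate n b) \<longleftrightarrow> (\<forall>r<n. A (p + r) = of_bool b)"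
  unfolding holds_at_def by auto

lemma holds_at_concat:
  assumes "holds_at A p (concat (map f [0..<n]))" "\<And>i. i < n \<Longrightarrow> length (f i) = L" "i < n"
  shows "holds_at A (p + i * L) (f i)"
  using assms
proof (induction n)
  case (Suc n)
  have "length (concat (map f [0..<n])) = n * L"
    using Suc.prems(2) by (induction n) auto
  with Suc show ?case by (cases "i = n") (auto simp: holds_at_append)
qed auto

lemma length_unary [simp]: "length (unary g) = Suc g"
  and length_binary [simp]: "length (binary w v) = w"
  and length_block [simp]: "length (block f st W) = W"
  and length_record [simp]: "length (record_bits w W S par m i) = 2 * w + 2 * W"
  unfolding unary_def binary_def block_def record_bits_def by auto

lemma length_concat_const: "(\<And>i. i < n \<Longrightarrow> length (f i) = L) \<Longrightarrow> length (concat (map f [0..<n])) = n * L"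
  by (induction n) auto

lemma length_round: "length (round_bits d n g \<Lambda> w fl S par m) =
    g + \<Lambda> + w + 3 + n + (n - 1) * (2 * w + 2 * (d * \<Lambda>))"
  unfolding round_bits_def by (simp add: length_concat_const)

abbreviation V :: "nat \<Rightarrow> nexp" where "V a \<equiv> NCell a (NConst 0)"
abbreviation RV :: "nat \<Rightarrow> rexp" where "RV a \<equiv> RCell a (NConst 0)"
abbreviation NSet :: "nat \<Rightarrow> nexp \<Rightarrow> com" where "NSet a e \<equiv> NAssign a (NConst 0) e"
abbreviation RSet :: "nat \<Rightarrow> rexp \<Rightarrow> com" where "RSet a e \<equiv> RAssign a (NConst 0) e"
abbreviation Inc :: "nat \<Rightarrow> com" where "Inc a \<equiv> NSet a (NAdd (V a) (NConst 1))"
abbreviation RNum :: "nat \<Rightarrow> rexp" where "RNum c \<equiv> ROfNat (NConst c)"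

notation Seq (infixr ";;" 60)

section \<open>The recovery program\<close>

text \<open>Scalars are kept in cell 0 of an array. Arrays of naturals: 2 position in the sketch, 7 \<open>d\<close>,
  8 size of the current pointset, 9 set when done, 10 \<open>g\<close>, 11 \<open>2 ^ g\<close>, 12 \<open>d 2 ^ g\<close>, 13 \<open>\<Lambda>\<close>, 14 \<open>d \<Lambda>\<close>,
  15 length of the strings, 16 width of the binary fields, 17 flags of the good points,
  18 base addresses of the strings, 19 pointers, 20 prefix lengths, 21 bits of the strings,
  25 and 26 the indices of the two points in the current pointset. Arrays of reals: 0 result, 3 scale.
  Array 21 is not cleared between rounds: unknown bits may have any value, as long as they are bits.\<close>

definition read_unary :: "nat \<Rightarrow> com" where
  "read_unary x = (NSet x (NConst 0) ;; While (NLe (NConst 1) (NCell 1 (V 2))) (Inc x ;; Inc 2) ;; Inc 2)"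

lemma mods_read_unary [simp]:
  "nmods (read_unary x) = {x, 2}" "rmods (read_unary x) = {}" "\<not> emits (read_unary x)"
  unfolding read_unary_def by auto

lemma wp_read_unary:
  assumes "holds_at (nats s 1) (nats s 2 0) (unary g)" "x \<noteq> 1" "x \<noteq> 2"
  shows "wp (read_unary x) (\<lambda>s' k'. nats s' x 0 = g \<and> nats s' 2 0 = nats s 2 0 + Suc g) s k"
  unfolding read_unary_def wp_simps
proof (rule wp_While[where B = g and tb = 2
      and I = "\<lambda>i s'. i \<le> g \<and> nats s' x 0 = i \<and> nats s' 2 0 = nats s 2 0 + i"], goal_cases)
  case 1
  then show ?case using assms by (simp add: set_cell_def)
next
  case (2 i s' k')
  have "nats s' 1 = nats s 1" using same_nats[OF 2(2), of 1] assms by (simp add: set_cell_def)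
  moreover have "i < g"
    using 2 assms(1) calculation
    by (cases "i = g") (auto simp: unary_def holds_at_append holds_at_Cons)
  ultimately show ?case using 2 assms by (simp add: wp_simps set_cell_def)
next
  case (3 i s' k')
  have "nats s' 1 = nats s 1" using same_nats[OF 3(2), of 1] assms by (simp add: set_cell_def)
  moreover have "i = g"
    using 3 assms(1) calculation
    by (cases "i < g") (auto simp: unary_def holds_at_append holds_at_replicate)
  ultimately show ?case using 3 assms by (simp add: wp_simps set_cell_def)
qed

definition read_binary :: "nat \<Rightarrow> com" where
  "read_binary x = (NSet x (NConst 0) ;;
     For 3 (V 16) (NSet x (NAdd (NAdd (V x) (V x)) (NCell 1 (V 2))) ;; Inc 2))"

lemma mods_read_binary [simp]:
  "nmods (read_binary x) = {x, 2, 3}" "rmods (read_binary x) = {}" "\<not> emits (read_binary x)"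
  unfolding read_binary_def by auto

lemma div_pow2_step:
  fixes v :: nat
  assumes "r < w"
  shows "v div 2 ^ (w - Suc r) = 2 * (v div 2 ^ (w - r)) + of_bool (odd (v div 2 ^ (w - Suc r)))"
proof -
  have "w - r = Suc (w - Suc r)" using assms by simp
  then have "v div 2 ^ (w - r) = v div 2 ^ (w - Suc r) div 2"
    by (simp only: power_Suc2 div_mult2_eq)
  then show ?thesis by (auto simp: of_bool_def elim: evenE oddE)
qed

lemma wp_read_binary:
  assumes "holds_at (nats s 1) (nats s 2 0) (binary w v)" "nats s 16 0 = w" "v < 2 ^ w" "x \<notin> {1, 2, 3, 16}"
  shows "wp (read_binary x) (\<lambda>s' k'. nats s' x 0 = v \<and> nats s' 2 0 = nats s 2 0 + w) s k"
  unfolding read_binary_def wp_simps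
proof (rule wp_ForU[where N = w
      and I = "\<lambda>r s'. nats s' x 0 = v div 2 ^ (w - r) \<and> nats s' 2 0 = nats s 2 0 + r"], goal_cases)
  case 1
  then show ?case using assms by (simp add: set_cell_def)
next
  case (2 s')
  show ?case using same_nats[OF 2, of 16] assms by (simp add: set_cell_def)
next
  case 3
  then show ?case using assms by simp
next
  case (4 r s' k')
  have "nats s' 1 = nats s 1" using same_nats[OF 4(4), of 1] assms by (simp add: set_cell_def)
  moreover have "nats s 1 (nats s 2 0 + r) = of_bool (odd (v div 2 ^ (w - Suc r)))"
    using assms(1) 4 unfolding binary_def holds_at_map by blast
  ultimately show ?case using 4 assms div_pow2_step[of r w v] by (simp add: wp_simps set_cell_def)
next
  case (5 s' k')
  then show ?case by simp
qed

definition read_header :: com where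
  "read_header = (NSet 2 (NConst 0) ;; NSet 37 (NCell 1 (V 2)) ;; Inc 2 ;; read_unary 5 ;;
     RSet 1 (RNum 2) ;;
     For 6 (V 5) (RAssign 1 (NAdd (V 6) (NConst 1)) (RMul (RCell 1 (V 6)) (RCell 1 (V 6)))) ;;
     RSet 2 (RNum 1) ;;
     For 6 (V 5) (Cond (NLe (NConst 1) (NCell 1 (V 2)))
         (RSet 2 (RMul (RV 2) (RCell 1 (NSub (V 5) (NAdd (V 6) (NConst 1)))))) Skip ;; Inc 2) ;;
     Cond (NLe (NConst 1) (V 37)) (RSet 3 (RMul (RNum 4) (RV 2))) (RSet 3 (RDiv (RNum 4) (RV 2))) ;;
     read_unary 7 ;; read_unary 8)"

lemma mods_read_header [simp]:
  "nmods read_header = {2, 37, 5, 6, 7, 8}" "rmods read_header = {1, 2, 3}" "\<not> emits read_header"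
  unfolding read_header_def by auto

lemma wp_read_header:
  assumes "holds_at (nats s 1) 0 (header_bits sg K e d n)"
  shows "wp read_header (\<lambda>s' k'. nats s' 2 0 = length (header_bits sg K e d n) \<and>
     reals s' 3 0 = scale sg (pow_bits K e) \<and> nats s' 7 0 = d \<and> nats s' 8 0 = n) s k"
proof -
  let ?A = "nats s 1"
  have h: "?A 0 = of_bool sg" "holds_at ?A 1 (unary K)" "\<And>r. r < K \<Longrightarrow> ?A (2 + K + r) = of_bool (e r)"
    "holds_at ?A (2 + K + K) (unary d)" "holds_at ?A (3 + K + K + d) (unary n)"
    using assms unfolding header_bits_def
    by (simp_all add: holds_at_append holds_at_Cons holds_at_map numeral_2_eq_2 numeral_3_eq_3)
  show ?thesis
    unfolding read_header_def wp_simps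
  proof (rule wp_use[OF wp_read_unary[where g = K]], goal_cases)
    case (4 s1 k1)
    have A1: "nats s1 1 = ?A" and p1: "nats s1 5 0 = K" "nats s1 2 0 = 2 + K" "nats s1 37 0 = of_bool sg"
      using 4 h(1) same_nats[OF 4(2), of 1] same_nats[OF 4(2), of 37] by (auto simp: set_cell_def)
    show ?case
      unfolding wp_simps
    proof (rule wp_ForU[where N = K and I = "\<lambda>i s'. \<forall>r\<le>i. reals s' 1 r = 2 ^ 2 ^ r"], goal_cases)
      case (2 s')
      then show ?case using p1 by (simp add: same_nats)
    next
      case (4 i s' k')
      then show ?case
        by (auto simp: wp_simps set_cell_def le_Suc_eq power_mult_distrib power2_eq_square[symmetric]
            simp flip: power_mult)
    next
      case (5 s2 k2)
      have p2: "nats s2 1 = ?A" "nats s2 5 0 = K" "nats s2 2 0 = 2 + K" "nats s2 37 0 = of_bool sg"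
        using A1 p1 by (simp_all add: same_nats[OF 5(3)])
      show ?case
        unfolding wp_simps
      proof (rule wp_ForU[where N = K and I = "\<lambda>i s'. nats s' 2 0 = 2 + K + i \<and>
            reals s' 2 0 = (\<Prod>r<i. if e r then 2 ^ 2 ^ (K - Suc r) else 1)"], goal_cases)
        case (2 s')
        then show ?case using p2 by (simp add: same_nats)
      next
        case (4 i s' k')
        have "nats s' 1 = ?A" "nats s' 5 0 = K" "reals s' 1 = reals s2 1"
          using p2 by (simp_all add: same_nats[OF 4(4)] same_reals[OF 4(4)] set_cell_def)
        then show ?case using 4 5(1) h(3)[of i] by (auto simp: wp_simps set_cell_def)
      next
        case (5 s3 k3)
        have p3: "nats s3 1 = ?A" "nats s3 37 0 = of_bool sg"
          using p2 by (simp_all add: same_nats[OF 5(3)])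
        have *: "wp (read_unary 7) (wp (read_unary 8) (\<lambda>s' k'.
             nats s' 2 0 = length (header_bits sg K e d n) \<and>
             reals s' 3 0 = scale sg (pow_bits K e) \<and> nats s' 7 0 = d \<and> nats s' 8 0 = n)) s4 k4"
          if s4: "nats s4 1 = ?A" "nats s4 2 0 = 2 + K + K" "reals s4 3 0 = scale sg (pow_bits K e)" for s4 k4
        proof (rule wp_use[OF wp_read_unary[where g = d]], goal_cases)
          case (4 s5 k5)
          show ?case
          proof (rule wp_use[OF wp_read_unary[where g = n]], goal_cases)
            case 1
            have "nats s5 2 0 = 3 + K + K + d" using 4 s4 by simp
            then show ?case using s4 h(5) by (simp only:) (simp add: same_nats[OF 4(2)])
          next
            case (4 s6 k6)
            then show ?case
              using \<open>same (read_unary 7) s4 s5\<close> \<open>nats s5 7 0 = d \<and> _\<close> s4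
              by (simp add: same_nats same_reals header_bits_def)
          qed auto
        qed (use s4 h(4) in auto)
        show ?case
          unfolding wp_simps
          by (split if_split, intro conjI impI *)
            (use 5 p3 in \<open>auto simp: set_cell_def scale_def pow_bits_def split: if_splits\<close>)
      qed (use p2 in \<open>auto simp: set_cell_def\<close>)
    qed (auto simp: set_cell_def)
  qed (use h(1,2) in \<open>auto simp: set_cell_def\<close>)
qed

definition read_round :: com where
  "read_round = (read_unary 10 ;; NSet 11 (NConst 1) ;; NSet 12 (V 7) ;;
     For 6 (V 10) (NSet 11 (NAdd (V 11) (V 11)) ;; NSet 12 (NAdd (V 12) (V 12))) ;;
     read_unary 13 ;; read_unary 16 ;;
     NSet 14 (NConst 0) ;; For 6 (V 13) (NSet 14 (NAdd (V 14) (V 7))) ;;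
     NSet 15 (NAdd (V 12) (V 14)) ;; NSet 22 (NConst 0) ;;
     For 6 (V 8) (NAssign 17 (V 6) (NCell 1 (V 2)) ;; Inc 2 ;; NAssign 18 (V 6) (V 22) ;;
       NSet 22 (NAdd (V 22) (V 15))) ;;
     NAssign 20 (NConst 0) (NConst 0) ;;
     For 23 (NSub (V 8) (NConst 1)) (NSet 38 (NAdd (V 23) (NConst 1)) ;;
       read_binary 39 ;; NAssign 19 (V 38) (V 39) ;; read_binary 41 ;; NAssign 20 (V 38) (V 41) ;;
       NSet 42 (NAdd (NCell 18 (V 38)) (V 41)) ;; NSet 43 (NAdd (NCell 18 (V 39)) (V 41)) ;;
       For 24 (V 14) (NAssign 21 (NAdd (V 42) (V 24)) (NCell 1 (V 2)) ;; Inc 2) ;;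
       For 24 (V 14) (NAssign 21 (NAdd (V 43) (V 24)) (NCell 1 (V 2)) ;; Inc 2)))"

lemma mods_read_round [simp]:
  "nmods read_round = {10, 2, 11, 12, 6, 13, 16, 14, 15, 22, 17, 18, 20, 23, 38, 39, 3, 19, 41, 42, 43, 24, 21}"
  "rmods read_round = {}" "\<not> emits read_round"
  unfolding read_round_def by auto

definition vals :: "(nat \<Rightarrow> nat) \<Rightarrow> nat \<Rightarrow> nat \<Rightarrow> nat \<Rightarrow> nat" where
  "vals A NB p t = A (p * NB + t)"

definition consistent :: "(nat \<Rightarrow> nat \<Rightarrow> bool) \<Rightarrow> nat \<Rightarrow> (nat \<Rightarrow> nat) \<Rightarrow> (nat \<Rightarrow> nat \<Rightarrow> bool) \<Rightarrow> bool" where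
  "consistent X NB A S \<longleftrightarrow> (\<forall>p t. t < NB \<longrightarrow> X p t \<longrightarrow> A (p * NB + t) = of_bool (S p t))"

text \<open>Offsets below \<open>NB\<close> keep the cells of different strings apart. The new cell
  may already belong to \<open>X\<close>: windows can overlap, and a cell that is written twice
  receives the same bit.\<close>

lemma consistent_block:
  assumes "consistent X NB A S" "q < NB"
  shows "consistent (\<lambda>p t. X p t \<or> (p = a \<and> t = q)) NB (A(a * NB + q := of_bool (S a q))) S"
  unfolding consistent_def
proof (intro allI impI)
  fix p t assume t: "t < NB" "X p t \<or> p = a \<and> t = q"
  have "p = a \<and> t = q" if "p * NB + t = a * NB + q"
    using that t(1) assms(2)
    by (metis div_mult_self3 mod_mult_self3 add.right_neutral div_less mod_less not_less_zero)
  then show "(A(a * NB + q := of_bool (S a q))) (p * NB + t) = of_bool (S p t)"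
    using assms(1) t unfolding consistent_def by auto
qed

lemma consistentD: "consistent X NB A S \<Longrightarrow> t < NB \<Longrightarrow> X p t \<Longrightarrow> A (p * NB + t) = of_bool (S p t)"
  unfolding consistent_def by blast

lemma consistent_mono: "consistent X NB A S \<Longrightarrow> (\<And>p t. Y p t \<Longrightarrow> X p t) \<Longrightarrow> consistent Y NB A S"
  unfolding consistent_def by blast

lemma wp_read_block:
  assumes "holds_at (nats s 1) (nats s 2 0) (block (S a) q W)" "nats s 14 0 = W" "nats s x 0 = a * NB + q"
    "q + W \<le> NB" "consistent X NB (nats s 21) S" "\<forall>p. nats s 21 p \<le> 1" "x \<notin> {24, 21, 2}"
  shows "wp (For 24 (V 14) (NAssign 21 (NAdd (V x) (V 24)) (NCell 1 (V 2)) ;; Inc 2))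
    (\<lambda>s' k'. consistent (\<lambda>p t. X p t \<or> (p = a \<and> q \<le> t \<and> t < q + W)) NB (nats s' 21) S \<and>
      (\<forall>p. nats s' 21 p \<le> 1) \<and> nats s' 2 0 = nats s 2 0 + W) s k"
proof (rule wp_ForU[where N = W and I = "\<lambda>r s'.
     consistent (\<lambda>p t. X p t \<or> (p = a \<and> q \<le> t \<and> t < q + r)) NB (nats s' 21) S \<and>
      (\<forall>p. nats s' 21 p \<le> 1) \<and> nats s' 2 0 = nats s 2 0 + r"], goal_cases)
  case 1
  then show ?case using assms by (auto simp: set_cell_def elim: consistent_mono)
next
  case (2 s')
  then show ?case using assms by (simp add: same_nats)
next
  case (4 r s' k')
  have s': "nats s' 1 = nats s 1" "nats s' x = nats s x"
    using same_nats[OF 4(4)] assms(7) by auto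
  have b: "nats s 1 (nats s 2 0 + r) = of_bool (S a (q + r))"
    using assms(1) 4(1) unfolding block_def holds_at_map by blast
  have "consistent (\<lambda>p t. X p t \<or> (p = a \<and> q \<le> t \<and> t < q + Suc r)) NB
      ((nats s' 21)(a * NB + (q + r) := of_bool (S a (q + r)))) S"
    by (rule consistent_mono[OF consistent_block]) (use 4 assms(4) in auto)
  then show ?case
    using 4 s' b assms(3,7) by (simp add: wp_simps set_cell_def add.assoc)
qed (use assms in auto)

lemma wp_read_round:
  assumes A: "holds_at (nats s 1) (nats s 2 0) (round_bits d n g \<Lambda> w fl S par m)"
    and dn: "nats s 7 0 = d" "nats s 8 0 = n" and v1: "\<forall>p. nats s 21 p \<le> 1"
    and ok: "\<And>i. 0 < i \<Longrightarrow> i < n \<Longrightarrow> par i < i \<and> m i < d * 2 ^ g \<and> par i < 2 ^ w \<and> m i < 2 ^ w"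
    and m0: "m 0 = 0" and NB: "NB = d * (2 ^ g + \<Lambda>)"
  shows "wp read_round (\<lambda>s' k'. nats s' 2 0 = nats s 2 0 + length (round_bits d n g \<Lambda> w fl S par m) \<and>
     nats s' 11 0 = 2 ^ g \<and> nats s' 12 0 = d * 2 ^ g \<and> nats s' 13 0 = \<Lambda> \<and>
     (\<forall>i<n. nats s' 17 i = of_bool (fl i) \<and> nats s' 18 i = i * NB) \<and>
     (\<forall>i<n. nats s' 20 i = m i) \<and> (\<forall>i<n. 0 < i \<longrightarrow> nats s' 19 i = par i) \<and>
     (\<forall>p. nats s' 21 p \<le> 1) \<and> covers S n (d * \<Lambda>) par m (vals (nats s' 21) NB)) s k"
proof -
  let ?A = "nats s 1" and ?p = "nats s 2 0"
  let ?W = "d * \<Lambda>"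
  let ?L = "2 * w + 2 * ?W"
  define p1 where "p1 = ?p + Suc g"
  define p2 where "p2 = p1 + Suc \<Lambda>"
  define p3 where "p3 = p2 + Suc w"
  define p4 where "p4 = p3 + n"
  have h: "holds_at ?A ?p (unary g)" "holds_at ?A p1 (unary \<Lambda>)" "holds_at ?A p2 (unary w)"
    "\<And>i. i < n \<Longrightarrow> ?A (p3 + i) = of_bool (fl i)"
    and hr: "holds_at ?A p4 (concat (map (\<lambda>i. record_bits w ?W S par m (Suc i)) [0..<n - 1]))"
    using A unfolding round_bits_def p1_def p2_def p3_def p4_def
    by (simp_all add: holds_at_append holds_at_map add.assoc)
  have h5: "holds_at ?A (p4 + i * ?L) (record_bits w ?W S par m (Suc i))" if "i < n - 1" for i
    by (rule holds_at_concat[OF hr _ that]) simp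
  have len: "?p + length (round_bits d n g \<Lambda> w fl S par m) = p4 + (n - 1) * ?L"
    unfolding length_round p1_def p2_def p3_def p4_def by simp
  show ?thesis
    unfolding read_round_def wp_simps
  proof (rule wp_use[OF wp_read_unary[where g = g]], goal_cases)
    case (4 s1 k1)
    have s1: "nats s1 1 = ?A" "nats s1 7 0 = d" "nats s1 8 0 = n" "nats s1 21 = nats s 21"
      "nats s1 10 0 = g" "nats s1 2 0 = p1"
      using 4 dn by (simp_all add: same_nats[OF 4(2)] p1_def)
    show ?case
      unfolding wp_simps
    proof (rule wp_ForU[where N = g and I = "\<lambda>i s'. nats s' 11 0 = 2 ^ i \<and> nats s' 12 0 = d * 2 ^ i"],
        goal_cases)
      case (2 s')
      then show ?case using s1 by (simp add: same_nats set_cell_def)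
    next
      case (4 i s' k')
      then show ?case by (auto simp: wp_simps set_cell_def)
    next
      case (5 s2 k2)
      have s2: "nats s2 1 = ?A" "nats s2 7 0 = d" "nats s2 8 0 = n" "nats s2 21 = nats s 21"
        "nats s2 2 0 = p1" "nats s2 11 0 = 2 ^ g" "nats s2 12 0 = d * 2 ^ g"
        using 5 s1 by (simp_all add: same_nats[OF 5(3)] set_cell_def)
      show ?case
        unfolding wp_simps
      proof (rule wp_use[OF wp_read_unary[where g = \<Lambda>]], goal_cases)
        case (4 s3 k3)
        have s3: "nats s3 1 = ?A" "nats s3 7 0 = d" "nats s3 8 0 = n" "nats s3 21 = nats s 21"
          "nats s3 2 0 = p2" "nats s3 11 0 = 2 ^ g" "nats s3 12 0 = d * 2 ^ g" "nats s3 13 0 = \<Lambda>"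
          using 4 s2 by (simp_all add: same_nats[OF 4(2)] p2_def)
        show ?case
        proof (rule wp_use[OF wp_read_unary[where g = w]], goal_cases)
          case (4 s4 k4)
          have s4: "nats s4 1 = ?A" "nats s4 7 0 = d" "nats s4 8 0 = n" "nats s4 21 = nats s 21"
            "nats s4 2 0 = p3" "nats s4 11 0 = 2 ^ g" "nats s4 12 0 = d * 2 ^ g" "nats s4 13 0 = \<Lambda>"
            "nats s4 16 0 = w"
            using 4 s3 by (simp_all add: same_nats[OF 4(2)] p3_def)
          show ?case
            unfolding wp_simps
          proof (rule wp_ForU[where N = \<Lambda> and I = "\<lambda>i s'. nats s' 14 0 = d * i"], goal_cases)
            case (2 s')
            then show ?case using s4 by (simp add: same_nats set_cell_def)
          next
            case (4 i s' k')
            then have "nats s' 7 0 = d" using s4 by (simp add: same_nats set_cell_def)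
            then show ?case using 4 by (auto simp: wp_simps set_cell_def)
          next
            case (5 s5 k5)
            have s5: "nats s5 1 = ?A" "nats s5 7 0 = d" "nats s5 8 0 = n" "nats s5 21 = nats s 21"
              "nats s5 2 0 = p3" "nats s5 11 0 = 2 ^ g" "nats s5 12 0 = d * 2 ^ g" "nats s5 13 0 = \<Lambda>"
              "nats s5 16 0 = w" "nats s5 14 0 = ?W"
              using 5 s4 by (simp_all add: same_nats[OF 5(3)] set_cell_def)
            have NB': "NB = d * 2 ^ g + ?W" unfolding NB by (simp add: algebra_simps)
            show ?case
              unfolding wp_simps
            proof (rule wp_ForU[where N = n and I = "\<lambda>i s'. nats s' 2 0 = p3 + i \<and> nats s' 22 0 = i * NB \<and>
                (\<forall>i'<i. nats s' 17 i' = of_bool (fl i') \<and> nats s' 18 i' = i' * NB)"], goal_cases)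
              case (2 s')
              then show ?case using s5 by (simp add: same_nats set_cell_def)
            next
              case (4 i s' k')
              have "nats s' 15 0 = NB" "nats s' 1 = ?A"
                using s5 NB' by (simp_all add: same_nats[OF 4(4)] set_cell_def)
              then show ?case using 4 h(4)[of i] by (auto simp: wp_simps set_cell_def less_Suc_eq)
            next
              case (5 s6 k6)
              have s6: "nats s6 1 = ?A" "nats s6 7 0 = d" "nats s6 8 0 = n" "nats s6 21 = nats s 21"
                "nats s6 2 0 = p4" "nats s6 11 0 = 2 ^ g" "nats s6 12 0 = d * 2 ^ g" "nats s6 13 0 = \<Lambda>"
                "nats s6 16 0 = w" "nats s6 14 0 = ?W"
                "\<forall>i<n. nats s6 17 i = of_bool (fl i) \<and> nats s6 18 i = i * NB"
                using 5 s5 by (simp_all add: same_nats[OF 5(3)] set_cell_def p4_def)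
              show ?case
                unfolding wp_simps
              \<comment> \<open>After \<open>i\<close> records, the cells of the first
                \<open>i\<close> pairs of windows are guaranteed. Record \<open>i\<close> belongs to
                string \<open>Suc i\<close>, as string 0 has no pointer.\<close>
              proof (rule wp_ForU[where N = "n - 1" and I = "\<lambda>i s'. nats s' 2 0 = p4 + i * ?L \<and>
                  nats s' 20 0 = 0 \<and> (\<forall>r. 0 < r \<and> r \<le> i \<longrightarrow> nats s' 19 r = par r \<and> nats s' 20 r = m r) \<and>
                  (\<forall>p. nats s' 21 p \<le> 1) \<and>
                  consistent (\<lambda>p t. \<exists>r. 0 < r \<and> r \<le> i \<and> (p = r \<or> p = par r) \<and> m r \<le> t \<and> t < m r + ?W)
                    NB (nats s' 21) S"], goal_cases)
                case 1
                show ?case using s6 v1 by (simp add: set_cell_def consistent_def)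
              next
                case (2 s')
                then show ?case using s6 by (simp add: same_nats set_cell_def)
              next
                case (4 i s' k')
                let ?X = "\<lambda>i p t. \<exists>r. 0 < r \<and> r \<le> i \<and> (p = r \<or> p = par r) \<and> m r \<le> t \<and> t < m r + ?W"
                have i: "i < n - 1" "Suc i < n" using 4 by auto
                have oki: "par (Suc i) < Suc i" "m (Suc i) < d * 2 ^ g" "par (Suc i) < 2 ^ w" "m (Suc i) < 2 ^ w"
                  using ok[of "Suc i"] i by auto
                define q where "q = p4 + i * ?L"
                have hb: "holds_at ?A q (binary w (par (Suc i)))" "holds_at ?A (q + w) (binary w (m (Suc i)))"
                  "holds_at ?A (q + w + w) (block (S (Suc i)) (m (Suc i)) ?W)"
                  "holds_at ?A (q + w + w + ?W) (block (S (par (Suc i))) (m (Suc i)) ?W)"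
                  using h5[OF i(1)] unfolding record_bits_def q_def[symmetric] by (simp_all add: holds_at_append)
                have t0: "nats s' 1 = ?A" "nats s' 16 0 = w" "nats s' 14 0 = ?W" "nats s' 23 0 = i"
                   "nats s' 2 0 = q" "\<forall>i<n. nats s' 18 i = i * NB"
                  using 4 s6 by (simp_all add: same_nats[OF 4(4)] set_cell_def q_def)
                show ?case
                  unfolding wp_simps
                proof (rule wp_use[OF wp_read_binary[where w = w and v = "par (Suc i)"]], goal_cases)
                  case (5 t1 l1)
                  have t1: "nats t1 1 = ?A" "nats t1 16 0 = w" "nats t1 14 0 = ?W" "nats t1 38 0 = Suc i"
                    "nats t1 39 0 = par (Suc i)" "nats t1 2 0 = q + w" "\<forall>i<n. nats t1 18 i = i * NB"
                    "nats t1 19 = nats s' 19" "nats t1 20 = nats s' 20" "nats t1 21 = nats s' 21" "nats t1 23 0 = i"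
                    using 5 t0 by (simp_all add: same_nats[OF 5(2)] set_cell_def)
                  show ?case
                    unfolding wp_simps
                  proof (rule wp_use[OF wp_read_binary[where w = w and v = "m (Suc i)"]], goal_cases)
                    case (5 t2 l2)
                    have t2: "nats t2 1 = ?A" "nats t2 16 0 = w" "nats t2 14 0 = ?W" "nats t2 38 0 = Suc i"
                      "nats t2 39 0 = par (Suc i)" "nats t2 41 0 = m (Suc i)" "nats t2 2 0 = q + w + w"
                      "\<forall>i<n. nats t2 18 i = i * NB" "nats t2 23 0 = i"
                      "nats t2 19 = (nats s' 19)(Suc i := par (Suc i))"
                      "nats t2 20 = nats s' 20" "nats t2 21 = nats s' 21"
                      using 5 t1 by (simp_all add: same_nats[OF 5(2)] set_cell_def)
                    show ?case
                      unfolding wp_simps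
                    proof (rule wp_use[OF wp_read_block[where S = S and a = "Suc i" and q = "m (Suc i)" and
                        NB = NB and X = "?X i" and W = ?W]], goal_cases)
                      case (8 t3 l3)
                      have t3: "nats t3 1 = ?A" "nats t3 14 0 = ?W" "nats t3 23 0 = i"
                        "nats t3 43 0 = par (Suc i) * NB + m (Suc i)" "nats t3 2 0 = q + w + w + ?W"
                        "nats t3 19 = (nats s' 19)(Suc i := par (Suc i))"
                        "nats t3 20 = (nats s' 20)(Suc i := m (Suc i))"
                        using 8(1) t2 oki(1) i by (simp_all add: same_nats[OF 8(2)] set_cell_def)
                      show ?case
                      proof (rule wp_use[OF wp_read_block[where S = S and a = "par (Suc i)" and q = "m (Suc i)" and
                          NB = NB and W = ?W and X = "\<lambda>p t. ?X i p t \<or>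
                            (p = Suc i \<and> m (Suc i) \<le> t \<and> t < m (Suc i) + ?W)"]], goal_cases)
                        case (8 t4 l4)
                        have c: "consistent (?X (Suc i)) NB (nats t4 21) S"
                          by (rule consistent_mono[OF conjunct1[OF 8(1)]]) (auto simp: le_Suc_eq)
                        have t4: "nats t4 19 = (nats s' 19)(Suc i := par (Suc i))"
                          "nats t4 20 = (nats s' 20)(Suc i := m (Suc i))" "nats t4 2 0 = q + ?L"
                          using 8 t3 by (simp_all add: same_nats[OF 8(2)])
                        show ?case
                          using c t4 8(1) 4(2) by (auto simp: set_cell_def q_def le_Suc_eq)
                      qed (use t3 hb 8 oki NB' in auto)
                    next
                      case 1
                      show ?case using t2 hb by (simp add: set_cell_def)
                    next
                      case 2
                      show ?case using t2 by (simp add: set_cell_def)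
                    next
                      case 3
                      show ?case using t2 i by (simp add: set_cell_def)
                    next
                      case 5
                      show ?case using t2 4(2) by (simp add: set_cell_def)
                    next
                      case 6
                      show ?case using t2 4(2) by (simp add: set_cell_def)
                    qed (use oki NB' in auto)
                  qed (use t1 hb oki in \<open>auto simp: set_cell_def\<close>)
                qed (use t0 hb oki in \<open>auto simp: set_cell_def\<close>)
              next
                case (5 s7 k7)
                have s7: "nats s7 11 0 = 2 ^ g" "nats s7 12 0 = d * 2 ^ g" "nats s7 13 0 = \<Lambda>"
                  "\<forall>i<n. nats s7 17 i = of_bool (fl i) \<and> nats s7 18 i = i * NB"
                  using s6 by (simp_all add: same_nats[OF 5(3)] set_cell_def)
                have mi: "nats s7 20 i = m i" if "i < n" for i
                  using 5(1) m0 that by (cases "i = 0") auto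
                have con: "consistent (\<lambda>p t. \<exists>r. 0 < r \<and> r \<le> n - 1 \<and> (p = r \<or> p = par r) \<and> m r \<le> t \<and>
                    t < m r + ?W) NB (nats s7 21) S"
                  using 5(1) by (elim conjE) assumption
                have "covers S n ?W par m (vals (nats s7 21) NB)"
                  unfolding covers_def vals_def
                proof (intro allI impI)
                  fix i r assume ir: "0 < i \<and> i < n \<and> r < ?W"
                  have mr: "m i + r < NB" using ok[of i] ir NB' by auto
                  have ex: "\<exists>r'. 0 < r' \<and> r' \<le> n - 1 \<and> (p = r' \<or> p = par r') \<and> m r' \<le> m i + r \<and> m i + r < m r' + ?W"
                    if "p = i \<or> p = par i" for p
                    by (rule exI[of _ i]) (use ir that in auto)
                  show "nats s7 21 (i * NB + (m i + r)) = of_bool (S i (m i + r)) \<and>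
                      nats s7 21 (par i * NB + (m i + r)) = of_bool (S (par i) (m i + r))"
                    by (intro conjI; rule consistentD[OF con mr]; rule ex; simp)
                qed
                then show ?case using 5(1) s7 mi len by auto
              qed auto
            qed (use s5 in \<open>auto simp: set_cell_def\<close>)
          qed (auto simp: set_cell_def)
        qed (use s3 h in auto)
      qed (use s2 h in auto)
    qed (use s1 in \<open>auto simp: set_cell_def\<close>)
  qed (use h in auto)
qed

text \<open>The decoder's arrays match \<open>par\<close> and \<open>m\<close> on the stored entries
  only. String 0 has no stored pointer, and \<open>m 0 = 0\<close> keeps the walk from asking for
  one.\<close>

lemma own_cong:
  assumes "\<And>i. i < n \<Longrightarrow> m' i = m i" "\<And>i. 0 < i \<Longrightarrow> i < n \<Longrightarrow> par' i = par i \<and> par i < i" "m 0 = 0" "i < n"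
  shows "own par' m' i t = own par m i t"
  using assms(4)
proof (induction i rule: less_induct)
  case (less i)
  show ?case
  proof (cases "m i \<le> t")
    case True
    then show ?thesis using assms(1)[OF less.prems] by (simp add: own.simps)
  next
    case False
    then have "0 < i" using assms(3) by (cases i) auto
    then show ?thesis
      using False assms(1,2) less by (subst (1 2) own.simps) auto
  qed
qed

lemma own_less: "i < n \<Longrightarrow> own par m i t < n"
proof (induction i rule: less_induct)
  case (less i)
  then show ?case by (subst own.simps) auto
qed

section \<open>Following pointers and summing digits\<close>

definition walk :: "nat \<Rightarrow> com" where
  "walk x = While (BNot (NLe (NCell 20 (V x)) (V 30))) (NSet x (NCell 19 (V x)))"

lemma mods_walk [simp]: "nmods (walk x) = {x}" "rmods (walk x) = {}" "\<not> emits (walk x)"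
  unfolding walk_def by auto

lemma wp_walk:
  assumes "\<And>i. 0 < i \<Longrightarrow> i < n \<Longrightarrow> nats s 19 i < i" "nats s 20 0 = 0" "nats s x 0 < n" "x \<notin> {19, 20, 30}"
  shows "wp (walk x) (\<lambda>s' k'. nats s' x 0 = own (nats s 19) (nats s 20) (nats s x 0) (nats s 30 0)) s k"
  unfolding walk_def
proof (rule wp_While[where B = "Suc (nats s x 0)" and tb = 1 and
    I = "\<lambda>i s'. nats s' x 0 + i \<le> nats s x 0 \<and>
      own (nats s 19) (nats s 20) (nats s' x 0) (nats s 30 0) =
      own (nats s 19) (nats s 20) (nats s x 0) (nats s 30 0)"], goal_cases)
  case (2 i s' k')
  let ?c = "nats s' x 0"
  have s': "nats s' 19 = nats s 19" "nats s' 20 = nats s 20" "nats s' 30 = nats s 30"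
    using assms(4) by (simp_all add: same_nats[OF 2(2)])
  have "nats s 30 0 < nats s 20 ?c" using 2(3) s' by simp
  moreover from this have "0 < ?c" using assms(2) by (cases ?c) auto
  moreover have "?c < n" using 2(1) assms(3) by simp
  ultimately have lt: "nats s 19 ?c < ?c" using assms(1) by blast
  with \<open>nats s 30 0 < nats s 20 ?c\<close> have "own (nats s 19) (nats s 20) ?c (nats s 30 0) =
      own (nats s 19) (nats s 20) (nats s 19 ?c) (nats s 30 0)"
    by (simp add: own.simps[of _ _ ?c])
  then show ?case using 2(1) s' lt by (simp add: wp_simps set_cell_def)
next
  case (3 i s' k')
  have s': "nats s' 19 = nats s 19" "nats s' 20 = nats s 20" "nats s' 30 = nats s 30"
    using assms(4) by (simp_all add: same_nats[OF 3(2)])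
  then show ?case using 3 by (simp add: own.simps[of _ _ "nats s' x 0"])
qed simp

text \<open>The weight of a digit starts at F M / 2 and is halved from level to level:
  \<open>F\<close> undoes the scaling and \<open>M\<close> the division by the modulus, while the
  common shift cancels in the difference. Scalar 30 is the position in the interleaved string and
  advances by \<open>d\<close> per level.\<close>

definition estimate :: com where
  "estimate = (NSet 33 (NAdd (NAdd (NAdd (V 12) (V 12)) (NAdd (V 12) (V 12))) (NConst 1)) ;;
     NSet 40 (NAdd (V 11) (V 13)) ;; RSet 4 (RNum 0) ;;
     For 28 (V 7) (RSet 5 (RNum 0) ;; RSet 6 (RDiv (RMul (RV 3) (ROfNat (V 33))) (RNum 2)) ;;
       NSet 30 (V 28) ;;
       For 29 (V 40) (NSet 31 (V 25) ;; NSet 32 (V 26) ;; walk 31 ;; walk 32 ;;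
         RSet 5 (RAdd (RV 5) (RMul (RSub
           (ROfNat (NCell 21 (NAdd (NCell 18 (V 31)) (V 30))))
           (ROfNat (NCell 21 (NAdd (NCell 18 (V 32)) (V 30))))) (RV 6))) ;;
         RSet 6 (RDiv (RV 6) (RNum 2)) ;; NSet 30 (NAdd (V 30) (V 7))) ;;
       RSet 4 (RAdd (RV 4) (RMul (RV 5) (RV 5)))) ;;
     RSet 0 (RSqrt (RV 4)))"

lemma mods_estimate [simp]:
  "nmods estimate = {33, 40, 28, 30, 29, 31, 32}" "rmods estimate = {4, 5, 6, 0}" "\<not> emits estimate"
  unfolding estimate_def by auto

lemma wp_estimate:
  assumes dH: "nats s 7 0 = d" "nats s 11 0 = H" "nats s 12 0 = d * H" "nats s 13 0 = \<Lambda>"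
    and bs: "\<forall>i<n. nats s 18 i = i * NB" and m: "\<And>i. i < n \<Longrightarrow> nats s 20 i = m i"
    and par: "\<And>i. 0 < i \<Longrightarrow> i < n \<Longrightarrow> nats s 19 i = par i \<and> par i < i" and m0: "m 0 = 0"
    and ij: "nats s 25 0 = i" "nats s 26 0 = j" "i < n" "j < n" and F: "0 < reals s 3 0"
  shows "wp estimate (\<lambda>s' k'. reals s' 0 0 = reals s 3 0 * (real (4 * d * H + 1) *
     est d (H + \<Lambda>) (vals (nats s 21) NB) (own par m) i j)) s k"
proof -
  let ?v = "vals (nats s 21) NB" and ?F = "reals s 3 0"
  define M where "M = real (4 * d * H + 1)"
  let ?Q = "H + \<Lambda>"
  let ?t = "\<lambda>k h. real (?v (own par m i (h * d + k)) (h * d + k)) - real (?v (own par m j (h * d + k)) (h * d + k))"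
  let ?f = "\<lambda>k l. \<Sum>h<l. ?t k h / 2 ^ Suc h"
  have own: "own (nats s 19) (nats s 20) p q = own par m p q" if "p < n" for p q
    by (rule own_cong[where n = n]) (use m par m0 that in auto)
  have n0: "0 < n" using ij by simp
  show ?thesis
    unfolding estimate_def wp_simps
  proof (rule wp_ForU[where N = d and I = "\<lambda>k s'. reals s' 4 0 = (\<Sum>k<k. (?F * M * ?f k ?Q)\<^sup>2)"], goal_cases)
    case (2 s')
    then show ?case using dH by (simp add: same_nats set_cell_def)
  next
    case (4 k s' k')
    have s': "nats s' 7 0 = d" "nats s' 18 = nats s 18" "nats s' 19 = nats s 19" "nats s' 20 = nats s 20"
      "nats s' 21 = nats s 21" "nats s' 25 0 = i" "nats s' 26 0 = j" "real (nats s' 33 0) = M"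
      "nats s' 40 0 = ?Q" "reals s' 3 0 = ?F"
      using dH ij by (simp_all add: same_nats[OF 4(4)] same_reals[OF 4(4)] set_cell_def M_def)
    show ?case
      unfolding wp_simps
    proof (rule wp_ForU[where N = ?Q and I = "\<lambda>h s'. reals s' 5 0 = ?F * M * ?f k h \<and>
          reals s' 6 0 = ?F * M / 2 ^ Suc h \<and> nats s' 30 0 = h * d + k"], goal_cases)
      case 1
      then show ?case using s' 4(3) by (simp add: set_cell_def)
    next
      case (2 s'')
      then show ?case using s' by (simp add: same_nats set_cell_def)
    next
      case (4 h t l)
      let ?q = "h * d + k"
      have t: "nats t 7 0 = d" "nats t 18 = nats s 18" "nats t 19 = nats s 19" "nats t 20 = nats s 20"
        "nats t 21 = nats s 21" "nats t 25 0 = i" "nats t 26 0 = j" "nats t 30 0 = ?q"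
        using s' 4(2) by (simp_all add: same_nats[OF 4(4)] set_cell_def)
      show ?case
        unfolding wp_simps
      proof (rule wp_use[OF wp_walk[where n = n]], goal_cases)
        case (5 t1 l1)
        have t1: "nats t1 7 0 = d" "nats t1 18 = nats s 18" "nats t1 19 = nats s 19" "nats t1 20 = nats s 20"
          "nats t1 21 = nats s 21" "nats t1 32 0 = j" "nats t1 30 0 = ?q" "nats t1 31 0 = own par m i ?q"
          "reals t1 = reals t" "nats t1 29 = nats t 29"
          using 5(1) t ij own same_reals[OF 5(2)]
          by (simp_all add: same_nats[OF 5(2)] set_cell_def fun_eq_iff)
        show ?case
        proof (rule wp_use[OF wp_walk[where n = n]], goal_cases)
          case (5 t2 l2)
          have t2: "nats t2 7 0 = d" "nats t2 18 = nats s 18"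
            "nats t2 21 = nats s 21" "nats t2 30 0 = ?q" "nats t2 31 0 = own par m i ?q"
            "nats t2 32 0 = own par m j ?q" "reals t2 = reals t" "nats t2 29 = nats t 29"
            using 5(1) t1 ij own same_reals[OF 5(2)]
            by (simp_all add: same_nats[OF 5(2)] set_cell_def fun_eq_iff)
          have o: "own par m i ?q < n" "own par m j ?q < n" using ij by (auto intro: own_less)
          have step: "?F * M * x + (a - b) * (?F * M) / 2 ^ Suc h = ?F * M * (x + (a - b) / 2 ^ Suc h)"
            "2 ^ Suc h * 2 = (2 ^ Suc (Suc h) :: real)" for x a b :: real
            by (simp_all add: distrib_left)
          show ?case
            using 4(2,3) t2 o bs unfolding wp_simps by (simp add: set_cell_def vals_def step del: power_Suc)
        qed (use t1 ij m par m0 n0 in auto)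
      qed (use t ij m par m0 n0 in \<open>auto simp: set_cell_def\<close>)
    next
      case (5 t l)
      then show ?case using 4(1-3) by (simp add: wp_simps set_cell_def same_reals[OF 5(3)] power2_eq_square)
    qed (use s' in \<open>auto simp: set_cell_def\<close>)
  next
    case (5 s' k')
    have "sqrt (\<Sum>k<d. (?F * M * ?f k ?Q)\<^sup>2) = ?F * (M * est d ?Q ?v (own par m) i j)"
      using F M_def unfolding est_def L2_set_sqrt power_mult_distrib[of "?F * M"] sum_distrib_left[symmetric]
      by (simp add: real_sqrt_mult abs_mult)
    then show ?case using 5(1) by (simp add: wp_simps set_cell_def M_def)
  qed (auto simp: set_cell_def)
qed

definition next_indices :: com where
  "next_indices = (NSet 27 (NConst 0) ;;
     For 6 (V 8) (Cond (NLe (NConst 1) (NCell 17 (V 6))) Skip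
       (Cond (BAnd (NLe (V 6) (V 25)) (NLe (V 25) (V 6))) (NSet 35 (V 27)) Skip ;;
        Cond (BAnd (NLe (V 6) (V 26)) (NLe (V 26) (V 6))) (NSet 36 (V 27)) Skip ;; Inc 27)) ;;
     NSet 25 (V 35) ;; NSet 26 (V 36) ;; NSet 8 (V 27))"

lemma mods_next_indices [simp]:
  "nmods next_indices = {27, 6, 35, 36, 25, 26, 8}" "rmods next_indices = {}" "\<not> emits next_indices"
  unfolding next_indices_def by auto

lemma wp_next_indices:
  assumes "nats s 8 0 = n" "nats s 25 0 = i" "nats s 26 0 = j" "i < n" "j < n" "\<not> fl i" "\<not> fl j"
    "\<forall>i<n. nats s 17 i = of_bool (fl i)"
  shows "wp next_indices (\<lambda>s' k'. nats s' 8 0 = rank fl n \<and> nats s' 25 0 = rank fl i \<and>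
     nats s' 26 0 = rank fl j) s k"
  unfolding next_indices_def wp_simps
proof (rule wp_ForU[where N = n and I = "\<lambda>r s'. nats s' 27 0 = rank fl r \<and>
    (i < r \<longrightarrow> nats s' 35 0 = rank fl i) \<and> (j < r \<longrightarrow> nats s' 36 0 = rank fl j)"], goal_cases)
  case (2 s')
  then show ?case using assms by (simp add: same_nats set_cell_def)
next
  case (4 r s' k')
  have s': "nats s' 17 = nats s 17" "nats s' 25 0 = i" "nats s' 26 0 = j"
    using assms by (simp_all add: same_nats[OF 4(4)] set_cell_def)
  have eq: "i < Suc r \<longleftrightarrow> i < r \<or> i = r" "j < Suc r \<longleftrightarrow> j < r \<or> j = r"
    "r \<le> i \<and> i \<le> r \<longleftrightarrow> i = r" "r \<le> j \<and> j \<le> r \<longleftrightarrow> j = r" by auto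
  have fl: "nats s 17 r = of_bool (fl r)" "nats s' 6 0 = r" using 4(1,3) assms(8) by auto
  show ?case
    using 4(2) s' fl assms(6,7) unfolding wp_simps eq
    by (cases "fl r"; cases "i = r"; cases "j = r"; simp add: set_cell_def rank_Suc eq)
next
  case (5 s' k')
  then show ?case using assms by (simp add: wp_simps set_cell_def)
qed (auto simp: set_cell_def)

definition rounds :: com where
  "rounds = While (NLe (V 9) (NConst 0)) (read_round ;;
     Cond (NLe (NConst 1) (NAdd (NCell 17 (V 25)) (NCell 17 (V 26)))) (estimate ;; NSet 9 (NConst 1))
       next_indices)"

lemma mods_rounds [simp]: "rmods rounds = {4, 5, 6, 0}"
  unfolding rounds_def by simp

text \<open>Induction over the rounds. If neither point is flagged, both are passed on with
  different ranks and unchanged coordinates, so the claim for the rest of the sketch is the claim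
  itself.\<close>

lemma wp_rounds:
  assumes "valid \<epsilon> d n U bs" "holds_at (nats s 1) (nats s 2 0) bs"
    "nats s 7 0 = d" "nats s 8 0 = n" "nats s 9 0 = 0" "\<forall>p. nats s 21 p \<le> 1" "nats s 25 0 = i" "nats s 26 0 = j"
    "i < n" "j < n" "i \<noteq> j" "reals s 3 0 = F" "0 < F"
  shows "wp rounds (\<lambda>s' k'. \<bar>reals s' 0 0 - F * pdist d (U i) (U j)\<bar> \<le> \<epsilon> * (F * pdist d (U i) (U j))) s k"
  using assms
proof (induction arbitrary: s i j k rule: valid.induct)
  case (valid_last n U bs)
  then show ?case by simp
next
  case (valid_round m n par g w U \<Lambda> fl S U' rest)
  let ?NB = "d * (2 ^ g + \<Lambda>)"
  let ?D = "pdist d (U i) (U j)"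
  note pr = valid_round.prems
  have par: "par i < i" if "0 < i" "i < n" for i using valid_round.hyps(2) that by blast
  show ?case
    apply (subst rounds_def, subst wp_While_unfold, fold rounds_def)
    apply (simp add: pr wp_Seq)
  proof (rule wp_use[OF wp_read_round[where g = g and d = d and n = n and \<Lambda> = \<Lambda> and w = w and fl = fl
          and S = S and par = par and m = m and NB = ?NB]], goal_cases)
    case (8 s1 k1)
    have s1: "nats s1 7 0 = d" "nats s1 8 0 = n" "nats s1 9 0 = 0" "nats s1 25 0 = i" "nats s1 26 0 = j"
      "reals s1 3 0 = F" "nats s1 1 = nats s 1"
      using pr by (simp_all add: same_nats[OF 8(2)] same_reals[OF 8(2)])
    show ?case
    proof (cases "fl i \<or> fl j")
      case True
      have e: "\<bar>real (4 * d * 2 ^ g + 1) * est d (2 ^ g + \<Lambda>) (vals (nats s1 21) ?NB) (own par m) i j - ?D\<bar> \<le> \<epsilon> * ?D"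
        by (rule valid_round.hyps(3)[unfolded accurate_def, rule_format])
          (use True 8(1) pr in \<open>auto simp: vals_def\<close>)
      have "wp estimate (wp (NSet 9 (NConst 1)) (wp rounds (\<lambda>s' k'. \<bar>reals s' 0 0 - F * ?D\<bar> \<le> \<epsilon> * (F * ?D)))) s1 (k1 + 1)"
      proof (rule wp_use[OF wp_estimate[where n = n and NB = ?NB and m = m and par = par and i = i and j = j
              and d = d and H = "2 ^ g" and \<Lambda> = \<Lambda>]], goal_cases)
        case (14 s2 k2)
        have "reals s2 0 0 - F * ?D = F * (real (4 * d * 2 ^ g + 1) *
            est d (2 ^ g + \<Lambda>) (vals (nats s1 21) ?NB) (own par m) i j - ?D)"
          using 14(1) s1 by (simp add: algebra_simps)
        then have "\<bar>reals s2 0 0 - F * ?D\<bar> \<le> F * (\<epsilon> * ?D)"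
          using e pr by (simp add: abs_mult mult_left_mono)
        then show ?case
          unfolding wp_simps rounds_def by (simp add: wp_While_unfold set_cell_def algebra_simps)
      qed (use s1 8(1) pr par valid_round.hyps(1) in auto)
      then show ?thesis using True 8(1) s1 pr by (auto simp: wp_simps)
    next
      case False
      have "wp next_indices (wp rounds (\<lambda>s' k'. \<bar>reals s' 0 0 - F * ?D\<bar> \<le> \<epsilon> * (F * ?D))) s1 (k1 + 1)"
      proof (rule wp_use[OF wp_next_indices[where n = n and i = i and j = j and fl = fl]], goal_cases)
        case (9 s2 k2)
        have D: "pdist d (U' (rank fl i)) (U' (rank fl j)) = ?D"
          unfolding pdist_def L2_set_def using valid_round.hyps(4) False pr by simp
        have s2: "nats s2 1 = nats s 1" "nats s2 2 = nats s1 2" "nats s2 7 0 = d" "nats s2 9 0 = 0"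
          "nats s2 21 = nats s1 21" "reals s2 3 0 = F"
          using s1 by (simp_all add: same_nats[OF 9(2)] same_reals[OF 9(2)])
        have "rank fl i \<noteq> rank fl j"
          using pr(9) False rank_less[of i j fl] rank_less[of j i fl] by (metis nat_neq_iff pr(10))
        moreover have "holds_at (nats s 1) (nats s1 2 0) rest"
          using pr(1) 8(1) by (simp add: holds_at_append)
        ultimately show ?case
          unfolding D[symmetric]
          by (intro valid_round.IH) (use s2 9(1) 8(1) pr False rank_less in auto)
      qed (use s1 8(1) pr False in auto)
      then show ?thesis using False 8(1) s1 pr by (auto simp: wp_simps)
    qed
  qed (use pr valid_round.hyps in \<open>auto simp: holds_at_append\<close>)
qed

text \<open>Equal indices are answered before the sketch is looked at, and the empty sketch stands
  for the answer 0; in both cases the result cell keeps its initial value 0.\<close>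

definition recover :: com where
  "recover = Cond (BAnd (NLe (NCell 0 (NConst 1)) (NCell 0 (NConst 2)))
       (NLe (NCell 0 (NConst 2)) (NCell 0 (NConst 1)))) Skip
     (Cond (NLe (V 0) (NConst 0)) Skip
       (NSet 25 (NCell 0 (NConst 1)) ;; NSet 26 (NCell 0 (NConst 2)) ;; read_header ;; rounds))"

lemma pow_bits_pos: "0 < pow_bits K e"
  unfolding pow_bits_def by (rule prod_pos) simp

lemma wp_recovers: "wp recover (\<lambda>s' k'. P (reals s' 0 0)) (recovery_input b i j) 0 \<Longrightarrow> \<exists>v. recovers recover b i j v \<and> P v"
  unfolding wp_def recovers_def by blast

lemma recover_same: "\<exists>v. recovers recover b i i v \<and> v = 0"
  by (rule wp_recovers) (simp add: recover_def wp_simps recovery_input_def)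

lemma recover_empty: "\<exists>v. recovers recover [] i j v \<and> v = 0"
  by (rule wp_recovers) (simp add: recover_def wp_simps recovery_input_def)

lemma recover_valid:
  assumes b: "b = header_bits sg K e d n @ bs" and v: "valid \<epsilon> d n U bs" and ij: "i < n" "j < n" "i \<noteq> j"
    and F: "F = scale sg (pow_bits K e)"
  shows "\<exists>v. recovers recover b i j v \<and> \<bar>v - F * pdist d (U i) (U j)\<bar> \<le> \<epsilon> * (F * pdist d (U i) (U j))"
proof (rule wp_recovers)
  let ?P = "\<lambda>v. \<bar>v - F * pdist d (U i) (U j)\<bar> \<le> \<epsilon> * (F * pdist d (U i) (U j))"
  let ?s = "recovery_input b i j"
  have at: "holds_at (nats ?s 1) 0 b"
    unfolding holds_at_def recovery_input_def by simp
  have lb: "0 < length b" unfolding b header_bits_def by simp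
  have F0: "0 < F" unfolding F scale_def using pow_bits_pos by simp
  show "wp recover (\<lambda>s' k'. ?P (reals s' 0 0)) ?s 0"
    unfolding recover_def wp_simps
  proof (split if_split, intro conjI impI, goal_cases)
    case 1
    then show ?case using ij by (simp add: recovery_input_def)
  next
    case 2
    show ?case
    proof (split if_split, intro conjI impI, goal_cases)
      case 1
      then show ?case using lb by (simp add: recovery_input_def)
    next
      case 2
      show ?case
      proof (rule wp_use[OF wp_read_header[where sg = sg and K = K and e = e and d = d and n = n]], goal_cases)
        case 1
        show ?case using at b by (simp add: set_cell_def holds_at_append)
      next
        case (2 s1 k1)
        have s1: "nats s1 1 = nats ?s 1" "nats s1 9 0 = 0" "nats s1 21 = (\<lambda>_. 0)" "nats s1 25 0 = i" "nats s1 26 0 = j"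
          by (simp_all add: same_nats[OF 2(2)] set_cell_def) (auto simp: recovery_input_def)
        show ?case
          by (rule wp_rounds[OF v]) (use s1 2(1) at b ij F F0 in \<open>auto simp: holds_at_append\<close>)
      qed
    qed
  qed
qed

section \<open>Preprocessing\<close>

text \<open>Scalars are kept in cell 0 of an array. Arrays of naturals: 2 size of the current pointset, 3 \<open>d\<close>,
  4 their product, 10 \<open>H = 2 ^ g\<close>, 11 \<open>g\<close>, 12 \<open>d H\<close>, 13 \<open>M\<close>, 15 halving modulo \<open>M\<close>, 16 bad incidences of each shift,
  20 the chosen shift, 21 \<open>\<Lambda>\<close>, 22 \<open>d \<Lambda>\<close>, 23 length of the strings, 25 base addresses of the strings, 26 flags of the
  bad points, 28 bits of the strings, 29 \<open>lab\<close>, 30 number of classes, 31 \<open>first_odd\<close>, 32 pointers,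
  33 prefix lengths, 35 width of the binary fields, 36 powers of 2. Arrays of reals: 0 \<open>\<epsilon>\<close>, 1 input points,
  7 scale, 8 scaled coordinates.\<close>

abbreviation (input) True_b :: bexp where "True_b \<equiv> NLe (NConst 0) (NConst 0)"
abbreviation (input) False_b :: bexp where "False_b \<equiv> NLe (NConst 1) (NConst 0)"

definition emit_unary :: "nat \<Rightarrow> com" where
  "emit_unary x = (For 39 (V x) (Emit True_b) ;; Emit False_b)"

lemma mods_emit_unary [simp]: "nmods (emit_unary x) = {39}" "rmods (emit_unary x) = {}" "emits (emit_unary x)"
  unfolding emit_unary_def by auto

lemma wp_emit_unary:
  assumes "nats s x 0 = g" "x \<noteq> 39"
  shows "wp (emit_unary x) (\<lambda>s' k'. outbits s' = outbits s @ unary g \<and> k' \<le> k + 3 * g + 3) s k"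
  unfolding emit_unary_def wp_simps
proof (rule wp_For[where N = g and tb = 1 and I = "\<lambda>i s'. outbits s' = outbits s @ replicate i True"], goal_cases)
  case (2 s')
  then show ?case using assms by (simp add: same_nats)
next
  case (4 i s' k')
  then show ?case by (simp add: wp_simps replicate_append_same)
next
  case (5 s' k')
  then show ?case by (simp add: unary_def)
qed auto

section \<open>Radius, scale and normalized coordinates\<close>

definition scan :: com where
  "scan = (RSet 2 (RNum 0) ;; NSet 5 (NConst 0) ;;
     For 6 (V 2) (For 7 (V 3) (RSet 3 (RSub (RCell 1 (V 5)) (RCell 1 (V 7))) ;;
       RSet 3 (RSqrt (RMul (RV 3) (RV 3))) ;; Cond (RLe (RV 2) (RV 3)) (RSet 2 (RV 3)) Skip ;; Inc 5)))"

lemma mods_scan [simp]: "nmods scan = {5, 6, 7}" "rmods scan = {2, 3}" "\<not> emits scan"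
  unfolding scan_def by auto

definition rows :: "(nat \<Rightarrow> real) \<Rightarrow> nat \<Rightarrow> nat \<Rightarrow> nat \<Rightarrow> real" where
  "rows A d i k = A (i * d + k)"

text \<open>The maximum-norm radius around point 0 stands in for the diameter: it is found in one
  pass over the input, and it is what a cube centred at point 0 has to accommodate. The alternative
  \<open>R = 0\<close> reflects the initial value of the scan.\<close>

definition radius_of :: "nat \<Rightarrow> nat \<Rightarrow> (nat \<Rightarrow> nat \<Rightarrow> real) \<Rightarrow> real \<Rightarrow> bool" where
  "radius_of n d x R \<longleftrightarrow> (\<forall>i<n. \<forall>k<d. \<bar>x i k - x 0 k\<bar> \<le> R) \<and>
     (R = 0 \<or> (\<exists>i<n. \<exists>k<d. R = \<bar>x i k - x 0 k\<bar>))"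

lemma wp_scan:
  assumes "nats s 2 0 = n" "nats s 3 0 = d"
  shows "wp scan (\<lambda>s' k'. radius_of n d (rows (reals s 1) d) (reals s' 2 0) \<and> nats s' 5 0 = n * d \<and>
     k' \<le> k + 8 * (n * d) + 4 * n + 4) s k"
proof -
  let ?X = "rows (reals s 1) d"
  define P where "P i k R \<longleftrightarrow> 0 \<le> R \<and> (\<forall>i' k'. i' < n \<longrightarrow> k' < d \<longrightarrow> i' < i \<or> (i' = i \<and> k' < k) \<longrightarrow> \<bar>?X i' k' - ?X 0 k'\<bar> \<le> R) \<and>
     (R = 0 \<or> (\<exists>i<n. \<exists>k<d. R = \<bar>?X i k - ?X 0 k\<bar>))" for i k R
  show ?thesis
    unfolding scan_def wp_simps
  proof (rule wp_For[where N = n and tb = "8 * d + 2" and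
      I = "\<lambda>i s'. nats s' 5 0 = i * d \<and> P i 0 (reals s' 2 0)"], goal_cases)
    case 1
    show ?case by (simp add: set_cell_def P_def)
  next
    case (2 s')
    then show ?case using assms by (simp add: same_nats set_cell_def)
  next
    case (4 i s' k')
    have s': "nats s' 3 0 = d" "reals s' 1 = reals s 1"
      using assms by (simp_all add: same_nats[OF 4(4)] same_reals[OF 4(4)] set_cell_def)
    show ?case
    proof (rule wp_For[where N = d and tb = 6 and
        I = "\<lambda>j t. nats t 5 0 = i * d + j \<and> P i j (reals t 2 0)"], goal_cases)
      case 1
      then show ?case using 4(2) by (simp add: set_cell_def)
    next
      case (2 t)
      then show ?case using s' by (simp add: same_nats)
    next
      case (4 j t l)
      have t: "reals t 1 = reals s 1" using s' by (simp add: same_reals[OF 4(4)])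
      define c where "c = \<bar>?X i j - ?X 0 j\<bar>"
      have c: "\<bar>reals s 1 (i * d + j) - reals s 1 j\<bar> = c"
        unfolding c_def rows_def by simp
      define R where "R = reals t 2 0"
      have R: "P i j R" using 4(2) unfolding R_def by simp
      have P: "P i (Suc j) R'" if "R \<le> R'" "c \<le> R'" "R' = R \<or> R' = c" for R'
        unfolding P_def
      proof (intro conjI allI impI)
        show "0 \<le> R'" using that unfolding c_def by linarith
        show "\<bar>?X i' k' - ?X 0 k'\<bar> \<le> R'" if "i' < n" "k' < d" "i' < i \<or> i' = i \<and> k' < Suc j" for i' k'
        proof (cases "i' = i \<and> k' = j")
          case False
          then have "i' < i \<or> i' = i \<and> k' < j" using that(3) by (auto simp: less_Suc_eq)
          then have "\<bar>?X i' k' - ?X 0 k'\<bar> \<le> R" using R that(1,2) unfolding P_def by blast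
          then show ?thesis using \<open>R \<le> R'\<close> by (rule order_trans)
        qed (use \<open>c \<le> R'\<close> c_def in auto)
        show "R' = 0 \<or> (\<exists>i<n. \<exists>k<d. R' = \<bar>?X i k - ?X 0 k\<bar>)"
          using that(3) R 4(1) \<open>i < n\<close> unfolding P_def c_def by blast
      qed
      show ?case
        using conjunct1[OF 4(2)] 4(3) t P[of R] P[of c] c unfolding wp_simps
        by (auto simp: set_cell_def R_def)
    next
      case (5 t l)
      have "P (Suc i) 0 R" if "P i d R" for R
        using that unfolding P_def by (auto simp: less_Suc_eq)
      then show ?case using 5(1,4) by (auto simp: set_cell_def)
    qed auto
  next
    case (5 s' k')
    have "k' \<le> k + 8 * (n * d) + 4 * n + 4" using 5(4) by (simp add: algebra_simps)
    then show ?case using 5(1) unfolding P_def by (auto simp: radius_of_def)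
  qed auto
qed

text \<open>Rounds the radius, or its reciprocal, down to a power of 2 without a floor: squaring
  until the target is exceeded, then greedy division by the squares in decreasing order, which
  yields the bits of the exponent from the top.\<close>

definition exponent :: com where
  "exponent = (Cond (RLe (RNum 1) (RV 2)) (RSet 4 (RV 2) ;; Emit True_b)
       (RSet 4 (RDiv (RNum 1) (RV 2)) ;; Emit False_b) ;;
     NSet 9 (NConst 0) ;; RSet 5 (RNum 2) ;;
     While (RLe (RCell 5 (V 9)) (RV 4))
       (RAssign 5 (NAdd (V 9) (NConst 1)) (RMul (RCell 5 (V 9)) (RCell 5 (V 9))) ;; Inc 9) ;;
     emit_unary 9 ;; RSet 6 (RNum 1) ;;
     For 8 (V 9) (Cond (RLe (RCell 5 (NSub (V 9) (NAdd (V 8) (NConst 1)))) (RV 4))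
       (RSet 6 (RMul (RV 6) (RCell 5 (NSub (V 9) (NAdd (V 8) (NConst 1))))) ;;
        RSet 4 (RDiv (RV 4) (RCell 5 (NSub (V 9) (NAdd (V 8) (NConst 1))))) ;; Emit True_b)
       (Emit False_b)) ;;
     Cond (RLe (RNum 1) (RV 2)) (RSet 7 (RMul (RNum 4) (RV 6))) (RSet 7 (RDiv (RNum 4) (RV 6))))"

lemma mods_exponent [simp]: "nmods exponent = {9, 39, 8}" "rmods exponent = {4, 5, 6, 7}" "emits exponent"
  unfolding exponent_def by auto

text \<open>The last conjunct says that squaring did not go on for longer than necessary; it is what
  bounds \<open>K\<close>.\<close>

definition exponent_ok :: "real \<Rightarrow> bool \<Rightarrow> nat \<Rightarrow> (nat \<Rightarrow> bool) \<Rightarrow> bool" where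
  "exponent_ok R sg K e \<longleftrightarrow> (let v = (if 1 \<le> R then R else 1 / R) in sg = (1 \<le> R) \<and>
     pow_bits K e \<le> v \<and> v < 2 * pow_bits K e \<and> (0 < K \<longrightarrow> 2 ^ 2 ^ (K - 1) \<le> v))"

lemma tower_unbounded: "\<exists>B::nat. v < (2::real) ^ 2 ^ B"
proof -
  obtain B where "v < (2::real) ^ B" using real_arch_pow[of 2 v] by auto
  also have "(2::real) ^ B \<le> 2 ^ 2 ^ B" by (intro power_increasing) (auto intro: less_imp_le[OF less_exp])
  finally show ?thesis by blast
qed

lemma pow_sq: "(x::real) ^ 2 ^ n * x ^ 2 ^ n = x ^ 2 ^ Suc n"
  by (simp add: power2_eq_square[symmetric] power_mult[symmetric] mult.commute)

lemma wp_exponent: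
  assumes R: "reals s 2 0 = R" "0 < R"
  shows "wp exponent (\<lambda>s' k'. \<exists>sg K e. exponent_ok R sg K e \<and> reals s' 7 0 = scale sg (pow_bits K e) \<and>
     outbits s' = outbits s @ sg # unary K @ map e [0..<K] \<and> k' \<le> k + 12 * K + 20) s k"
proof -
  define v where "v = (if 1 \<le> R then R else 1 / R)"
  define sg where "sg = (1 \<le> R)"
  have v1: "1 \<le> v" using R unfolding v_def by (simp add: field_simps)
  obtain B where B: "v < 2 ^ 2 ^ B" using tower_unbounded by blast
  let ?Q = "\<lambda>s' k'. \<exists>sg K e. exponent_ok R sg K e \<and> reals s' 7 0 = scale sg (pow_bits K e) \<and>
     outbits s' = outbits s @ sg # unary K @ map e [0..<K] \<and> k' \<le> k + 12 * K + 20"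
  have main: "wp (While (RLe (RCell 5 (V 9)) (RV 4))
       (RAssign 5 (NAdd (V 9) (NConst 1)) (RMul (RCell 5 (V 9)) (RCell 5 (V 9))) ;; Inc 9) ;;
     emit_unary 9 ;; RSet 6 (RNum 1) ;;
     For 8 (V 9) (Cond (RLe (RCell 5 (NSub (V 9) (NAdd (V 8) (NConst 1)))) (RV 4))
       (RSet 6 (RMul (RV 6) (RCell 5 (NSub (V 9) (NAdd (V 8) (NConst 1))))) ;;
        RSet 4 (RDiv (RV 4) (RCell 5 (NSub (V 9) (NAdd (V 8) (NConst 1))))) ;; Emit True_b)
       (Emit False_b)) ;;
     Cond (RLe (RNum 1) (RV 2)) (RSet 7 (RMul (RNum 4) (RV 6))) (RSet 7 (RDiv (RNum 4) (RV 6)))) ?Q s0 k0"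
    if s0: "reals s0 2 0 = R" "reals s0 4 0 = v" "nats s0 9 0 = 0" "reals s0 5 0 = 2"
      "outbits s0 = outbits s @ [sg]" "k0 \<le> k + 5" for s0 k0
    unfolding wp_simps
  proof (rule wp_While[where B = B and tb = 2 and
      I = "\<lambda>i s'. nats s' 9 0 = i \<and> (\<forall>r\<le>i. reals s' 5 r = 2 ^ 2 ^ r) \<and> (0 < i \<longrightarrow> 2 ^ 2 ^ (i - 1) \<le> v)"], goal_cases)
    case 1
    then show ?case using s0 by simp
  next
    case (2 i s' k')
    have s': "reals s' 4 0 = v" using s0 by (simp add: same_reals[OF 2(2)])
    have c: "2 ^ 2 ^ i \<le> v" using 2(1,3) s' by simp
    have "i < B"
    proof (rule ccontr)
      assume "\<not> i < B"
      then have "(2::real) ^ 2 ^ B \<le> 2 ^ 2 ^ i" by (intro power_increasing) auto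
      then show False using c B by linarith
    qed
    then show ?case using 2(1) c by (auto simp: wp_simps set_cell_def le_Suc_eq pow_sq)
  next
    case (3 K s1 k1)
    have s1: "nats s1 9 0 = K" "\<And>r. r \<le> K \<Longrightarrow> reals s1 5 r = 2 ^ 2 ^ r" "reals s1 2 0 = R" "reals s1 4 0 = v"
      "outbits s1 = outbits s @ [sg]" "k1 \<le> k + 6 + 3 * K"
      using 3(1,4) s0 by (auto simp: same_reals[OF 3(2)] same_outbits[OF 3(2)])
    have vK: "v < 2 ^ 2 ^ K" using 3(3) s1 by simp
    show ?case
    proof (rule wp_use[OF wp_emit_unary[where g = K]], goal_cases)
      case (3 s2 k2)
      have s2: "nats s2 9 0 = K" "reals s2 = reals s1" "outbits s2 = outbits s @ sg # unary K"
         "k2 \<le> k + 9 + 6 * K"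
        using 3 s1 by (auto simp: same_nats[OF 3(2)] same_reals[OF 3(2)] fun_eq_iff)
      show ?case
        unfolding wp_simps
      \<comment> \<open>Product times remainder is always the target, and the remainder lies between
        1 and the square dealt with last; in the end it is below 2.\<close>
      proof (rule wp_For[where N = K and tb = 4 and
          I = "\<lambda>i s'. \<exists>e. outbits s' = outbits s2 @ map e [0..<i] \<and>
            reals s' 6 0 = (\<Prod>r<i. if e r then 2 ^ 2 ^ (K - Suc r) else 1) \<and>
            reals s' 6 0 * reals s' 4 0 = v \<and> 1 \<le> reals s' 4 0 \<and> reals s' 4 0 < 2 ^ 2 ^ (K - i)"], goal_cases)
        case 1
        then show ?case using s2 s1 v1 vK by (auto simp: set_cell_def)
      next
        case (2 s')
        then show ?case using s2 by (simp add: same_nats)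
      next
        case (4 i s' k')
        from 4(2) obtain e where e: "outbits s' = outbits s2 @ map e [0..<i]"
            "reals s' 6 0 = (\<Prod>r<i. if e r then 2 ^ 2 ^ (K - Suc r) else 1)"
            "reals s' 6 0 * reals s' 4 0 = v" "1 \<le> reals s' 4 0" "reals s' 4 0 < 2 ^ 2 ^ (K - i)" by blast
        have s': "nats s' 9 0 = K" "reals s' 5 (K - Suc i) = 2 ^ 2 ^ (K - Suc i)"
          using s2 s1 by (simp_all add: same_nats[OF 4(4)] same_reals[OF 4(4)] set_cell_def)
        let ?p = "(2::real) ^ 2 ^ (K - Suc i)"
        have pp: "(2::real) ^ 2 ^ (K - i) = ?p * ?p"
          using 4(1) by (simp add: pow_sq Suc_diff_Suc)
        have p0: "0 < ?p" by simp
        show ?case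
        proof (cases "?p \<le> reals s' 4 0")
          case True
          let ?e = "e(i := True)"
          have "map ?e [0..<i] = map e [0..<i]" by simp
          moreover have "(\<Prod>r<i. if ?e r then 2 ^ 2 ^ (K - Suc r) else (1::real)) =
              (\<Prod>r<i. if e r then 2 ^ 2 ^ (K - Suc r) else 1)" by (rule prod.cong) auto
          moreover have "reals s' 4 0 / ?p < ?p" using e(5) pp p0 by (simp add: divide_less_eq)
          moreover have "1 \<le> reals s' 4 0 / ?p" using True p0 by (simp add: le_divide_eq)
          ultimately show ?thesis
            using e s' True 4(3) by (auto simp: wp_simps set_cell_def intro!: exI[of _ ?e])
        next
          case False
          let ?e = "e(i := False)"
          have "map ?e [0..<i] = map e [0..<i]" by simp
          moreover have "(\<Prod>r<i. if ?e r then 2 ^ 2 ^ (K - Suc r) else (1::real)) =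
              (\<Prod>r<i. if e r then 2 ^ 2 ^ (K - Suc r) else 1)" by (rule prod.cong) auto
          ultimately show ?thesis
            using e s' False 4(3) by (auto simp: wp_simps set_cell_def intro!: exI[of _ ?e])
        qed
      next
        case (5 s3 k3)
        from 5(1) obtain e where e': "outbits s3 = outbits s2 @ map e [0..<K]"
            "reals s3 6 0 = (\<Prod>r<K. if e r then 2 ^ 2 ^ (K - Suc r) else 1)"
            "reals s3 6 0 * reals s3 4 0 = v" "1 \<le> reals s3 4 0" "reals s3 4 0 < 2 ^ 2 ^ (K - K)"
          by blast
        then have e: "outbits s3 = outbits s2 @ map e [0..<K]" "reals s3 6 0 = pow_bits K e"
            "pow_bits K e * reals s3 4 0 = v" "1 \<le> reals s3 4 0" "reals s3 4 0 < 2"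
          unfolding pow_bits_def by auto
        have R3: "reals s3 2 0 = R" using s2 s1 by (simp add: same_reals[OF 5(3)] set_cell_def)
        have p0: "0 < pow_bits K e" by (rule pow_bits_pos)
        have "pow_bits K e \<le> v" "v < 2 * pow_bits K e"
          using e(3-5) p0 mult_left_mono[OF e(4), of "pow_bits K e"] mult_strict_left_mono[OF e(5) p0] by auto
        moreover have "0 < K \<longrightarrow> 2 ^ 2 ^ (K - 1) \<le> v" using \<open>nats s1 9 0 = K \<and> _\<close> by simp
        ultimately have ok: "exponent_ok R sg K e"
          unfolding exponent_ok_def v_def[symmetric] sg_def Let_def by simp
        have kk: "k3 \<le> k + 12 * K + 12" using 5(4) s2(4) by simp
        show ?case
          unfolding wp_simps
          by (split if_split, intro conjI impI; rule exI[of _ sg]; rule exI[of _ K]; rule exI[of _ e])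
            (use ok e R3 s2 kk in \<open>auto simp: set_cell_def scale_def sg_def\<close>)
      qed auto
    qed (use s1 in auto)
  qed
  show ?thesis
    unfolding exponent_def
    apply (subst wp_Seq, subst wp_Cond, split if_split, intro conjI impI)
    unfolding wp_Seq[of "NSet 9 (NConst 0)"] wp_Seq[of "RSet 5 (RNum 2)"]
      wp_Seq[of "RSet 4 _"] wp_NAssign wp_RAssign wp_Emit
     apply (rule main; use R in \<open>simp add: set_cell_def v_def sg_def\<close>)
    apply (rule main; use R in \<open>simp add: set_cell_def v_def sg_def\<close>)
    done
qed

definition fill :: com where
  "fill = (NSet 5 (NConst 0) ;; For 6 (V 2) (For 7 (V 3)
     (RAssign 8 (V 5) (RAdd (RDiv (RSub (RCell 1 (V 5)) (RCell 1 (V 7))) (RV 7)) (RDiv (RNum 1) (RNum 2))) ;; Inc 5)))"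

lemma mods_fill [simp]: "nmods fill = {5, 6, 7}" "rmods fill = {8}" "\<not> emits fill"
  unfolding fill_def by auto

lemma wp_fill:
  assumes "nats s 2 0 = n" "nats s 3 0 = d" "reals s 7 0 = F"
  shows "wp fill (\<lambda>s' k'. (\<forall>i<n. \<forall>k<d. rows (reals s' 8) d i k =
      (rows (reals s 1) d i k - rows (reals s 1) d 0 k) / F + 1 / 2) \<and> k' \<le> k + 4 * (n * d) + 4 * n + 3) s k"
proof -
  let ?u = "\<lambda>q. (reals s 1 q - reals s 1 (q mod d)) / F + 1 / 2"
  show ?thesis
    unfolding fill_def wp_simps
  proof (rule wp_For[where N = n and tb = "4 * d + 2" and
      I = "\<lambda>i s'. nats s' 5 0 = i * d \<and> (\<forall>q<i * d. reals s' 8 q = ?u q)"], goal_cases)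
    case 1
    show ?case by (simp add: set_cell_def)
  next
    case (2 s')
    then show ?case using assms by (simp add: same_nats set_cell_def)
  next
    case (4 i s' k')
    have s': "nats s' 3 0 = d" "reals s' 1 = reals s 1" "reals s' 7 0 = F"
      using assms by (simp_all add: same_nats[OF 4(4)] same_reals[OF 4(4)] set_cell_def)
    show ?case
    proof (rule wp_For[where N = d and tb = 2 and
        I = "\<lambda>j t. nats t 5 0 = i * d + j \<and> (\<forall>q<i * d + j. reals t 8 q = ?u q)"], goal_cases)
      case 1
      then show ?case using 4(2) by (simp add: set_cell_def)
    next
      case (2 t)
      then show ?case using s' by (simp add: same_nats)
    next
      case (4 j t l)
      have t: "reals t 1 = reals s 1" "reals t 7 0 = F" using s' by (simp_all add: same_reals[OF 4(4)])
      then show ?case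
        using 4(1-3) by (auto simp: wp_simps set_cell_def less_Suc_eq)
    next
      case (5 t l)
      then show ?case by (auto simp: set_cell_def algebra_simps)
    qed auto
  next
    case (5 s' k')
    have "k' \<le> k + 4 * (n * d) + 4 * n + 3" using 5(4) by (simp add: algebra_simps)
    moreover have "rows (reals s' 8) d i k = (rows (reals s 1) d i k - rows (reals s 1) d 0 k) / F + 1 / 2"
      if "i < n" "k < d" for i k
    proof -
      have "i * d + k < (i + 1) * d" using that by simp
      also have "\<dots> \<le> n * d" using that by (intro mult_right_mono) auto
      finally show ?thesis using 5(1) that unfolding rows_def by simp
    qed
    ultimately show ?case by auto
  qed auto
qed

section \<open>One attempt at a round\<close>

definition tables :: com where
  "tables = (NSet 13 (NAdd (NAdd (NAdd (V 12) (V 12)) (NAdd (V 12) (V 12))) (NConst 1)) ;;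
     For 39 (V 13) (NSet 14 (NAdd (V 39) (V 39)) ;;
       Cond (NLe (V 13) (V 14)) (NSet 14 (NSub (V 14) (V 13))) Skip ;;
       NAssign 15 (V 14) (V 39) ;; NAssign 16 (V 39) (NConst 0)))"

lemma mods_tables [simp]: "nmods tables = {13, 39, 14, 15, 16}" "rmods tables = {}" "\<not> emits tables"
  unfolding tables_def by auto

lemma wp_tables:
  assumes "nats s 12 0 = d * H" and M: "M = 4 * d * H + 1"
  shows "wp tables (\<lambda>s' k'. nats s' 13 0 = M \<and> halving M (nats s' 15) \<and> (\<forall>v<M. nats s' 16 v = 0) \<and>
     k' \<le> k + 7 * M + 3) s k"
  unfolding tables_def wp_simps
proof (rule wp_For[where N = M and tb = 5 and
    I = "\<lambda>i s'. (\<forall>v<i. nats s' 15 ((2 * v) mod M) = v) \<and> (\<forall>v<i. nats s' 16 v = 0)"], goal_cases)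
  case (2 s')
  then show ?case using assms by (simp add: same_nats set_cell_def)
next
  case (4 i s' k')
  have M': "nats s' 13 0 = M" using assms by (simp add: same_nats[OF 4(4)] set_cell_def)
  have i2: "(2 * i) mod M = (if M \<le> i + i then i + i - M else i + i)"
    using 4(1) by (auto simp: le_mod_geq mult_2)
  have odd: "odd M" using M by simp
  \<comment> \<open>No entry of the table is overwritten, since doubling is injective modulo an odd
    number.\<close>
  have ne: "(2 * i) mod M \<noteq> (2 * v) mod M" if "v < i" for v
    using double_mod_inj[OF odd, of i v] that 4(1) by auto
  show ?case
    using 4(1-3) M' i2 ne ne[symmetric] by (auto simp: wp_simps set_cell_def less_Suc_eq)
next
  case (5 s' k')
  have "halving M (nats s' 15)"
    by (rule halving_exists) (use M 5(1) in auto)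
  then show ?case using 5 assms by (auto simp: same_nats[OF 5(3)] set_cell_def)
qed auto

definition sub_mod :: "nat \<Rightarrow> nat \<Rightarrow> com" where
  "sub_mod x a = Cond (NLe (V 17) (V a)) (NSet x (NSub (V a) (V 17))) (NSet x (NSub (NAdd (V a) (V 13)) (V 17)))"

lemma mods_sub_mod [simp]: "nmods (sub_mod x a) = {x}" "rmods (sub_mod x a) = {}" "\<not> emits (sub_mod x a)"
  unfolding sub_mod_def by auto

lemma wp_sub_mod: "wp (sub_mod x a) Q s k =
    Q (s\<lparr>nats := set_cell (nats s) x 0 (subm (nats s 13 0) (nats s a 0) (nats s 17 0))\<rparr>) (k + 2)"
  unfolding sub_mod_def subm_def by (simp add: wp_simps)

abbreviation (input) Inc_cell :: "nat \<Rightarrow> nat \<Rightarrow> com" where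
  "Inc_cell a x \<equiv> NAssign a (V x) (NAdd (NCell a (V x)) (NConst 1))"

text \<open>Linear in \<open>n * d * H\<close>: the two candidates are updated in constant time per
  level, whereas testing each coordinate against each shift would cost a further factor
  \<open>M\<close>.\<close>

definition count_bad :: com where
  "count_bad = For 6 (V 4) (RSet 9 (RCell 8 (V 6)) ;; NSet 17 (NConst 1) ;; NSet 18 (NConst 0) ;;
     For 8 (V 10) (NSet 17 (NCell 15 (V 17)) ;; RSet 9 (RAdd (RV 9) (RV 9)) ;;
       Cond (RLe (RNum 1) (RV 9)) (RSet 9 (RSub (RV 9) (RNum 1)) ;; sub_mod 18 18) Skip ;;
       sub_mod 19 18 ;; Inc_cell 16 18 ;; Inc_cell 16 19))"

lemma mods_count_bad [simp]:
  "nmods count_bad = {6, 17, 18, 8, 19, 16}" "rmods count_bad = {9}" "\<not> emits count_bad"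
  unfolding count_bad_def by auto

lemma bads_Suc: "bads M hf (Suc h) u j = bads M hf h u j + (of_bool (jseq M hf u (Suc h) = j) +
     of_bool (subm M (jseq M hf u (Suc h)) (wseq hf (Suc h)) = j))"
  unfolding bads_def by simp

text \<open>The inner loop carries the fractional part of \<open>2 ^ h * u\<close>, the inverse of
  \<open>2 ^ h\<close> and the first candidate of level \<open>h\<close>. The counters are raised
  after the update, hence for the levels 1 to \<open>H\<close>; level 0 is the unit cube
  itself.\<close>

lemma wp_count_bad:
  assumes st: "nats s 4 0 = N" "nats s 10 0 = H" "nats s 13 0 = M" and hf: "halving M (nats s 15)" "1 < M"
    and B: "\<forall>j<M. nats s 16 j = 0" and u: "\<And>p. p < N \<Longrightarrow> 0 \<le> reals s 8 p \<and> reals s 8 p < 1"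
  shows "wp count_bad (\<lambda>s' k'. (\<forall>j<M. nats s' 16 j = (\<Sum>p<N. bads M (nats s 15) H (reals s 8 p) j)) \<and>
     k' \<le> k + N * (12 * H + 7) + 2) s k"
  unfolding count_bad_def wp_simps
proof (rule wp_For[where N = N and tb = "12 * H + 5" and
    I = "\<lambda>i s'. \<forall>j<M. nats s' 16 j = (\<Sum>p<i. bads M (nats s 15) H (reals s 8 p) j)"], goal_cases)
  case 1
  then show ?case using B by (simp add: set_cell_def)
next
  case (2 s')
  then show ?case using st by (simp add: same_nats set_cell_def)
next
  case (4 i s' k')
  let ?u = "reals s 8 i" and ?hf = "nats s 15"
  have s': "nats s' 10 0 = H" "nats s' 13 0 = M" "nats s' 15 = ?hf" "reals s' 8 = reals s 8"
    using st by (simp_all add: same_nats[OF 4(4)] same_reals[OF 4(4)])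
  have fu: "frac ?u = ?u" using u[OF 4(1)] by (simp add: frac_eq)
  show ?case
    unfolding wp_simps
  proof (rule wp_For[where N = H and tb = 10 and I = "\<lambda>h t. reals t 9 0 = frac (2 ^ h * ?u) \<and>
      nats t 17 0 = wseq ?hf h \<and> nats t 18 0 = jseq M ?hf ?u h \<and>
      (\<forall>j<M. nats t 16 j = (\<Sum>p<i. bads M ?hf H (reals s 8 p) j) + bads M ?hf h ?u j)"], goal_cases)
    case 1
    then show ?case using 4(2,3) s' fu by (simp add: set_cell_def bads_def)
  next
    case (2 t)
    then show ?case using s' by (simp add: same_nats set_cell_def)
  next
    case (4 h t l)
    have t: "nats t 13 0 = M" "nats t 15 = ?hf"
      using s' by (simp_all add: same_nats[OF 4(4)] set_cell_def)
    have d: "1 \<le> frac (2 ^ h * ?u) + frac (2 ^ h * ?u) \<longleftrightarrow> dig ?u h" unfolding dig_def by simp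
    have ff: "frac (2 ^ Suc h * ?u) = frac (2 ^ h * ?u) + frac (2 ^ h * ?u) - of_bool (dig ?u h)"
      unfolding frac_pow_Suc by simp
    have l: "jseq M ?hf ?u (Suc h) < M" "subm M (jseq M ?hf ?u (Suc h)) (wseq ?hf (Suc h)) < M"
      using jseq_less[OF hf] wseq_less[OF hf] subm_less by blast+
    show ?case
    proof (cases "dig ?u h")
      case True
      define J where "J = jseq M ?hf ?u (Suc h)"
      define J' where "J' = subm M J (wseq ?hf (Suc h))"
      have J: "subm M (jseq M ?hf ?u h) (?hf (wseq ?hf h)) = J" "subm M J (?hf (wseq ?hf h)) = J'"
        unfolding J_def J'_def using True by simp_all
      show ?thesis
        using J 4(2,3) t d True unfolding bads_Suc J_def[symmetric] J'_def[symmetric] ff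
        \<comment> \<open>The case distinction is about two updates of one counter, which would
          count twice, just as in \<open>bads\<close>.\<close>
        by (cases "J = J'") (simp_all add: wp_simps wp_sub_mod set_cell_def J)
    next
      case False
      define J where "J = jseq M ?hf ?u h"
      define J' where "J' = subm M J (wseq ?hf (Suc h))"
      have J: "jseq M ?hf ?u (Suc h) = J" "subm M J (?hf (wseq ?hf h)) = J'"
        unfolding J_def J'_def using False by simp_all
      show ?thesis
        using J(2) 4(2,3) t d False unfolding bads_Suc J(1) J_def[symmetric] J'_def[symmetric] ff
        by (cases "J = J'") (simp_all add: wp_simps wp_sub_mod set_cell_def J(2))
    qed
  next
    case (5 t l)
    then show ?case by (auto simp: set_cell_def)
  qed auto
next
  case (5 s' k')
  then show ?case by (simp add: algebra_simps)
qed auto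

definition best_shift :: com where
  "best_shift = (NSet 20 (NConst 0) ;;
     For 39 (V 13) (Cond (NLe (NCell 16 (V 20)) (NCell 16 (V 39))) Skip (NSet 20 (V 39))))"

lemma mods_best_shift [simp]: "nmods best_shift = {20, 39}" "rmods best_shift = {}" "\<not> emits best_shift"
  unfolding best_shift_def by auto

lemma wp_best_shift:
  assumes "nats s 13 0 = M" "0 < M"
  shows "wp best_shift (\<lambda>s' k'. nats s' 20 0 < M \<and> (\<forall>j<M. nats s 16 (nats s' 20 0) \<le> nats s 16 j) \<and>
     k' \<le> k + 4 * M + 3) s k"
  unfolding best_shift_def wp_simps
proof (rule wp_For[where N = M and tb = 2 and
    I = "\<lambda>i s'. nats s' 20 0 < M \<and> (\<forall>j<i. nats s 16 (nats s' 20 0) \<le> nats s 16 j)"], goal_cases)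
  case (2 s')
  then show ?case using assms by (simp add: same_nats set_cell_def)
next
  case (4 i s' k')
  have "nats s' 16 = nats s 16" by (simp add: same_nats[OF 4(4)] set_cell_def)
  then show ?case
    using 4(1-3) by (auto simp: wp_simps set_cell_def less_Suc_eq)
qed (use assms in \<open>auto simp: set_cell_def\<close>)

text \<open>Doubles \<epsilon> until the hypothesis of \<open>est_accurate\<close> on \<Lambda>
  holds. The first such \<Lambda> is taken, and its minimality bounds the size of the
  sketch.\<close>

definition precision :: com where
  "precision = (NSet 21 (NConst 0) ;; RSet 10 (RV 0) ;;
     While (BNot (RLe (RMul (RMul (RNum 4) (ROfNat (V 13))) (ROfNat (V 3))) (RV 10)))
       (RSet 10 (RAdd (RV 10) (RV 10)) ;; Inc 21) ;;
     NSet 22 (NConst 0) ;; For 8 (V 21) (NSet 22 (NAdd (V 22) (V 3))) ;;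
     NSet 23 (NAdd (V 12) (V 22)) ;; NSet 41 (NAdd (V 10) (V 21)))"

lemma mods_precision [simp]:
  "nmods precision = {21, 22, 8, 23, 41}" "rmods precision = {10}" "\<not> emits precision"
  unfolding precision_def by auto

lemma wp_precision:
  assumes st: "nats s 13 0 = M" "nats s 3 0 = d" "nats s 10 0 = H" "nats s 12 0 = d * H" and e: "reals s 0 0 = \<epsilon>" "0 < \<epsilon>"
  shows "wp precision (\<lambda>s' k'. \<exists>\<Lambda>. nats s' 21 0 = \<Lambda> \<and> nats s' 22 0 = d * \<Lambda> \<and> nats s' 23 0 = d * (H + \<Lambda>) \<and>
     nats s' 41 0 = H + \<Lambda> \<and> 4 * real M * real d \<le> 2 ^ \<Lambda> * \<epsilon> \<and>
     (0 < \<Lambda> \<longrightarrow> 2 ^ (\<Lambda> - 1) * \<epsilon> < 4 * real M * real d) \<and> k' \<le> k + 6 * \<Lambda> + 8) s k"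
proof -
  obtain B where "4 * real M * real d / \<epsilon> < (2::real) ^ B"
    using real_arch_pow[of 2 "4 * real M * real d / \<epsilon>"] by auto
  then have B: "4 * real M * real d < 2 ^ B * \<epsilon>" using e by (simp add: divide_less_eq)
  show ?thesis
    unfolding precision_def wp_simps
  proof (rule wp_While[where B = B and tb = 2 and I = "\<lambda>i s'. nats s' 21 0 = i \<and> reals s' 10 0 = 2 ^ i * \<epsilon> \<and>
      (0 < i \<longrightarrow> 2 ^ (i - 1) * \<epsilon> < 4 * real M * real d)"], goal_cases)
    case 1
    then show ?case using e by (simp add: set_cell_def)
  next
    case (2 i s' k')
    have s': "nats s' 13 0 = M" "nats s' 3 0 = d" using st by (simp_all add: same_nats[OF 2(2)] set_cell_def)
    then have c: "2 ^ i * \<epsilon> < 4 * real M * real d" using 2(1,3) by simp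
    have "i < B"
    proof (rule ccontr)
      assume "\<not> i < B"
      then have "(2::real) ^ B * \<epsilon> \<le> 2 ^ i * \<epsilon>" using e by (intro mult_right_mono power_increasing) auto
      then show False using c B by linarith
    qed
    then show ?case using 2(1) c by (simp add: wp_simps set_cell_def)
  next
    case (3 \<Lambda> s1 k1)
    have s1: "nats s1 13 0 = M" "nats s1 3 0 = d" "nats s1 10 0 = H" "nats s1 12 0 = d * H"
      using st by (simp_all add: same_nats[OF 3(2)] set_cell_def)
    show ?case
      unfolding wp_simps
    proof (rule wp_For[where N = \<Lambda> and tb = 1 and I = "\<lambda>i s'. nats s' 22 0 = d * i"], goal_cases)
      case (2 s')
      then show ?case using 3(1) by (simp add: same_nats set_cell_def)
    next
      case (4 i s' k')
      have "nats s' 3 0 = d" using s1 by (simp add: same_nats[OF 4(4)] set_cell_def)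
      then show ?case using 4(1-3) by (simp add: wp_simps set_cell_def)
    next
      case (5 s2 k2)
      have s2: "nats s2 10 0 = H" "nats s2 12 0 = d * H" "nats s2 21 0 = \<Lambda>"
        using s1 3(1) by (simp_all add: same_nats[OF 5(3)] set_cell_def)
      show ?case
        using 5(1,4) 3 s2 s1 by (simp add: wp_simps set_cell_def algebra_simps)
    qed (auto simp: set_cell_def)
  qed
qed

text \<open>Interleaving happens through the addresses: coordinate \<open>k\<close> starts at offset
  \<open>k\<close> and moves by \<open>d\<close> per level. Only the first \<open>H\<close> levels
  count for the flag; the \<Lambda> further ones fill the windows that reach beyond the last
  branching level.\<close>

definition digits :: com where
  "digits = (NSet 5 (NConst 0) ;; NSet 24 (NConst 0) ;;
     For 6 (V 2) (NAssign 25 (V 6) (V 24) ;; NAssign 26 (V 6) (NConst 0) ;;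
       For 7 (V 3) (RSet 11 (RDiv (RAdd (RCell 8 (V 5)) (ROfNat (V 20))) (ROfNat (V 13))) ;;
         NSet 27 (NAdd (V 24) (V 7)) ;;
         For 8 (V 41) (RSet 11 (RAdd (RV 11) (RV 11)) ;;
           Cond (RLe (RNum 1) (RV 11)) (NAssign 28 (V 27) (NConst 1) ;; RSet 11 (RSub (RV 11) (RNum 1)))
             (NAssign 28 (V 27) (NConst 0)) ;;
           Cond (BAnd (BNot (NLe (V 10) (V 8))) (BNot (BAnd (RLe (RNum 1) (RMul (ROfNat (V 13)) (RV 11)))
               (RLe (RMul (ROfNat (V 13)) (RV 11)) (RSub (ROfNat (V 13)) (RNum 1))))))
             (NAssign 26 (V 6) (NConst 1)) Skip ;;
           NSet 27 (NAdd (V 27) (V 3))) ;;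
         Inc 5) ;;
       NSet 24 (NAdd (V 24) (V 23))))"

lemma mods_digits [simp]:
  "nmods digits = {5, 24, 6, 25, 26, 7, 27, 8, 28}" "rmods digits = {11}" "\<not> emits digits"
  unfolding digits_def by auto

definition shifted :: "(nat \<Rightarrow> real) \<Rightarrow> nat \<Rightarrow> nat \<Rightarrow> nat \<Rightarrow> nat \<Rightarrow> nat \<Rightarrow> real" where
  "shifted U d j M i k = (U (i * d + k) + real j) / real M"

definition dstring :: "nat \<Rightarrow> (nat \<Rightarrow> nat \<Rightarrow> real) \<Rightarrow> nat \<Rightarrow> nat \<Rightarrow> bool" where
  "dstring d y i t = dig (y i (t mod d)) (t div d)"

lemma good_num_Suc: "good_num M (Suc h) y \<longleftrightarrow> good_num M h y \<and>
    1 \<le> real M * frac (2 ^ Suc h * y) \<and> real M * frac (2 ^ Suc h * y) \<le> real M - 1"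
  unfolding good_num_def by (auto simp: less_Suc_eq)

lemma wp_digits:
  assumes st: "nats s 2 0 = n" "nats s 3 0 = d" "nats s 41 0 = Q" "nats s 10 0 = H" "nats s 13 0 = M"
      "nats s 20 0 = j" "nats s 23 0 = d * Q"
    and M: "0 < M" and HQ: "H \<le> Q" and y: "y = shifted (reals s 8) d j M"
    and y01: "\<And>i k. i < n \<Longrightarrow> k < d \<Longrightarrow> 0 \<le> y i k \<and> y i k < 1"
  shows "wp digits (\<lambda>s' k'. (\<forall>i<n. nats s' 25 i = i * (d * Q) \<and>
      nats s' 26 i = of_bool (\<not> (\<forall>k<d. good_num M H (y i k))) \<and>
      (\<forall>t<d * Q. nats s' 28 (i * (d * Q) + t) = of_bool (dstring d y i t))) \<and>
     k' \<le> k + n * (d * (10 * Q + 7) + 7) + 4) s k"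
proof -
  let ?NB = "d * Q" and ?S = "dstring d y"
  \<comment> \<open>The bits written so far, in the order of the nested loops: strings, then
    coordinates, then levels.\<close>
  define X where "X i k h p t \<longleftrightarrow> p < n \<and> (p < i \<or> (p = i \<and> (t mod d < k \<or> (t mod d = k \<and> t div d < h))))" for i k h p t
  let ?G = "\<lambda>i. \<forall>k<d. good_num M H (y i k)"
  show ?thesis
    unfolding digits_def wp_simps
  proof (rule wp_For[where N = n and tb = "d * (10 * Q + 7) + 5" and I = "\<lambda>i s'. nats s' 5 0 = i * d \<and>
      nats s' 24 0 = i * ?NB \<and> (\<forall>i'<i. nats s' 25 i' = i' * ?NB \<and> nats s' 26 i' = of_bool (\<not> ?G i')) \<and>
      consistent (X i 0 0) ?NB (nats s' 28) ?S"], goal_cases)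
    case 1
    then show ?case by (simp add: set_cell_def consistent_def X_def)
  next
    case (2 s')
    then show ?case using st by (simp add: same_nats set_cell_def)
  next
    case (4 i s' k')
    note i = 4(1)
    have s': "nats s' 3 0 = d" "nats s' 41 0 = Q" "nats s' 10 0 = H" "nats s' 13 0 = M" "nats s' 20 0 = j"
      "nats s' 23 0 = ?NB" "reals s' 8 = reals s 8"
      using st by (simp_all add: same_nats[OF 4(4)] same_reals[OF 4(4)] set_cell_def)
    show ?case
      unfolding wp_simps
    proof (rule wp_For[where N = d and tb = "10 * Q + 5" and I = "\<lambda>k t. nats t 5 0 = i * d + k \<and>
        (\<forall>i'<i. nats t 25 i' = i' * ?NB \<and> nats t 26 i' = of_bool (\<not> ?G i')) \<and> nats t 25 i = i * ?NB \<and>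
        nats t 26 i = of_bool (\<not> (\<forall>k'<k. good_num M H (y i k'))) \<and>
        consistent (X i k 0) ?NB (nats t 28) ?S"], goal_cases)
      case 1
      then show ?case using 4(2,3) by (simp add: set_cell_def)
    next
      case (2 t)
      then show ?case using s' by (simp add: same_nats set_cell_def)
    next
      case (4 k t l)
      note k = 4(1)
      have t: "nats t 3 0 = d" "nats t 41 0 = Q" "nats t 10 0 = H" "nats t 13 0 = M" "nats t 20 0 = j"
        "nats t 23 0 = ?NB" "reals t 8 = reals s 8" "nats t 6 0 = i" "nats t 24 0 = i * ?NB"
        using s' \<open>nats s' 6 0 = i\<close> \<open>nats s' 5 0 = i * d \<and> _\<close>
        by (simp_all add: same_nats[OF 4(4)] same_reals[OF 4(4)] set_cell_def)
      have fy: "frac (y i k) = y i k" using y01[OF i k] by (simp add: frac_eq)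
      show ?case
        unfolding wp_simps
      proof (rule wp_For[where N = Q and tb = 8 and I = "\<lambda>h r. reals r 11 0 = frac (2 ^ h * y i k) \<and>
          nats r 27 0 = i * ?NB + (h * d + k) \<and> nats r 5 0 = i * d + k \<and>
          (\<forall>i'<i. nats r 25 i' = i' * ?NB \<and> nats r 26 i' = of_bool (\<not> ?G i')) \<and> nats r 25 i = i * ?NB \<and>
          nats r 26 i = of_bool (\<not> ((\<forall>k'<k. good_num M H (y i k')) \<and> good_num M (min h H) (y i k))) \<and>
          consistent (X i k h) ?NB (nats r 28) ?S"], goal_cases)
        case 1
        have "good_num M 0 (y i k)" unfolding good_num_def by simp
        then show ?case using 4(2,3) t fy by (simp add: set_cell_def y shifted_def)
      next
        case (2 r)
        then show ?case using t by (simp add: same_nats set_cell_def)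
      next
        case (4 h r m)
        have r: "nats r 3 0 = d" "nats r 10 0 = H" "nats r 13 0 = M" "nats r 6 0 = i"
          using t by (simp_all add: same_nats[OF 4(4)] set_cell_def)
        define f where "f = frac (2 ^ Suc h * y i k)"
        define b where "b = dig (y i k) h"
        define q where "q = h * d + k"
        have ff: "frac (2 ^ h * y i k) + frac (2 ^ h * y i k) = f + of_bool b"
          unfolding f_def b_def frac_pow_Suc by simp
        have db: "1 \<le> f + of_bool b \<longleftrightarrow> b"
          unfolding ff[symmetric] unfolding b_def dig_def by simp
        have q: "q < ?NB"
        proof -
          have "q < (h + 1) * d" using k unfolding q_def by simp
          also have "\<dots> \<le> Q * d" using 4(1) by (intro mult_right_mono) auto
          finally show ?thesis by (simp add: mult.commute)
        qed
        have qd: "q mod d = k" "q div d = h" using k unfolding q_def by auto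
        have Sb: "?S i q = b" unfolding dstring_def b_def qd ..
        have cons: "consistent (X i k (Suc h)) ?NB ((nats r 28)(i * ?NB + q := of_bool b)) ?S"
        proof (rule consistent_mono)
          show "consistent (\<lambda>p t. X i k h p t \<or> (p = i \<and> t = q)) ?NB ((nats r 28)(i * ?NB + q := of_bool b)) ?S"
            unfolding Sb[symmetric] by (rule consistent_block) (use 4(2) q in auto)
          fix p t assume "X i k (Suc h) p t"
          moreover have "t = q" if "t mod d = k" "t div d = h"
            unfolding q_def using that div_mult_mod_eq[of t d] by simp
          ultimately show "X i k h p t \<or> (p = i \<and> t = q)" by (auto simp: less_Suc_eq X_def)
        qed
        have g: "good_num M (min (Suc h) H) (y i k) \<longleftrightarrow> good_num M (min h H) (y i k) \<and>
            (h < H \<longrightarrow> 1 \<le> real M * f \<and> real M * f \<le> real M - 1)"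
          by (cases "h < H") (auto simp: min_def good_num_Suc f_def)
        have q': "i * ?NB + q + d = i * ?NB + (Suc h * d + k)" unfolding q_def by simp
        show ?case
          using 4(2,3) r ff db cons g q' unfolding f_def[symmetric] q_def[symmetric]
          by (cases b) (simp_all add: wp_simps set_cell_def not_le)
      next
        case (5 r m)
        have c: "consistent (X i (Suc k) 0) ?NB (nats r 28) ?S"
        proof -
          have "consistent (X i k Q) ?NB (nats r 28) ?S" using 5(1) by (elim conjE) assumption
          then show ?thesis
            unfolding consistent_def X_def by (auto simp: less_Suc_eq less_mult_imp_div_less mult.commute)
        qed
        show ?case
          using 5(1,2,4) c HQ by (auto simp: wp_simps set_cell_def less_Suc_eq min_absorb2)
      qed auto
    next
      case (5 t l)
      have t: "nats t 23 0 = ?NB" "nats t 24 0 = i * ?NB"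
        using s' \<open>nats s' 5 0 = i * d \<and> _\<close> by (simp_all add: same_nats[OF 5(3)] set_cell_def)
      have c: "consistent (X (Suc i) 0 0) ?NB (nats t 28) ?S"
      proof (cases "d = 0")
        case False
        have "consistent (X i d 0) ?NB (nats t 28) ?S" using 5(1) by (elim conjE) assumption
        then show ?thesis
          using False unfolding consistent_def X_def by (auto simp: less_Suc_eq)
      qed (simp add: consistent_def)
      show ?case
        using 5(1,2,4) c t by (auto simp: wp_simps set_cell_def less_Suc_eq algebra_simps)
    qed (auto simp: set_cell_def)
  next
    case (5 s' k')
    have c: "consistent (X n 0 0) ?NB (nats s' 28) ?S" using 5(1) by (elim conjE) assumption
    have "nats s' 28 (i * ?NB + t) = of_bool (?S i t)" if "i < n" "t < ?NB" for i t
      using consistentD[OF c that(2)] that(1) unfolding X_def by simp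
    then show ?case using 5(1,4) by (simp add: algebra_simps)
  qed (auto simp: set_cell_def)
qed

section \<open>Partition refinement\<close>

definition refine_point :: com where
  "refine_point = (NSet 34 (NCell 29 (V 6)) ;;
     Cond (BAnd (NLe (V 34) (V 6)) (NLe (V 6) (V 34))) (NAssign 31 (V 6) (NConst 0))
       (Cond (BAnd (NLe (NCell 28 (NAdd (NCell 25 (V 6)) (V 40))) (NCell 28 (NAdd (NCell 25 (V 34)) (V 40))))
             (NLe (NCell 28 (NAdd (NCell 25 (V 34)) (V 40))) (NCell 28 (NAdd (NCell 25 (V 6)) (V 40))))) Skip
         (Cond (NLe (NCell 31 (V 34)) (NConst 0))
           (NAssign 31 (V 34) (V 6) ;; NAssign 29 (V 6) (V 6) ;; NAssign 32 (V 6) (V 34) ;;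
            NAssign 33 (V 6) (V 40) ;; Inc 30)
           (NAssign 29 (V 6) (NCell 31 (V 34))))))"

text \<open>A level costs time linear in the number of points: a point compares its bit with that of
  the string naming its class and looks up array 31 there. That entry is reset when the naming
  string itself is visited, which happens before any other member of the class is, as the name is
  the least member.\<close>

definition refine :: com where
  "refine = (For 6 (V 2) (NAssign 29 (V 6) (NConst 0)) ;; NSet 30 (NConst 1) ;; NSet 33 (NConst 0) ;;
     For 40 (V 12) (For 6 (V 2) refine_point))"

lemma mods_refine_point [simp]:
  "nmods refine_point = {34, 31, 29, 32, 33, 30}" "rmods refine_point = {}" "\<not> emits refine_point"
  unfolding refine_point_def by auto

lemma mods_refine [simp]:
  "nmods refine = {6, 40, 34, 31, 29, 32, 33, 30}" "rmods refine = {}" "\<not> emits refine"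
  unfolding refine_def by auto

text \<open>\<open>first_odd\<close> is the first string before \<open>i\<close> that shares \<open>t\<close> bits with the string \<open>p\<close> (the least one with
  these \<open>t\<close> bits) but not bit \<open>t\<close>; the value 0 encodes that there is none.\<close>

definition odd_at :: "(nat \<Rightarrow> nat \<Rightarrow> bool) \<Rightarrow> nat \<Rightarrow> nat \<Rightarrow> nat \<Rightarrow> bool" where
  "odd_at S t p q \<longleftrightarrow> lab S t q = p \<and> S q t \<noteq> S p t"

definition first_odd :: "(nat \<Rightarrow> nat \<Rightarrow> bool) \<Rightarrow> nat \<Rightarrow> nat \<Rightarrow> nat \<Rightarrow> nat" where
  "first_odd S t i p = (if \<exists>q<i. odd_at S t p q then (LEAST q. odd_at S t p q) else 0)"

lemma lab_Suc_odd: "odd_at S t p i \<Longrightarrow> lab S (Suc t) i = (LEAST q. odd_at S t p q)"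
  by (simp add: lab_Suc odd_at_def)

lemma first_odd_skip: "\<not> odd_at S t p i \<Longrightarrow> first_odd S t (Suc i) p = first_odd S t i p"
  unfolding first_odd_def by (auto simp: less_Suc_eq)

lemma first_odd_self:
  assumes "lab S t i = i"
  shows "first_odd S t (Suc i) i = 0"
proof -
  have "\<not> odd_at S t i q" if "q < Suc i" for q
    using that lab_le_self[of S t q] by (cases "q = i") (auto simp: odd_at_def)
  then show ?thesis unfolding first_odd_def by auto
qed

lemma first_odd_pos:
  assumes "first_odd S t i p \<noteq> 0"
  shows "first_odd S t i p = (LEAST q. odd_at S t p q)" "\<exists>q<i. odd_at S t p q"
  using assms unfolding first_odd_def by (auto split: if_splits)

text \<open>The code 0 is unambiguous: string 0 names its own class and is therefore never split
  off.\<close>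

lemma first_odd_0:
  assumes "first_odd S t i p = 0" "odd_at S t p i"
  shows "(LEAST q. odd_at S t p q) = i" "first_odd S t (Suc i) p = i"
proof -
  have no: "\<not> odd_at S t p q" if "q < i" for q
  proof
    assume q: "odd_at S t p q"
    then have "(LEAST q. odd_at S t p q) = 0"
      using assms(1) that unfolding first_odd_def by (metis (no_types))
    moreover have "odd_at S t p (LEAST q. odd_at S t p q)"
      using q by (rule LeastI)
    ultimately have "odd_at S t p 0" by simp
    then show False using lab_le_self[of S t 0] unfolding odd_at_def by (metis le_zero_eq)
  qed
  show l: "(LEAST q. odd_at S t p q) = i"
    using assms(2) no by (intro Least_equality) (auto simp: not_less[symmetric])
  show "first_odd S t (Suc i) p = i"
    unfolding first_odd_def l using assms(2) by auto
qed

text \<open>The state in the middle of level \<open>t\<close>: strings below \<open>i\<close> carry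
  their new names, the others their old ones. Counting names makes it possible to detect separation
  without comparing points.\<close>

definition refined :: "(nat \<Rightarrow> nat \<Rightarrow> bool) \<Rightarrow> nat \<Rightarrow> nat \<Rightarrow> nat \<Rightarrow> (nat \<Rightarrow> nat) \<Rightarrow> (nat \<Rightarrow> nat) \<Rightarrow> (nat \<Rightarrow> nat) \<Rightarrow> nat \<Rightarrow> bool" where
  "refined S t i n l par m c \<longleftrightarrow> (\<forall>p<n. l p = (if p < i then lab S (Suc t) p else lab S t p)) \<and>
     c = card {p. p < n \<and> l p = p} \<and> m 0 = 0 \<and>
     (\<forall>p. 0 < p \<and> p < n \<and> l p = p \<longrightarrow> m p \<le> t \<and> lab S (m p) p \<noteq> p \<and> lab S (Suc (m p)) p = p \<and> par p = lab S (m p) p)"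

text \<open>One claim for each branch of \<open>refine_point\<close>. In the last one,
  \<open>i\<close> is the first member to leave the class of \<open>p\<close>, so it becomes a name
  with branching position \<open>t\<close> and pointer \<open>p\<close>. The entry \<open>a\<close>
  is meaningful only for \<open>p < i\<close>; for \<open>p = i\<close> it has not been reset
  yet.\<close>

lemma refined_step:
  assumes r: "refined S t i n l par m c" and i: "i < n" and o: "p = l i" and alt: "lab S t p = p \<Longrightarrow> p < i \<Longrightarrow> a = first_odd S t i p"
  shows "p = i \<Longrightarrow> refined S t (Suc i) n l par m c"
    "p \<noteq> i \<Longrightarrow> S i t = S p t \<Longrightarrow> refined S t (Suc i) n l par m c"
    "p \<noteq> i \<Longrightarrow> S i t \<noteq> S p t \<Longrightarrow> a \<noteq> 0 \<Longrightarrow> refined S t (Suc i) n (l(i := a)) par m c"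
    "p \<noteq> i \<Longrightarrow> S i t \<noteq> S p t \<Longrightarrow> a = 0 \<Longrightarrow>
      refined S t (Suc i) n (l(i := i)) (par(i := p)) (m(i := t)) (Suc c)"
proof -
  have pl: "p = lab S t i" using r i o unfolding refined_def by simp
  have p: "lab S t p = p" unfolding pl by (rule lab_lab)
  have li: "\<And>q. q < n \<Longrightarrow> l q = (if q < i then lab S (Suc t) q else lab S t q)"
    using r unfolding refined_def by blast
  have id: "refined S t (Suc i) n l par m c" if "lab S (Suc t) i = p"
    using r that o li[OF i] unfolding refined_def by (auto simp: less_Suc_eq)
  show "refined S t (Suc i) n l par m c" if "p = i"
    by (rule id) (use that pl lab_fix_mono[of S t i "Suc t"] in auto)
  show "refined S t (Suc i) n l par m c" if "p \<noteq> i" "S i t = S p t"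
    by (rule id) (use that in \<open>simp add: lab_Suc pl[symmetric]\<close>)
  show "refined S t (Suc i) n (l(i := a)) par m c" if ne: "p \<noteq> i" "S i t \<noteq> S p t" "a \<noteq> 0"
  proof -
    have pi: "p < i" using ne(1) lab_le_self[of S t i] pl by simp
    have a: "a = (LEAST q. odd_at S t p q)" "\<exists>q<i. odd_at S t p q"
      using first_odd_pos[of S t i p] ne(3) alt[OF p pi] by auto
    have la: "lab S (Suc t) i = a"
      unfolding a(1) by (rule lab_Suc_odd) (use ne(2) pl in \<open>simp add: odd_at_def\<close>)
    have "a < i" using a(2) Least_le[of "odd_at S t p"] unfolding a(1) by (meson le_less_trans)
    then have "{q. q < n \<and> (l(i := a)) q = q} = {q. q < n \<and> l q = q}"
      using ne(1) o by auto
    then show ?thesis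
      using r la \<open>a < i\<close> unfolding refined_def by (auto simp: less_Suc_eq)
  qed
  show "refined S t (Suc i) n (l(i := i)) (par(i := p)) (m(i := t)) (Suc c)" if ne: "p \<noteq> i" "S i t \<noteq> S p t" "a = 0"
  proof -
    have pi: "p < i" using ne(1) lab_le_self[of S t i] pl by simp
    have "first_odd S t i p = 0" using alt[OF p pi] ne(3) by simp
    then have "lab S (Suc t) i = i"
      using first_odd_0(1)[of S t i p] lab_Suc_odd[of S t p i] pl ne(2) by (simp add: odd_at_def)
    moreover have "{q. q < n \<and> (l(i := i)) q = q} = insert i {q. q < n \<and> l q = q}"
      using i by auto
    moreover have "i \<notin> {q. q < n \<and> l q = q}" using o ne(1) by auto
    ultimately show ?thesis
      using r pl ne(1) pi unfolding refined_def by (auto simp: less_Suc_eq)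
  qed
qed

lemma wp_refine:
  assumes st: "nats s 2 0 = n" "nats s 12 0 = D" and n: "0 < n"
    and S: "\<forall>i<n. nats s 25 i = i * NB \<and> (\<forall>t<NB. nats s 28 (i * NB + t) = of_bool (S i t))" and D: "D \<le> NB"
  shows "wp refine (\<lambda>s' k'. (n \<le> nats s' 30 0 \<longleftrightarrow> (\<forall>i<n. lab S D i = i)) \<and>
     (n \<le> nats s' 30 0 \<longrightarrow> splits S n D (nats s' 32) (nats s' 33)) \<and>
     k' \<le> k + 3 * n + 8 + D * (12 * n + 4)) s k"
  unfolding refine_def wp_simps
proof (rule wp_For[where N = n and tb = 1 and I = "\<lambda>i s'. \<forall>p<i. nats s' 29 p = 0"], goal_cases)
  case (2 s')
  then show ?case using st by (simp add: same_nats)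
next
  case (4 i s' k')
  then show ?case by (simp add: wp_simps set_cell_def less_Suc_eq)
next
  case (5 s1 k1)
  have s1: "nats s1 2 0 = n" "nats s1 12 0 = D" "nats s1 25 = nats s 25" "nats s1 28 = nats s 28"
    using st by (simp_all add: same_nats[OF 5(3)])
  let ?R = "\<lambda>t i s. refined S t i n (nats s 29) (nats s 32) (nats s 33) (nats s 30 0)"
  show ?case
    unfolding wp_simps
  proof (rule wp_For[where N = D and tb = "12 * n + 2" and I = "\<lambda>t s'.
       (\<forall>p<n. nats s' 29 p = lab S t p) \<and> nats s' 30 0 = card {p. p < n \<and> lab S t p = p} \<and> nats s' 33 0 = 0 \<and>
       (\<forall>p. 0 < p \<and> p < n \<and> lab S t p = p \<longrightarrow> nats s' 33 p < t \<and> lab S (nats s' 33 p) p \<noteq> p \<and>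
         lab S (Suc (nats s' 33 p)) p = p \<and> nats s' 32 p = lab S (nats s' 33 p) p)"], goal_cases)
    case 1
    have "{p. p < n \<and> lab S 0 p = p} = {0}" using n by (auto simp: lab_0)
    then show ?case using 5(1) by (auto simp: set_cell_def lab_0)
  next
    case (2 s')
    then show ?case using s1 by (simp add: same_nats set_cell_def)
  next
    case (4 t s2 k2)
    have s2: "nats s2 2 0 = n" "nats s2 25 = nats s 25" "nats s2 28 = nats s 28"
      using s1 by (simp_all add: same_nats[OF 4(4)] set_cell_def)
    have R0: "?R t 0 s2"
    proof -
      have "{p. p < n \<and> nats s2 29 p = p} = {p. p < n \<and> lab S t p = p}" using 4(2) by auto
      moreover have "nats s2 33 p \<le> t \<and> lab S (nats s2 33 p) p \<noteq> p \<and> lab S (Suc (nats s2 33 p)) p = p \<and>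
          nats s2 32 p = lab S (nats s2 33 p) p" if p: "0 < p \<and> p < n \<and> nats s2 29 p = p" for p
      proof -
        have "lab S t p = p" using 4(2) p by metis
        then show ?thesis using 4(2) p less_imp_le by blast
      qed
      ultimately show ?thesis using 4(2) unfolding refined_def by simp
    qed
    show ?case
    proof (rule wp_For[where N = n and tb = 10 and I = "\<lambda>i s'. ?R t i s' \<and>
        (\<forall>p<i. lab S t p = p \<longrightarrow> nats s' 31 p = first_odd S t i p)"], goal_cases)
      case 1
      then show ?case using R0 by (simp add: set_cell_def)
    next
      case (2 s')
      then show ?case using s2 by (simp add: same_nats set_cell_def)
    next
      case (4 i s' k')
      have s': "nats s' 25 = nats s 25" "nats s' 28 = nats s 28" "nats s' 40 0 = t"
        using s2 \<open>nats s2 40 0 = t\<close> by (simp_all add: same_nats[OF 4(4)])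
      define p where "p = nats s' 29 i"
      define a where "a = nats s' 31 p"
      have R: "?R t i s'" and A: "\<And>q. q < i \<Longrightarrow> lab S t q = q \<Longrightarrow> nats s' 31 q = first_odd S t i q"
        using 4(2) by auto
      have pl: "p = lab S t i" using R 4(1) unfolding refined_def p_def by simp
      then have pi: "p \<le> i" "lab S t p = p" using lab_le_self lab_lab by auto
      have tNB: "t < NB" using \<open>t < D\<close> D by simp
      have bits: "nats s 28 (nats s 25 i + t) = of_bool (S i t)" "nats s 28 (nats s 25 p + t) = of_bool (S p t)"
        using S 4(1) pi(1) tNB by auto
      note step = refined_step[OF R 4(1) p_def, of a]
      have al: "a = first_odd S t i p" if "lab S t p = p" "p < i" unfolding a_def using A that by blast
      note st = step[OF al]
      show ?case
      proof (cases "p = i")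
        case True
        have "first_odd S t (Suc i) q = nats s' 31 q" if "q < i" "lab S t q = q" for q
          using A[OF that] first_odd_skip[of S t q i] pl True that by (simp add: odd_at_def)
        moreover have "first_odd S t (Suc i) i = 0" using first_odd_self pl True by metis
        ultimately show ?thesis
          using st(1) True 4(3) p_def
          by (simp add: refine_point_def wp_simps set_cell_def less_Suc_eq)
      next
        case ne: False
        then have lt: "p < i" "p \<le> i" "\<not> i \<le> p" using pi by auto
        have li: "lab S t i \<noteq> i" using ne pl by simp
        show ?thesis
        proof (cases "S i t = S p t")
          case True
          have "first_odd S t (Suc i) q = nats s' 31 q" if "q < i" "lab S t q = q" for q
            using A[OF that] first_odd_skip[of S t q i] pl True by (auto simp: odd_at_def)
          then show ?thesis
            using st(2) ne True 4(3) p_def s' bits lt li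
            by (auto simp: refine_point_def wp_simps set_cell_def less_Suc_eq)
        next
          case False
          have nb: "nats s 28 (nats s 25 i + t) < nats s 28 (nats s 25 p + t) \<or>
              nats s 28 (nats s 25 p + t) < nats s 28 (nats s 25 i + t)"
            unfolding bits using False by auto
          have oth: "first_odd S t (Suc i) q = nats s' 31 q" if "q < i" "lab S t q = q" "q \<noteq> p" for q
            using A[OF that(1,2)] first_odd_skip[of S t q i] pl that(3) by (auto simp: odd_at_def)
          show ?thesis
          proof (cases "a = 0")
            case True
            have "first_odd S t i p = 0" using al lt pi True by simp
            then have fp: "first_odd S t (Suc i) p = i" using first_odd_0(2) pl False by (simp add: odd_at_def)
            have R': "refined S t (Suc i) n ((nats s' 29)(i := i)) ((nats s' 32)(i := p)) ((nats s' 33)(i := t))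
                (Suc (nats s' 30 0))" using st(4) ne False True by blast
            show ?thesis
              using R' fp oth 4(3) p_def[symmetric] a_def[symmetric] True s' lt li
              by (rule_tac disjE[OF nb]) (simp_all add: refine_point_def wp_simps set_cell_def less_Suc_eq)
          next
            case a0: False
            have fp: "first_odd S t (Suc i) p = a"
              using first_odd_pos[of S t i p] al lt pi a0 unfolding first_odd_def by (metis less_SucI)
            have R': "refined S t (Suc i) n ((nats s' 29)(i := a)) (nats s' 32) (nats s' 33) (nats s' 30 0)"
              using st(3) ne False a0 by blast
            have "first_odd S t (Suc i) q = nats s' 31 q" if "q < i" "lab S t q = q" for q
              using oth[OF that] fp a_def by (cases "q = p") auto
            then show ?thesis
              using R' 4(3) p_def[symmetric] a_def[symmetric] a0 s' lt li
              by (rule_tac disjE[OF nb]) (simp_all add: refine_point_def wp_simps set_cell_def less_Suc_eq)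
          qed
        qed
      qed
    next
      case (5 s' k')
      have "{p. p < n \<and> nats s' 29 p = p} = {p. p < n \<and> lab S (Suc t) p = p}"
        using 5(1) unfolding refined_def by auto
      then show ?case using 5(1,4) unfolding refined_def by (auto simp: set_cell_def less_Suc_eq_le)
    qed auto
  next
    case (5 s' k')
    \<comment> \<open>All names lie among the first \<open>n\<close> indices, so \<open>n\<close>
      names can only be all of them.\<close>
    have c: "n \<le> nats s' 30 0 \<longleftrightarrow> (\<forall>i<n. lab S D i = i)"
    proof -
      have "n \<le> card {p. p < n \<and> lab S D p = p} \<longleftrightarrow> {p. p < n \<and> lab S D p = p} = {..<n}"
      proof
        assume "n \<le> card {p. p < n \<and> lab S D p = p}"
        then show "{p. p < n \<and> lab S D p = p} = {..<n}" by (intro card_seteq) auto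
      qed auto
      then show ?thesis using 5(1) by auto
    qed
    have "k1 \<le> k + 3 * n + 2" using \<open>k1 \<le> k + n * (1 + 2) + 2\<close> by simp
    moreover have "k' \<le> k1 + D * (12 * n + 4) + 4" using 5(4) by (simp add: algebra_simps)
    ultimately have "k' \<le> k + 3 * n + 8 + D * (12 * n + 4)" by linarith
    moreover have "splits S n D (nats s' 32) (nats s' 33)" if "n \<le> nats s' 30 0"
      using 5(1) that unfolding c splits_def by blast
    ultimately show ?case using c by auto
  qed auto
qed auto

section \<open>Writing a round and keeping the remaining points\<close>

definition emit_binary :: com where
  "emit_binary = For 8 (V 35) (Cond (NLe (NCell 36 (NSub (V 35) (NAdd (V 8) (NConst 1)))) (V 37))
     (Emit True_b ;; NSet 37 (NSub (V 37) (NCell 36 (NSub (V 35) (NAdd (V 8) (NConst 1)))))) (Emit False_b))"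

lemma mods_emit_binary [simp]: "nmods emit_binary = {8, 37}" "rmods emit_binary = {}" "emits emit_binary"
  unfolding emit_binary_def by auto

text \<open>Comparison with a table of powers of 2 and subtraction replace division: after
  \<open>r\<close> bits from the top, the value modulo \<open>2 ^ (w - r)\<close> is still to be
  written.\<close>

lemma binary_step:
  fixes v :: nat
  assumes "r < w"
  shows "2 ^ (w - Suc r) \<le> v mod 2 ^ (w - r) \<longleftrightarrow> odd (v div 2 ^ (w - Suc r))"
    "v mod 2 ^ (w - Suc r) = (if 2 ^ (w - Suc r) \<le> v mod 2 ^ (w - r) then v mod 2 ^ (w - r) - 2 ^ (w - Suc r)
       else v mod 2 ^ (w - r))"
proof -
  define p a b :: nat where "p = 2 ^ (w - Suc r)" and "a = v div p" and "b = v mod p"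
  have "w - r = Suc (w - Suc r)" using assms by simp
  then have m: "v mod 2 ^ (w - r) = p * (a mod 2) + b"
    unfolding p_def a_def b_def by (simp only: power_Suc2 mod_mult2_eq)
  have lt: "b < p" unfolding b_def p_def by simp
  consider "even a" "v mod 2 ^ (w - r) = b" | "odd a" "v mod 2 ^ (w - r) = p + b"
    unfolding m by (cases "even a") (auto simp: even_iff_mod_2_eq_zero odd_iff_mod_2_eq_one)
  then show "2 ^ (w - Suc r) \<le> v mod 2 ^ (w - r) \<longleftrightarrow> odd (v div 2 ^ (w - Suc r))"
    "v mod 2 ^ (w - Suc r) = (if 2 ^ (w - Suc r) \<le> v mod 2 ^ (w - r) then v mod 2 ^ (w - r) - 2 ^ (w - Suc r)
       else v mod 2 ^ (w - r))"
    unfolding p_def[symmetric] a_def[symmetric] b_def[symmetric] using lt by (cases; simp)+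
qed

lemma wp_emit_binary:
  assumes st: "nats s 35 0 = w" "nats s 37 0 = v" and P: "\<forall>r\<le>w. nats s 36 r = 2 ^ r" and v: "v < 2 ^ w"
  shows "wp emit_binary (\<lambda>s' k'. outbits s' = outbits s @ binary w v \<and> k' \<le> k + 5 * w + 2) s k"
  unfolding emit_binary_def
proof (rule wp_For[where N = w and tb = 3 and I = "\<lambda>r s'. nats s' 37 0 = v mod 2 ^ (w - r) \<and>
    outbits s' = outbits s @ map (\<lambda>r. odd (v div 2 ^ (w - Suc r))) [0..<r]"], goal_cases)
  case 1
  then show ?case using st v by (simp add: set_cell_def)
next
  case (2 s')
  then show ?case using st by (simp add: same_nats)
next
  case (4 r s' k')
  have s': "nats s' 35 0 = w" "nats s' 36 (w - Suc r) = 2 ^ (w - Suc r)"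
    using st P by (simp_all add: same_nats[OF 4(4)])
  show ?case
    using 4(2,3) s' binary_step[OF 4(1), of v]
    by (cases "2 ^ (w - Suc r) \<le> v mod 2 ^ (w - r)") (simp_all add: wp_simps set_cell_def)
next
  case (5 s' k')
  then show ?case by (simp add: binary_def)
qed auto

definition emit_block :: com where
  "emit_block = For 8 (V 22) (Emit (NLe (NConst 1) (NCell 28 (NAdd (V 27) (V 8)))))"

lemma mods_emit_block [simp]: "nmods emit_block = {8}" "rmods emit_block = {}" "emits emit_block"
  unfolding emit_block_def by auto

lemma wp_emit_block:
  assumes st: "nats s 22 0 = W" "nats s 27 0 = a * NB + q" and S: "\<forall>t<NB. nats s 28 (a * NB + t) = of_bool (S t)"
    and q: "q + W \<le> NB"
  shows "wp emit_block (\<lambda>s' k'. outbits s' = outbits s @ block S q W \<and> k' \<le> k + 3 * W + 2) s k"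
  unfolding emit_block_def
proof (rule wp_For[where N = W and tb = 1 and
    I = "\<lambda>r s'. outbits s' = outbits s @ map (\<lambda>r. S (q + r)) [0..<r]"], goal_cases)
  case (2 s')
  then show ?case using st by (simp add: same_nats)
next
  case (4 r s' k')
  have "nats s' 28 = nats s 28" "nats s' 27 = nats s 27" by (simp_all add: same_nats[OF 4(4)])
  moreover have "nats s 28 (a * NB + (q + r)) = of_bool (S (q + r))" using S q 4(1) by simp
  ultimately show ?case using 4(2,3) st by (simp add: wp_simps set_cell_def add.assoc)
next
  case (5 s' k')
  then show ?case by (simp add: block_def)
qed auto

text \<open>The width is the least \<open>w\<close> with \<open>n + d * H \<le> 2 ^ w\<close>, so
  that both indices and positions fit; its minimality enters the size bound. Array 26 marks the bad
  points, whereas the sketch marks the good ones.\<close>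

definition emit_round :: com where
  "emit_round = (NSet 35 (NConst 0) ;; NSet 36 (NConst 1) ;;
     While (BNot (NLe (NAdd (V 2) (V 12)) (NCell 36 (V 35))))
       (NAssign 36 (NAdd (V 35) (NConst 1)) (NAdd (NCell 36 (V 35)) (NCell 36 (V 35))) ;; Inc 35) ;;
     emit_unary 11 ;; emit_unary 21 ;; emit_unary 35 ;;
     For 6 (V 2) (Emit (NLe (NCell 26 (V 6)) (NConst 0))) ;;
     For 6 (NSub (V 2) (NConst 1)) (NSet 42 (NAdd (V 6) (NConst 1)) ;;
       NSet 37 (NCell 32 (V 42)) ;; emit_binary ;; NSet 37 (NCell 33 (V 42)) ;; emit_binary ;;
       NSet 27 (NAdd (NCell 25 (V 42)) (NCell 33 (V 42))) ;; emit_block ;;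
       NSet 27 (NAdd (NCell 25 (NCell 32 (V 42))) (NCell 33 (V 42))) ;; emit_block))"

lemma mods_emit_round [simp]:
  "nmods emit_round = {35, 36, 39, 6, 42, 37, 8, 27}" "rmods emit_round = {}" "emits emit_round"
  unfolding emit_round_def by auto

lemma wp_emit_round:
  assumes st: "nats s 2 0 = n" "nats s 12 0 = D" "nats s 11 0 = g" "nats s 21 0 = \<Lambda>" "nats s 22 0 = d * \<Lambda>"
    and S: "\<forall>i<n. nats s 25 i = i * NB \<and> nats s 26 i = of_bool (\<not> fl i) \<and>
      (\<forall>t<NB. nats s 28 (i * NB + t) = of_bool (S i t))"
    and NB: "NB = D + d * \<Lambda>" and n: "0 < n"
    and pm: "\<And>i. 0 < i \<Longrightarrow> i < n \<Longrightarrow> nats s 32 i < i \<and> nats s 33 i < D"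
  shows "wp emit_round (\<lambda>s' k'. \<exists>w. outbits s' = outbits s @ round_bits d n g \<Lambda> w fl S (nats s 32) (nats s 33) \<and>
     n + D \<le> 2 ^ w \<and> (0 < w \<longrightarrow> 2 ^ (w - 1) < n + D) \<and>
     k' \<le> k + 3 * g + 3 * \<Lambda> + 6 * w + n * (10 * w + 6 * (d * \<Lambda>) + 20) + 20) s k"
proof -
  let ?par = "nats s 32" and ?m = "nats s 33" and ?W = "d * \<Lambda>"
  show ?thesis
    unfolding emit_round_def wp_simps
  proof (rule wp_While[where B = "n + D" and tb = 2 and I = "\<lambda>i s'. nats s' 35 0 = i \<and> (\<forall>r\<le>i. nats s' 36 r = 2 ^ r) \<and>
      (0 < i \<longrightarrow> 2 ^ (i - 1) < n + D)"], goal_cases)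
    case 1
    then show ?case by (simp add: set_cell_def)
  next
    case (2 i s' k')
    have s': "nats s' 2 0 = n" "nats s' 12 0 = D" using st by (simp_all add: same_nats[OF 2(2)] set_cell_def)
    have c: "2 ^ i < n + D" using 2(1,3) s' by simp
    then have "i < n + D" using less_exp[of i] by (rule less_trans[rotated])
    then show ?case using 2(1) c by (simp add: wp_simps set_cell_def le_Suc_eq)
  next
    case (3 w s1 k1)
    have s1: "nats s1 2 0 = n" "nats s1 12 0 = D" "nats s1 11 0 = g" "nats s1 21 0 = \<Lambda>" "nats s1 22 0 = ?W"
      "nats s1 25 = nats s 25" "nats s1 26 = nats s 26" "nats s1 28 = nats s 28" "nats s1 32 = ?par" "nats s1 33 = ?m"
      "nats s1 35 0 = w" "\<forall>r\<le>w. nats s1 36 r = 2 ^ r" "outbits s1 = outbits s"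
      using st 3(1) by (simp_all add: same_nats[OF 3(2)] same_outbits[OF 3(2)] set_cell_def)
    have w: "n + D \<le> 2 ^ w" "0 < w \<longrightarrow> 2 ^ (w - 1) < n + D"
      using 3(1,3) s1 by simp_all
    show ?case
    proof (rule wp_use[OF wp_emit_unary[where g = g]], goal_cases)
      case (3 s2 k2)
      have s2: "nats s2 a = nats s1 a" if "a \<noteq> 39" for a using that by (simp add: same_nats[OF 3(2)])
      have o2: "outbits s2 = outbits s @ unary g" "k2 \<le> k1 + 3 * g + 3" using 3(1) s1 by simp_all
      show ?case
      proof (rule wp_use[OF wp_emit_unary[where g = \<Lambda>]], goal_cases)
        case (3 s3 k3)
        have s3: "nats s3 a = nats s1 a" if "a \<noteq> 39" for a using that s2 by (simp add: same_nats[OF 3(2)])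
        have o3: "outbits s3 = outbits s @ unary g @ unary \<Lambda>" "k3 \<le> k1 + 3 * g + 3 * \<Lambda> + 6" using 3(1) o2 by simp_all
        show ?case
        proof (rule wp_use[OF wp_emit_unary[where g = w]], goal_cases)
          case (3 s4 k4)
          have s4: "nats s4 a = nats s1 a" if "a \<noteq> 39" for a using that s3 by (simp add: same_nats[OF 3(2)])
          have o4: "outbits s4 = outbits s @ unary g @ unary \<Lambda> @ unary w"
            "k4 \<le> k1 + 3 * g + 3 * \<Lambda> + 3 * w + 9" using 3(1) o3 by simp_all
          show ?case
            unfolding wp_simps
          proof (rule wp_For[where N = n and tb = 1 and I = "\<lambda>i s'. outbits s' = outbits s4 @ map fl [0..<i]"], goal_cases)
            case (2 s')
            then show ?case using s4 s1 by (simp add: same_nats)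
          next
            case (4 i s' k')
            have "nats s' 26 i = of_bool (\<not> fl i)" using s4 s1 S 4(1) by (simp add: same_nats[OF 4(4)])
            then show ?case using 4(2,3) by (simp add: wp_simps)
          next
            case (5 s5 k5)
            have s5: "nats s5 a = nats s1 a" if "a \<noteq> 39" "a \<noteq> 6" for a using that s4 by (simp add: same_nats[OF 5(3)])
            have k5: "k5 \<le> k1 + 3 * g + 3 * \<Lambda> + 3 * w + 3 * n + 11" using 5(4) o4 by simp
            show ?case
            proof (rule wp_For[where N = "n - 1" and tb = "10 * w + 6 * ?W + 13" and I = "\<lambda>i s'. outbits s' = outbits s5 @
                concat (map (\<lambda>i. record_bits w ?W S ?par ?m (Suc i)) [0..<i])"], goal_cases)
              case (2 s')
              then show ?case using s5 s1 by (simp add: same_nats)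
            next
              case (4 i t l)
              let ?i = "Suc i"
              have i: "?i < n" using 4(1) by simp
              note pmi = pm[OF _ i, simplified]
              have t: "nats t a = nats s1 a" if "a \<notin> {39, 6, 42, 37, 8, 27}" for a
                using that s5 by (simp add: same_nats[OF 4(4)])
              have pw: "?par ?i < 2 ^ w" "?m ?i < 2 ^ w" using pmi w i by auto
              show ?case
                unfolding wp_simps
              proof (rule wp_use[OF wp_emit_binary[where w = w and v = "?par ?i"]], goal_cases)
                case (5 t1 l1)
                have t1: "nats t1 a = nats s1 a" if "a \<notin> {39, 6, 42, 37, 8, 27}" for a
                  using that t by (simp add: same_nats[OF 5(2)] set_cell_def)
                have u1: "nats t1 42 0 = ?i" "nats t1 6 0 = i" using 4(3) by (simp_all add: same_nats[OF 5(2)] set_cell_def)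
                show ?case
                  unfolding wp_simps
                proof (rule wp_use[OF wp_emit_binary[where w = w and v = "?m ?i"]], goal_cases)
                  case (5 t2 l2)
                  have t2: "nats t2 a = nats s1 a" if "a \<notin> {39, 6, 42, 37, 8, 27}" for a
                    using that t1 by (simp add: same_nats[OF 5(2)] set_cell_def)
                  have u2: "nats t2 42 0 = ?i" "nats t2 6 0 = i" using u1 by (simp_all add: same_nats[OF 5(2)] set_cell_def)
                  show ?case
                    unfolding wp_simps
                  proof (rule wp_use[OF wp_emit_block[where a = ?i and q = "?m ?i" and NB = NB and S = "S ?i" and W = ?W]], goal_cases)
                    case (5 t3 l3)
                    have t3: "nats t3 a = nats s1 a" if "a \<notin> {39, 6, 42, 37, 8, 27}" for a
                      using that t2 by (simp add: same_nats[OF 5(2)] set_cell_def)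
                    have u3: "nats t3 42 0 = ?i" "nats t3 6 0 = i" using u2 by (simp_all add: same_nats[OF 5(2)] set_cell_def)
                    show ?case
                      unfolding wp_simps
                    proof (rule wp_use[OF wp_emit_block[where a = "?par ?i" and q = "?m ?i" and NB = NB and
                          S = "S (?par ?i)" and W = ?W]], goal_cases)
                      case (5 t4 l4)
                      have "outbits t4 = outbits t @ record_bits w ?W S ?par ?m ?i"
                        using 5(1) \<open>outbits t3 = _ \<and> _\<close> \<open>outbits t2 = _ \<and> _\<close> \<open>outbits t1 = _ \<and> _\<close>
                        by (simp add: record_bits_def)
                      moreover have "l4 \<le> l + (10 * w + 6 * ?W + 13)"
                        using 5(1) \<open>outbits t3 = _ \<and> _\<close> \<open>outbits t2 = _ \<and> _\<close> \<open>outbits t1 = _ \<and> _\<close> by simp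
                      ultimately show ?case using 4(2) by simp
                    next
                      case 2
                      show ?case using t3 u3 s1 S pmi i by (simp add: set_cell_def)
                    qed (use t3 u3 s1 S pmi i NB in \<open>auto simp: set_cell_def\<close>)
                  next
                    case 2
                    show ?case using t2 u2 s1 S pmi i by (simp add: set_cell_def)
                  qed (use t2 u2 s1 S pmi i NB in \<open>auto simp: set_cell_def\<close>)
                qed (use t1 u1 s1 pw in \<open>auto simp: set_cell_def\<close>)
              qed (use t 4(3) s1 pw in \<open>auto simp: set_cell_def\<close>)
            next
              case (5 s6 k6)
              have "outbits s6 = outbits s @ round_bits d n g \<Lambda> w fl S ?par ?m"
                using 5(1) \<open>outbits s5 = _\<close> o4 unfolding round_bits_def by simp
              moreover have "k6 \<le> k + 3 * g + 3 * \<Lambda> + 6 * w + n * (10 * w + 6 * ?W + 20) + 20"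
              proof -
                have fifteen: "10 * w + 6 * ?W + 13 + 2 = 10 * w + 6 * ?W + 15" by simp
                have "(n - 1) * (10 * w + 6 * ?W + 15) \<le> n * (10 * w + 6 * ?W + 15)" by (intro mult_right_mono) auto
                then have "k6 \<le> k5 + n * (10 * w + 6 * ?W + 15) + 2"
                  using 5(4) unfolding fifteen by linarith
                moreover have "k1 \<le> k + 3 * w + 3" using \<open>k1 \<le> _\<close> by simp
                ultimately show ?thesis using k5 by (simp add: algebra_simps)
              qed
              ultimately show ?case using w by blast
            qed auto
          qed auto
        qed (use s3 s1 in auto)
      qed (use s2 s1 in auto)
    qed (use s1 in auto)
  qed
qed

text \<open>Compaction works in place because the write position never overtakes the read position,
  by \<open>rank fl i \<le> i\<close>.\<close>

definition compact_rows :: com where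
  "compact_rows = (NSet 5 (NConst 0) ;; NSet 38 (NConst 0) ;; NSet 27 (NConst 0) ;;
     For 6 (V 2) (Cond (NLe (NConst 1) (NCell 26 (V 6)))
       (For 7 (V 3) (RAssign 8 (V 27) (RCell 8 (V 5)) ;; Inc 27 ;; Inc 5) ;; Inc 38)
       (NSet 5 (NAdd (V 5) (V 3)))) ;;
     NSet 2 (V 38) ;; NSet 4 (V 27))"

lemma mods_compact_rows [simp]:
  "nmods compact_rows = {5, 38, 27, 6, 7, 2, 4}" "rmods compact_rows = {8}" "\<not> emits compact_rows"
  unfolding compact_rows_def by auto

lemma wp_compact_rows:
  assumes st: "nats s 2 0 = n" "nats s 3 0 = d" and fl: "\<forall>i<n. nats s 26 i = of_bool (\<not> fl i)"
  shows "wp compact_rows (\<lambda>s' k'. nats s' 2 0 = rank fl n \<and> nats s' 4 0 = rank fl n * d \<and>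
     (\<forall>i<n. \<forall>k<d. \<not> fl i \<longrightarrow> rows (reals s' 8) d (rank fl i) k = rows (reals s 8) d i k) \<and>
     k' \<le> k + n * (5 * d + 6) + 7) s k"
proof -
  let ?A = "reals s 8"
  define copied where "copied A i \<longleftrightarrow> (\<forall>i'<i. \<not> fl i' \<longrightarrow> (\<forall>k<d. A (rank fl i' * d + k) = ?A (i' * d + k)))"
    for A :: "nat \<Rightarrow> real" and i
  show ?thesis
    unfolding compact_rows_def wp_simps
  proof (rule wp_For[where N = n and tb = "5 * d + 4" and I = "\<lambda>i s'. nats s' 5 0 = i * d \<and>
      nats s' 38 0 = rank fl i \<and> nats s' 27 0 = rank fl i * d \<and> copied (reals s' 8) i \<and>
      (\<forall>q\<ge>i * d. reals s' 8 q = ?A q)"], goal_cases)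
    case 1
    then show ?case by (simp add: set_cell_def copied_def)
  next
    case (2 s')
    then show ?case using st by (simp add: same_nats set_cell_def)
  next
    case (4 i s' k')
    have s': "nats s' 3 0 = d" "nats s' 26 i = of_bool (\<not> fl i)"
      using st fl 4(1) by (simp_all add: same_nats[OF 4(4)] set_cell_def)
    show ?case
    proof (cases "fl i")
      case True
      then have "copied A (Suc i) = copied A i" for A unfolding copied_def by (auto simp: less_Suc_eq)
      then show ?thesis
        using True s' 4(2,3) by (simp add: wp_simps set_cell_def rank_Suc)
    next
      case False
      define r where "r = rank fl i * d"
      have rl: "r \<le> i * d" unfolding r_def using rank_le by simp
      have "wp (For 7 (V 3) (RAssign 8 (V 27) (RCell 8 (V 5)) ;; Inc 27 ;; Inc 5))
          (\<lambda>t l. nats t 5 0 = Suc i * d \<and> nats t 27 0 = r + d \<and> nats t 38 0 = rank fl i \<and> nats t 6 0 = i \<and>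
            copied (reals t 8) (Suc i) \<and> (\<forall>q\<ge>Suc i * d. reals t 8 q = ?A q) \<and> l \<le> k' + 1 + d * 5 + 2) s' (k' + 1)"
      proof (rule wp_For[where N = d and tb = 3 and I = "\<lambda>k t. nats t 5 0 = i * d + k \<and>
          nats t 27 0 = r + k \<and> (\<forall>q\<ge>i * d + k. reals t 8 q = ?A q) \<and> copied (reals t 8) i \<and>
          (\<forall>k'<k. reals t 8 (r + k') = ?A (i * d + k'))"], goal_cases)
        case 1
        then show ?case using 4(2) by (simp add: set_cell_def r_def)
      next
        case (2 t)
        then show ?case using s' by (simp add: same_nats)
      next
        case (4 k t l)
        have "copied ((reals t 8)(r + k := ?A (i * d + k))) i"
          unfolding copied_def
        proof (intro allI impI)
          fix i' k'' assume a: "i' < i" "\<not> fl i'" "k'' < d"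
          then have "rank fl i' < rank fl i" by (intro rank_less)
          then have "(rank fl i' + 1) * d \<le> r" unfolding r_def by (intro mult_right_mono) auto
          then have "rank fl i' * d + k'' < r + k" using a by simp
          then show "((reals t 8)(r + k := ?A (i * d + k))) (rank fl i' * d + k'') = ?A (i' * d + k'')"
            using 4(2) a unfolding copied_def by simp
        qed
        then show ?case
          using 4(2,3) rl by (auto simp: wp_simps set_cell_def less_Suc_eq)
      next
        case (5 t l)
        have "nats t 38 0 = rank fl i" "nats t 6 0 = i"
          using \<open>nats s' 5 0 = i * d \<and> _\<close> \<open>nats s' 6 0 = i\<close> by (simp_all add: same_nats[OF 5(3)])
        moreover have "copied (reals t 8) (Suc i)"
          using 5(1) unfolding copied_def r_def by (auto simp: less_Suc_eq)
        ultimately show ?case using 5(1,4) by (simp add: add.commute)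
      qed auto
      then have "wp (For 7 (V 3) (RAssign 8 (V 27) (RCell 8 (V 5)) ;; Inc 27 ;; Inc 5) ;; Inc 38)
          (\<lambda>t l. (nats t 5 0 = Suc i * d \<and> nats t 38 0 = rank fl (Suc i) \<and> nats t 27 0 = rank fl (Suc i) * d \<and>
            copied (reals t 8) (Suc i) \<and> (\<forall>q\<ge>Suc i * d. reals t 8 q = ?A q)) \<and> nats t 6 0 = i \<and>
            l \<le> k' + (5 * d + 4)) s' (k' + 1)"
        unfolding wp_simps by (rule wp_mono) (use False in \<open>simp add: set_cell_def rank_Suc r_def\<close>)
      then have "wp (Cond (NLe (NConst 1) (NCell 26 (V 6)))
         (For 7 (V 3) (RAssign 8 (V 27) (RCell 8 (V 5)) ;; Inc 27 ;; Inc 5) ;; Inc 38)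
         (NSet 5 (NAdd (V 5) (V 3))))
          (\<lambda>t l. (nats t 5 0 = Suc i * d \<and> nats t 38 0 = rank fl (Suc i) \<and> nats t 27 0 = rank fl (Suc i) * d \<and>
            copied (reals t 8) (Suc i) \<and> (\<forall>q\<ge>Suc i * d. reals t 8 q = ?A q)) \<and> nats t 6 0 = i \<and>
            l \<le> k' + (5 * d + 4)) s' k'"
        using False s' 4(3) unfolding wp_Cond by simp
      then show ?thesis by (rule wp_mono) (simp add: set_cell_def)
    qed
  next
    case (5 s' k')
    have "k' \<le> k + n * (5 * d + 6) + 5" using 5(4) by (simp add: algebra_simps)
    then show ?case using 5(1) unfolding copied_def rows_def wp_simps by (simp add: set_cell_def)
  qed auto
qed

section \<open>The main loop\<close>

definition attempt :: com where
  "attempt = (tables ;; count_bad ;; best_shift ;; precision ;; digits ;; refine)"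

text \<open>A completed round keeps the current number of levels, so each doubling is paid for only
  once in the whole run.\<close>

definition iteration :: com where
  "iteration = (attempt ;; Cond (NLe (V 2) (V 30)) (emit_round ;; compact_rows)
     (NSet 10 (NAdd (V 10) (V 10)) ;; NSet 12 (NAdd (V 12) (V 12)) ;; Inc 11))"

lemma mods_attempt [simp]:
  "nmods attempt = {13, 39, 14, 15, 16, 6, 17, 18, 8, 19, 20, 21, 22, 23, 41, 5, 24, 25, 26, 7, 27, 28, 40, 34, 31, 29, 32, 33, 30}"
  "rmods attempt = {9, 10, 11}" "\<not> emits attempt"
  unfolding attempt_def by auto

definition ready :: "nat \<Rightarrow> real \<Rightarrow> nat \<Rightarrow> nat \<Rightarrow> store \<Rightarrow> bool" where
  "ready d \<epsilon> n g s \<longleftrightarrow> nats s 2 0 = n \<and> nats s 3 0 = d \<and> nats s 4 0 = n * d \<and> nats s 10 0 = 2 ^ g \<and>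
     nats s 11 0 = g \<and> nats s 12 0 = d * 2 ^ g \<and> reals s 0 0 = \<epsilon>"

definition unit_rows :: "nat \<Rightarrow> nat \<Rightarrow> real \<Rightarrow> (nat \<Rightarrow> nat \<Rightarrow> real) \<Rightarrow> bool" where
  "unit_rows n d \<delta> U \<longleftrightarrow> (\<forall>i<n. \<forall>k<d. 0 \<le> U i k \<and> U i k < 1) \<and>
     (\<forall>i<n. \<forall>j<n. i \<noteq> j \<longrightarrow> \<delta> \<le> pdist d (U i) (U j))"

definition modulus :: "nat \<Rightarrow> nat \<Rightarrow> nat" where
  "modulus d g = 4 * d * 2 ^ g + 1"

text \<open>Only the minimality of \<Lambda> is kept, for the bounds; that \<Lambda> is large enough
  has already gone into \<open>accurate\<close>.\<close>

definition precise :: "nat \<Rightarrow> real \<Rightarrow> nat \<Rightarrow> nat \<Rightarrow> bool" where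
  "precise d \<epsilon> g \<Lambda> \<longleftrightarrow> 0 < \<Lambda> \<longrightarrow> 2 ^ (\<Lambda> - 1) * \<epsilon> < 4 * real (modulus d g) * real d"

lemma pdist_scale: "0 < c \<Longrightarrow> (\<And>k. k < d \<Longrightarrow> p' k - q' k = (p k - q k) / c) \<Longrightarrow> pdist d p' q' = pdist d p q / c"
proof -
  assume c: "0 < c" and e: "\<And>k. k < d \<Longrightarrow> p' k - q' k = (p k - q k) / c"
  have "(\<Sum>k<d. (p' k - q' k)\<^sup>2) = (\<Sum>k<d. (p k - q k)\<^sup>2) / c\<^sup>2"
    unfolding sum_divide_distrib by (rule sum.cong) (use e in \<open>auto simp: power_divide\<close>)
  then show ?thesis
    using c unfolding pdist_def L2_set_sqrt by (simp add: real_sqrt_divide)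
qed

lemma shifted_01:
  assumes "0 \<le> U (i * d + k)" "U (i * d + k) < (1::real)" "j < M"
  shows "0 \<le> shifted U d j M i k \<and> shifted U d j M i k < 1"
proof -
  have "real j + 1 \<le> real M" using assms(3) by linarith
  then show ?thesis using assms unfolding shifted_def by (simp add: divide_less_eq)
qed

lemma pdist_shifted: "0 < M \<Longrightarrow> pdist d (shifted U d j M i) (shifted U d j M i') = pdist d (rows U d i) (rows U d i') / real M"
  by (rule pdist_scale) (auto simp: shifted_def rows_def diff_divide_distrib[symmetric])

text \<open>Points in one cell of level \<open>H\<close> differ by at most its side in every
  coordinate. A failed attempt thus exhibits a pair whose distance is tiny, which limits the levels
  that are ever tried.\<close>

lemma not_separated_close:
  assumes d: "0 < d" and y: "\<And>k. k < d \<Longrightarrow> 0 \<le> y i k \<and> y i k < 1 \<and> 0 \<le> y j k \<and> y j k < 1"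
    and ag: "agree (dstring d y) (d * H) i j"
  shows "pdist d (y i) (y j) \<le> real d / 2 ^ H"
proof -
  have "\<bar>y i k - y j k\<bar> \<le> 1 / 2 ^ H" if k: "k < d" for k
  proof -
    have eq: "dig (y i k) h = dig (y j k) h" if h: "h < H" for h
    proof -
      have "h * d + k < (h + 1) * d" using k by simp
      also have "\<dots> \<le> H * d" using h by (intro mult_right_mono) auto
      finally have "dstring d y i (h * d + k) = dstring d y j (h * d + k)"
        using ag unfolding agree_def by (simp add: mult.commute)
      then show ?thesis using k unfolding dstring_def by simp
    qed
    have "y i k - y j k = (frac (2 ^ H * y i k) - frac (2 ^ H * y j k)) / 2 ^ H"
    proof -
      have "(\<Sum>h<H. of_bool (dig (y i k) h) / 2 ^ Suc h) = (\<Sum>h<H. of_bool (dig (y j k) h) / 2 ^ Suc h :: real)"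
        by (rule sum.cong) (auto simp: eq)
      moreover have "y i k = (\<Sum>h<H. of_bool (dig (y i k) h) / 2 ^ Suc h) + frac (2 ^ H * y i k) / 2 ^ H"
        "y j k = (\<Sum>h<H. of_bool (dig (y j k) h) / 2 ^ Suc h) + frac (2 ^ H * y j k) / 2 ^ H"
        using y[OF k] digit_expansion[of "y i k" H] digit_expansion[of "y j k" H] by blast+
      ultimately show ?thesis unfolding diff_divide_distrib by linarith
    qed
    moreover have "\<bar>frac (2 ^ H * y i k) - frac (2 ^ H * y j k)\<bar> \<le> 1"
      using frac_lt_1[of "2 ^ H * y i k"] frac_lt_1[of "2 ^ H * y j k"]
        frac_ge_0[of "2 ^ H * y i k"] frac_ge_0[of "2 ^ H * y j k"] by linarith
    ultimately show ?thesis by (simp add: divide_right_mono)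
  qed
  then have "pdist d (y i) (y j) \<le> sqrt (real d) * (1 / 2 ^ H)"
    unfolding pdist_def by (intro L2_set_le_const) auto
  also have "\<dots> \<le> real d * (1 / 2 ^ H)"
    by (rule mult_right_mono[OF sqrt_nat_le]) auto
  finally show ?thesis by simp
qed

text \<open>Success yields the contract \<open>accurate\<close>. Failure yields an inequality
  between the number of levels and the minimum distance \<delta>, from which the number of doublings
  is bounded later.\<close>

lemma wp_attempt:
  assumes rd: "ready d \<epsilon> n g s" and U: "unit_rows n d \<delta> (rows (reals s 8) d)" and d: "0 < d" and n: "0 < n" and e: "0 < \<epsilon>"
  shows "wp attempt (\<lambda>s' k'. \<exists>\<Lambda> fl S NB. nats s' 21 0 = \<Lambda> \<and> nats s' 22 0 = d * \<Lambda> \<and> NB = d * 2 ^ g + d * \<Lambda> \<and>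
     precise d \<epsilon> g \<Lambda> \<and>
     (\<forall>i<n. nats s' 25 i = i * NB \<and> nats s' 26 i = of_bool (\<not> fl i) \<and> (\<forall>t<NB. nats s' 28 (i * NB + t) = of_bool (S i t))) \<and>
     2 * rank fl n < n \<and>
     (if n \<le> nats s' 30 0 then splits S n (d * 2 ^ g) (nats s' 32) (nats s' 33) \<and>
        accurate \<epsilon> d n (rows (reals s 8) d) (2 ^ g) \<Lambda> fl S (nats s' 32) (nats s' 33)
      else 2 ^ 2 ^ g * \<delta> \<le> real d * real (modulus d g)) \<and>
     k' \<le> k + n * d * (170 * 2 ^ g + 16 * \<Lambda>)) s k"
proof -
  let ?H = "2 ^ g :: nat" and ?U = "reals s 8"
  define M where "M = modulus d g"
  have M: "M = 4 * d * ?H + 1" "1 < M" "0 < M" using d unfolding M_def modulus_def by auto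
  have s0: "nats s 2 0 = n" "nats s 3 0 = d" "nats s 4 0 = n * d" "nats s 10 0 = ?H" "nats s 12 0 = d * ?H" "reals s 0 0 = \<epsilon>"
    using rd unfolding ready_def by auto
  have u: "0 \<le> ?U p \<and> ?U p < 1" if "p < n * d" for p
  proof -
    have "p div d < n" "p mod d < d" using that d by (auto simp: less_mult_imp_div_less)
    then have "0 \<le> rows ?U d (p div d) (p mod d) \<and> rows ?U d (p div d) (p mod d) < 1"
      using U unfolding unit_rows_def by blast
    then show ?thesis unfolding rows_def by simp
  qed
  show ?thesis
    unfolding attempt_def wp_simps
  proof (rule wp_use[OF wp_tables[where d = d and H = ?H and M = M]], goal_cases)
    case (3 s1 k1)
    have s1: "nats s1 a = nats s a" if "a \<notin> {13, 39, 14, 15, 16}" for a using that by (simp add: same_nats[OF 3(2)])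
    have r1: "reals s1 = reals s" using same_reals[OF 3(2)] by (simp add: fun_eq_iff)
    have hf: "halving M (nats s1 15)" and m1: "nats s1 13 0 = M" and k1: "k1 \<le> k + 7 * M + 3" using 3 by auto
    show ?case
    proof (rule wp_use[OF wp_count_bad[where N = "n * d" and H = ?H and M = M]], goal_cases)
      case (8 s2 k2)
      have s2: "nats s2 a = nats s1 a" if "a \<notin> {6, 17, 18, 8, 19, 16}" for a using that by (simp add: same_nats[OF 8(2)])
      have r2: "reals s2 a = reals s a" if "a \<noteq> 9" for a using that r1 by (simp add: same_reals[OF 8(2)])
      have k2: "k2 \<le> k1 + n * d * (12 * ?H + 7) + 2" using 8 by auto
      have B: "nats s2 16 j = (\<Sum>p<n * d. bads M (nats s1 15) ?H (?U p) j)" if "j < M" for j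
        using 8 that r1 by simp
      show ?case
      proof (rule wp_use[OF wp_best_shift[where M = M]], goal_cases)
        case (3 s3 k3)
        define j where "j = nats s3 20 0"
        have j: "j < M" and k3: "k3 \<le> k2 + 4 * M + 3" using 3 unfolding j_def by auto
        have s3: "nats s3 a = nats s2 a" if "a \<notin> {20, 39}" for a using that by (simp add: same_nats[OF 3(2)])
        have r3: "reals s3 a = reals s a" if "a \<noteq> 9" for a using that r2 by (simp add: same_reals[OF 3(2)])
        define y where "y = shifted ?U d j M"
        have y01: "0 \<le> y i k \<and> y i k < 1" if ik: "i < n" "k < d" for i k
        proof -
          have "i * d + k < (i + 1) * d" using ik by simp
          also have "\<dots> \<le> n * d" using ik by (intro mult_right_mono) auto
          finally show ?thesis unfolding y_def using u j by (intro shifted_01) auto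
        qed
        define fl where "fl i \<longleftrightarrow> (\<forall>k<d. good_num M ?H (y i k))" for i
        have few: "2 * rank fl n < n"
          unfolding rank_def fl_def y_def shifted_def
        proof (rule few_bad_points[OF hf M(1) d _ n u j])
          fix j' assume j': "j' < M"
          then have "nats s2 16 j \<le> nats s2 16 j'" using 3(1) unfolding j_def by blast
          then show "(\<Sum>p<n * d. bads M (nats s1 15) ?H (?U p) j) \<le> (\<Sum>p<n * d. bads M (nats s1 15) ?H (?U p) j')"
            unfolding B[OF j] B[OF j'] .
        qed auto
        show ?case
        proof (rule wp_use[OF wp_precision[where M = M and d = d and H = ?H and \<epsilon> = \<epsilon>]], goal_cases)
          case (7 s4 k4)
          then obtain \<Lambda> where L: "nats s4 21 0 = \<Lambda>" "nats s4 22 0 = d * \<Lambda>" "nats s4 23 0 = d * (?H + \<Lambda>)"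
              "nats s4 41 0 = ?H + \<Lambda>" "4 * real M * real d \<le> 2 ^ \<Lambda> * \<epsilon>"
              "0 < \<Lambda> \<longrightarrow> 2 ^ (\<Lambda> - 1) * \<epsilon> < 4 * real M * real d" "k4 \<le> k3 + 6 * \<Lambda> + 8" by auto
          have s4: "nats s4 a = nats s3 a" if "a \<notin> {21, 22, 8, 23, 41}" for a using that by (simp add: same_nats[OF 7(2)])
          have r4: "reals s4 a = reals s a" if "a \<notin> {9, 10}" for a using that r3 by (simp add: same_reals[OF 7(2)])
          let ?Q = "?H + \<Lambda>"
          have j4: "nats s4 20 0 = j" using s4 unfolding j_def by simp
          show ?case
          proof (rule wp_use[OF wp_digits[where n = n and d = d and Q = ?Q and H = ?H and M = M and j = j and y = y]], goal_cases)
            case (12 s5 k5)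
            let ?S = "dstring d y"
            have s5: "nats s5 a = nats s4 a" if "a \<notin> {5, 24, 6, 25, 26, 7, 27, 8, 28}" for a using that by (simp add: same_nats[OF 12(2)])
            have k5: "k5 \<le> k4 + n * (d * (10 * ?Q + 7) + 7) + 4" using 12 by auto
            have dd: "\<forall>i<n. nats s5 25 i = i * (d * ?Q) \<and> nats s5 26 i = of_bool (\<not> fl i) \<and>
               (\<forall>t<d * ?Q. nats s5 28 (i * (d * ?Q) + t) = of_bool (?S i t))"
              using 12(1) unfolding fl_def by blast
            show ?case
            proof (rule wp_use[OF wp_refine[where n = n and D = "d * ?H" and NB = "d * ?Q" and S = ?S]], goal_cases)
              case (6 s6 k6)
              have s6: "nats s6 a = nats s5 a" if "a \<notin> {6, 40, 34, 31, 29, 32, 33, 30}" for a using that by (simp add: same_nats[OF 6(2)])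
              have k6: "k6 \<le> k5 + 3 * n + 8 + d * ?H * (12 * n + 4)" using 6 by auto
              have NB: "d * ?Q = d * ?H + d * \<Lambda>" by (simp add: algebra_simps)
              have acc: "accurate \<epsilon> d n (rows ?U d) ?H \<Lambda> fl ?S (nats s6 32) (nats s6 33)" if "n \<le> nats s6 30 0"
                unfolding accurate_def
              proof (intro allI impI)
                fix v i i' assume v: "\<forall>p t. v p t \<le> 1" "covers ?S n (d * \<Lambda>) (nats s6 32) (nats s6 33) v"
                  and ii: "i < n" "i' < n" "i \<noteq> i'" "fl i \<or> fl i'"
                have sp: "splits ?S n (d * ?H) (nats s6 32) (nats s6 33)" using 6(1) that by blast
                define E where "E = est d ?Q v (own (nats s6 32) (nats s6 33)) i i'"
                define D where "D = pdist d (rows ?U d i) (rows ?U d i')"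
                have pd: "pdist d (y i) (y i') = D / real M"
                  unfolding y_def D_def by (rule pdist_shifted) (use M in simp)
                have "\<bar>E - pdist d (y i) (y i')\<bar> \<le> \<epsilon> * pdist d (y i) (y i')"
                  unfolding E_def
                  by (rule est_accurate[where n = n and M = M and s = ?S])
                    (use d M e L(5) y01 sp v ii fl_def in \<open>auto simp: dstring_def\<close>)
                then have "real M * \<bar>E - D / real M\<bar> \<le> real M * (\<epsilon> * (D / real M))"
                  unfolding pd by (rule mult_left_mono) simp
                moreover have "real M * \<bar>E - D / real M\<bar> = \<bar>real M * E - D\<bar>"
                  using M(3) by (simp add: abs_mult[of "real M", symmetric, simplified] right_diff_distrib)
                ultimately show "\<bar>real (4 * d * ?H + 1) * est d ?Q v (own (nats s6 32) (nats s6 33)) i i' - pdist d (rows ?U d i) (rows ?U d i')\<bar>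
                    \<le> \<epsilon> * pdist d (rows ?U d i) (rows ?U d i')"
                  using M(3) unfolding E_def[symmetric] D_def[symmetric] M(1)[symmetric] by simp
              qed
              \<comment> \<open>Two strings with the same \<open>d * H\<close> bits come from
                shifted points at distance at least \<delta> / M and at most d / 2^H.\<close>
              have fail: "2 ^ 2 ^ g * \<delta> \<le> real d * real (modulus d g)" if "\<not> n \<le> nats s6 30 0"
              proof -
                have "\<not> (\<forall>i<n. lab ?S (d * ?H) i = i)" using conjunct1[OF 6(1)] that by simp
                then obtain i where i: "i < n" "lab ?S (d * ?H) i \<noteq> i" by blast
                define i' where "i' = lab ?S (d * ?H) i"
                have i': "i' < i" using lab_le_self[of ?S "d * ?H" i] i(2) unfolding i'_def by simp
                have "pdist d (y i') (y i) \<le> real d / 2 ^ ?H"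
                  by (rule not_separated_close[OF d]) (use y01 i i' agree_lab i'_def in auto)
                moreover have "pdist d (y i') (y i) = pdist d (rows ?U d i') (rows ?U d i) / real M"
                  unfolding y_def by (rule pdist_shifted) (use M in simp)
                moreover have "\<delta> \<le> pdist d (rows ?U d i') (rows ?U d i)"
                  using U i i' unfolding unit_rows_def by auto
                ultimately have "\<delta> / real M \<le> real d / 2 ^ ?H"
                  by (smt (verit) divide_right_mono of_nat_0_le_iff)
                then show ?thesis
                  using M(3) unfolding M_def[symmetric] by (simp add: field_simps)
              qed
              \<comment> \<open>All terms are absorbed into \<open>n * d * h\<close> and
                \<open>n * d * \<Lambda>\<close>. Their coefficients add up to 145 and 16, so 170
                leaves some slack.\<close>
              have time: "k6 \<le> k + n * d * (170 * ?H + 16 * \<Lambda>)"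
              proof -
                define h where "h = ?H"
                have h: "1 \<le> h" unfolding h_def by simp
                have nd: "1 \<le> n * d" "n \<le> n * d" "d \<le> n * d" using n d by auto
                have 1: "d * h \<le> n * d * h" "n * d \<le> n * d * h" using n h by auto
                have "k6 \<le> k + 11 * M + n * d * (12 * h + 7) + 6 * \<Lambda> + n * (d * (10 * (h + \<Lambda>) + 7) + 7) + 3 * n + d * h * (12 * n + 4) + 28"
                  using k1 k2 k3 L(7) k5 k6 unfolding h_def by linarith
                also have "\<dots> = k + 44 * (d * h) + 34 * (n * d * h) + 14 * (n * d) + 6 * \<Lambda> + 10 * (n * d * \<Lambda>) + 10 * n + 4 * (d * h) + 39"
                  unfolding M(1) h_def by (simp add: algebra_simps)
                also have "\<dots> \<le> k + 48 * (n * d * h) + 34 * (n * d * h) + 14 * (n * d * h) + 6 * (n * d * \<Lambda>) + 10 * (n * d * \<Lambda>) + 10 * (n * d * h) + 39 * (n * d * h)"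
                proof -
                  have "\<Lambda> \<le> n * d * \<Lambda>" using nd(1) by simp
                  moreover have "n \<le> n * d * h" "1 \<le> n * d * h" using 1(2) nd by linarith+
                  ultimately show ?thesis using 1 by linarith
                qed
                also have "\<dots> \<le> k + n * d * (170 * h + 16 * \<Lambda>)" by (simp add: algebra_simps)
                finally show ?thesis unfolding h_def .
              qed
              show ?case
                by (rule exI[of _ \<Lambda>], rule exI[of _ fl], rule exI[of _ ?S], rule exI[of _ "d * ?Q"])
                  (use L s5 s6 dd few acc fail time 6(1) NB in \<open>simp add: precise_def M_def\<close>)
            qed (use dd s5 s4 s3 s2 s1 s0 n in auto)
          qed (use L s4 r4 s3 s2 s1 s0 m1 j4 M y01 y_def in auto)
        qed (use s3 s2 s1 s0 r3 m1 e in auto)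
      qed (use s2 m1 M in auto)
    qed (use s1 s0 r1 3 M u in auto)
  qed (use s0 M in auto)
qed

lemma rows_unit_rank:
  assumes U: "unit_rows n d \<delta> U" and U': "\<forall>i<n. \<forall>k<d. \<not> fl i \<longrightarrow> U' (rank fl i) k = U i k"
  shows "unit_rows (rank fl n) d \<delta> U'"
  unfolding unit_rows_def
proof (intro conjI allI impI)
  fix r k assume "r < rank fl n" "k < d"
  then obtain i where "i < n" "\<not> fl i" "rank fl i = r" using rank_surj by blast
  then show "0 \<le> U' r k" "U' r k < 1" using U U' \<open>k < d\<close> unfolding unit_rows_def by force+
next
  fix r r' assume r: "r < rank fl n" "r' < rank fl n" "r \<noteq> r'"
  obtain i where i: "i < n" "\<not> fl i" "rank fl i = r" using rank_surj r by blast
  obtain i' where i': "i' < n" "\<not> fl i'" "rank fl i' = r'" using rank_surj r by blast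
  have "pdist d (U' r) (U' r') = pdist d (U i) (U i') / 1"
    by (rule pdist_scale) (use U' i i' in auto)
  moreover have "i \<noteq> i'" using r(3) i i' by auto
  ultimately show "\<delta> \<le> pdist d (U' r) (U' r')" using U i i' unfolding unit_rows_def by simp
qed

lemma wp_iteration:
  assumes rd: "ready d \<epsilon> n g s" and U: "unit_rows n d \<delta> (rows (reals s 8) d)" and d: "0 < d" and n: "0 < n" and e: "0 < \<epsilon>"
  shows "wp iteration (\<lambda>s' k'. \<exists>\<Lambda> w. precise d \<epsilon> g \<Lambda> \<and> (0 < w \<longrightarrow> 2 ^ (w - 1) < n + d * 2 ^ g) \<and>
     k' \<le> k + n * d * (240 * (2 ^ g + \<Lambda> + w)) \<and>
     (\<exists>n' bits. ready d \<epsilon> n' g s' \<and> unit_rows n' d \<delta> (rows (reals s' 8) d) \<and> 2 * n' < n \<and>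
        outbits s' = outbits s @ bits \<and> length bits \<le> n * (g + 3 * w + 3 * d * \<Lambda> + 4) \<and>
        (\<forall>rest. valid \<epsilon> d n' (rows (reals s' 8) d) rest \<longrightarrow> valid \<epsilon> d n (rows (reals s 8) d) (bits @ rest)) \<or>
      ready d \<epsilon> n (Suc g) s' \<and> outbits s' = outbits s \<and> reals s' 8 = reals s 8 \<and>
        2 ^ 2 ^ g * \<delta> \<le> real d * real (modulus d g))) s k"
  unfolding iteration_def wp_simps
proof (rule wp_use[OF wp_attempt[OF assms]], elim exE conjE, goal_cases)
  case (1 s1 k1 \<Lambda> fl S NB)
  let ?U = "rows (reals s 8) d"
  have s1: "nats s1 2 0 = n" "nats s1 3 0 = d" "nats s1 4 0 = n * d" "nats s1 10 0 = 2 ^ g" "nats s1 11 0 = g"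
    "nats s1 12 0 = d * 2 ^ g" "reals s1 0 0 = \<epsilon>" "reals s1 8 = reals s 8" "outbits s1 = outbits s"
    using rd unfolding ready_def by (simp_all add: same_nats[OF 1(1)] same_reals[OF 1(1)] same_outbits[OF 1(1)])
  show ?case
  proof (split if_split, intro conjI impI, goal_cases)
    case 1
    then have c: "n \<le> nats s1 30 0" using s1 by simp
    then have sp: "splits S n (d * 2 ^ g) (nats s1 32) (nats s1 33)"
      and acc: "accurate \<epsilon> d n ?U (2 ^ g) \<Lambda> fl S (nats s1 32) (nats s1 33)"
      using \<open>if n \<le> nats s1 30 0 then _ else _\<close> by auto
    have pm: "nats s1 32 i < i \<and> nats s1 33 i < d * 2 ^ g" if "0 < i" "i < n" for i
    proof -
      have "nats s1 33 i < d * 2 ^ g" "lab S (nats s1 33 i) i \<noteq> i" "nats s1 32 i = lab S (nats s1 33 i) i"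
        using sp that unfolding splits_def by auto
      then show ?thesis using lab_le_self[of S "nats s1 33 i" i] by simp
    qed
    show ?case
    proof (rule wp_use[OF wp_emit_round[where n = n and D = "d * 2 ^ g" and g = g and \<Lambda> = \<Lambda> and d = d and
          NB = NB and fl = fl and S = S]], goal_cases)
      case (10 s2 k2)
      then obtain w where w: "outbits s2 = outbits s1 @ round_bits d n g \<Lambda> w fl S (nats s1 32) (nats s1 33)"
        "n + d * 2 ^ g \<le> 2 ^ w" "0 < w \<longrightarrow> 2 ^ (w - 1) < n + d * 2 ^ g"
        "k2 \<le> k1 + 1 + 3 * g + 3 * \<Lambda> + 6 * w + n * (10 * w + 6 * (d * \<Lambda>) + 20) + 20" by blast
      have s2: "nats s2 a = nats s1 a" if "a \<notin> {35, 36, 39, 6, 42, 37, 8, 27}" for a using that by (simp add: same_nats[OF 10(2)])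
      have r2: "reals s2 = reals s1" using same_reals[OF 10(2)] by (simp add: fun_eq_iff)
      show ?case
      proof (rule wp_use[OF wp_compact_rows[where n = n and d = d and fl = fl]], goal_cases)
        case (4 s3 k3)
        let ?n' = "rank fl n" and ?bits = "round_bits d n g \<Lambda> w fl S (nats s1 32) (nats s1 33)"
        have s3: "nats s3 a = nats s2 a" if "a \<notin> {5, 38, 27, 6, 7, 2, 4}" for a using that by (simp add: same_nats[OF 4(2)])
        have r3: "reals s3 a = reals s2 a" if "a \<noteq> 8" for a using that by (simp add: same_reals[OF 4(2)])
        have o3: "outbits s3 = outbits s @ ?bits" using w(1) s1 by (simp add: same_outbits[OF 4(2)])
        have U': "\<forall>i<n. \<forall>k<d. \<not> fl i \<longrightarrow> rows (reals s3 8) d (rank fl i) k = ?U i k"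
          using 4(1) r2 s1 by simp
        have rd': "ready d \<epsilon> ?n' g s3"
          using 4(1) s3 s2 s1 r3 r2 unfolding ready_def by simp
        have un: "unit_rows ?n' d \<delta> (rows (reals s3 8) d)" using rows_unit_rank[OF U U'] .
        have len: "length ?bits \<le> n * (g + 3 * w + 3 * d * \<Lambda> + 4)"
        proof -
          have "length ?bits \<le> g + \<Lambda> + w + 3 + n + n * (2 * w + 2 * (d * \<Lambda>))"
            unfolding length_round by (intro add_mono mult_right_mono) auto
          also have "\<dots> \<le> n * g + n * (d * \<Lambda>) + n * w + n * 3 + n + n * (2 * w + 2 * (d * \<Lambda>))"
          proof -
            have "g \<le> n * g" "w \<le> n * w" "3 \<le> n * 3" using n by auto
            moreover have "\<Lambda> \<le> d * \<Lambda>" "d * \<Lambda> \<le> n * (d * \<Lambda>)" using n d by auto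
            ultimately show ?thesis by linarith
          qed
          finally show ?thesis by (simp add: algebra_simps)
        qed
        have val: "valid \<epsilon> d n ?U (?bits @ rest)" if "valid \<epsilon> d ?n' (rows (reals s3 8) d) rest" for rest
        proof (rule valid_round[OF _ _ acc _ that])
          show "nats s1 33 0 = 0" using sp unfolding splits_def by simp
          show "nats s1 32 i < i \<and> nats s1 33 i < d * 2 ^ g \<and> nats s1 32 i < 2 ^ w \<and> nats s1 33 i < 2 ^ w"
            if "0 < i" "i < n" for i using pm[OF that] w(2) that by auto
          show "rows (reals s3 8) d (rank fl i) k = ?U i k" if "i < n" "k < d" "\<not> fl i" for i k
            using U' that by blast
        qed
        have time: "k3 \<le> k + n * d * (240 * (2 ^ g + \<Lambda> + w))"
        proof -
          define h where "h = (2::nat) ^ g"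
          have h: "1 \<le> h" "g \<le> h" unfolding h_def using less_exp[of g] by (auto intro: less_imp_le)
          define N where "N = n * d"
          have N: "1 \<le> N" "n \<le> N" unfolding N_def using n d by auto
          have a: "h \<le> N * h" "N \<le> N * h" "w \<le> N * w" "\<Lambda> \<le> N * \<Lambda>" "n * w \<le> N * w" using N h by auto
          have "k1 \<le> k + N * (170 * h + 16 * \<Lambda>)" using \<open>k1 \<le> _\<close> unfolding h_def N_def .
          moreover have "k3 \<le> k2 + n * (5 * d + 6) + 7" using 4(1) by simp
          ultimately have "k3 \<le> k + N * (170 * h + 16 * \<Lambda>) + 3 * g + 3 * \<Lambda> + 6 * w + n * (10 * w + 6 * (d * \<Lambda>) + 20) + n * (5 * d + 6) + 28"
            using w(4) by linarith
          also have "\<dots> = k + 170 * (N * h) + 16 * (N * \<Lambda>) + 3 * g + 3 * \<Lambda> + 6 * w + 10 * (n * w) + 6 * (N * \<Lambda>) + 5 * N + 26 * n + 28"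
            unfolding N_def by (simp add: algebra_simps)
          also have "\<dots> \<le> k + 240 * (N * h) + 240 * (N * \<Lambda>) + 240 * (N * w)"
          proof -
            have "g \<le> N * h" "n \<le> N * h" "1 \<le> N * h" using a N h by linarith+
            with a show ?thesis by linarith
          qed
          finally show ?thesis unfolding h_def N_def by (simp add: algebra_simps)
        qed
        show ?case
          by (rule exI[of _ \<Lambda>], rule exI[of _ w], intro conjI disjI1 exI[of _ ?n'] exI[of _ ?bits])
            (use \<open>precise d \<epsilon> g \<Lambda>\<close> w(3) time rd' un \<open>2 * rank fl n < n\<close> o3 len val in auto)
      qed (use s1 s2 \<open>\<forall>i<n. nats s1 25 i = i * NB \<and> _ i\<close> in auto)
    qed (use s1 \<open>nats s1 21 0 = \<Lambda>\<close> \<open>nats s1 22 0 = d * \<Lambda>\<close> \<open>NB = _\<close> n pm \<open>\<forall>i<n. nats s1 25 i = i * NB \<and> _ i\<close> in auto)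
  next
    case 2
    then have c: "\<not> n \<le> nats s1 30 0" using s1 by simp
    then have f: "2 ^ 2 ^ g * \<delta> \<le> real d * real (modulus d g)"
      using \<open>if n \<le> nats s1 30 0 then _ else _\<close> by auto
    have "k1 + 4 \<le> k + n * d * (240 * (2 ^ g + \<Lambda> + 0))"
    proof -
      define X Y where "X = n * d * 2 ^ g" and "Y = n * d * \<Lambda>"
      have "1 \<le> X" unfolding X_def using n d by simp
      moreover have "k1 \<le> k + (170 * X + 16 * Y)"
        using \<open>k1 \<le> _\<close> unfolding X_def Y_def by (simp add: algebra_simps)
      moreover have "n * d * (240 * (2 ^ g + \<Lambda> + 0)) = 240 * X + 240 * Y"
        unfolding X_def Y_def by (simp add: algebra_simps)
      ultimately show ?thesis by linarith
    qed
    then show ?case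
      unfolding wp_simps
      by (intro exI[of _ \<Lambda>] exI[of _ "0::nat"] conjI disjI2)
        (use s1 f \<open>precise d \<epsilon> g \<Lambda>\<close> in \<open>simp_all add: set_cell_def ready_def\<close>)
  qed
qed

definition main_loop :: com where
  "main_loop = While (NLe (NConst 2) (V 2)) iteration"

definition separation_fails :: "nat \<Rightarrow> real \<Rightarrow> nat \<Rightarrow> bool" where
  "separation_fails d \<delta> g \<longleftrightarrow> 2 ^ 2 ^ g * \<delta> \<le> real d * real (modulus d g)"

text \<open>Two potentials are at work. A pass either at least halves \<open>n + 1\<close>, by
  \<open>2 * n' < n\<close>, or doubles \<open>2 ^ g\<close>; so
  \<open>2 ^ it * (n + 1) \<le> (n0 + 1) * 2 ^ g\<close> is invariant and the number of passes is
  logarithmic. The number of bits written plus \<open>2 * c * n\<close> never exceeds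
  \<open>2 * c * n0\<close>, which is the geometric series in amortized form.\<close>

lemma wp_main_loop:
  assumes rd: "ready d \<epsilon> n0 0 s" and U: "unit_rows n0 d \<delta> (rows (reals s 8) d)" and d: "0 < d" and e: "0 < \<epsilon>"
    and H: "\<And>g. g = 0 \<or> separation_fails d \<delta> (g - 1) \<Longrightarrow> 2 ^ g \<le> Hm \<and> g \<le> gm"
    and L: "\<And>g \<Lambda>. 2 ^ g \<le> Hm \<Longrightarrow> precise d \<epsilon> g \<Lambda> \<Longrightarrow> \<Lambda> \<le> Lm"
    and W: "\<And>w. (0 < w \<longrightarrow> 2 ^ (w - 1) < n0 + d * Hm) \<Longrightarrow> w \<le> wm"
  shows "wp main_loop (\<lambda>s' k'. \<exists>bits it. outbits s' = outbits s @ bits \<and> valid \<epsilon> d n0 (rows (reals s 8) d) bits \<and>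
     length bits \<le> 2 * (gm + 3 * wm + 3 * d * Lm + 4) * n0 \<and> 2 ^ it \<le> (n0 + 1) * Hm \<and>
     k' \<le> k + it * (n0 * d * (240 * (Hm + Lm + wm)) + 1) + 1) s k"
proof -
  define c where "c = gm + 3 * wm + 3 * d * Lm + 4"
  define tb where "tb = n0 * d * (240 * (Hm + Lm + wm))"
  let ?U = "rows (reals s 8) d"
  define I where "I it s' \<longleftrightarrow> (\<exists>n g bits. ready d \<epsilon> n g s' \<and> unit_rows n d \<delta> (rows (reals s' 8) d) \<and>
     (g = 0 \<or> separation_fails d \<delta> (g - 1)) \<and> n \<le> n0 \<and> 2 ^ it * (n + 1) \<le> (n0 + 1) * 2 ^ g \<and>
     outbits s' = outbits s @ bits \<and> length bits + 2 * c * n \<le> 2 * c * n0 \<and>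
     (\<forall>rest. valid \<epsilon> d n (rows (reals s' 8) d) rest \<longrightarrow> valid \<epsilon> d n0 ?U (bits @ rest)))" for it s'
  have bound: "2 ^ it \<le> (n0 + 1) * Hm" if I: "I it s'" for it s'
  proof -
    obtain n g where g: "g = 0 \<or> separation_fails d \<delta> (g - 1)" "2 ^ it * (n + 1) \<le> (n0 + 1) * 2 ^ g"
      using I unfolding I_def by blast
    have "2 ^ it * 1 \<le> 2 ^ it * (n + 1)" by (intro mult_left_mono) auto
    also have "\<dots> \<le> (n0 + 1) * 2 ^ g" by (rule g(2))
    also have "\<dots> \<le> (n0 + 1) * Hm" using H[OF g(1)] by (intro mult_left_mono) auto
    finally show ?thesis by simp
  qed
  show ?thesis
    unfolding main_loop_def
  proof (rule wp_While[where I = I and tb = tb and B = "(n0 + 1) * Hm"], goal_cases)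
    case 1
    show ?case
      unfolding I_def
      by (intro exI[of _ n0] exI[of _ "0::nat"] exI[of _ "[]::bool list"] conjI) (use rd U in auto)
  next
    case (2 it s' k')
    from 2(1) obtain n g bits where i: "ready d \<epsilon> n g s'" "unit_rows n d \<delta> (rows (reals s' 8) d)"
        "g = 0 \<or> separation_fails d \<delta> (g - 1)" "n \<le> n0" "2 ^ it * (n + 1) \<le> (n0 + 1) * 2 ^ g"
        "outbits s' = outbits s @ bits" "length bits + 2 * c * n \<le> 2 * c * n0"
        "\<And>rest. valid \<epsilon> d n (rows (reals s' 8) d) rest \<Longrightarrow> valid \<epsilon> d n0 ?U (bits @ rest)"
      unfolding I_def by blast
    have n2: "2 \<le> n" using 2(3) i(1) unfolding ready_def by simp
    have Hg: "2 ^ g \<le> Hm" "g \<le> gm" using H[OF i(3)] by auto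
    have "it < 2 ^ it" by (rule less_exp)
    then have B: "it < (n0 + 1) * Hm" using bound[OF 2(1)] by (rule less_le_trans)
    moreover have "wp iteration (\<lambda>s'' k''. I (Suc it) s'' \<and> k'' \<le> k' + tb) s' k'"
    proof (rule wp_mono[OF wp_iteration[OF i(1,2) d _ e]], goal_cases)
      case 1
      then show ?case using n2 by simp
    next
      case (2 s2 k2)
      then obtain \<Lambda> w where r: "precise d \<epsilon> g \<Lambda>" "0 < w \<longrightarrow> 2 ^ (w - 1) < n + d * 2 ^ g"
          "k2 \<le> k' + n * d * (240 * (2 ^ g + \<Lambda> + w))"
        and alt: "(\<exists>n' bits. ready d \<epsilon> n' g s2 \<and> unit_rows n' d \<delta> (rows (reals s2 8) d) \<and> 2 * n' < n \<and>
          outbits s2 = outbits s' @ bits \<and> length bits \<le> n * (g + 3 * w + 3 * d * \<Lambda> + 4) \<and>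
          (\<forall>rest. valid \<epsilon> d n' (rows (reals s2 8) d) rest \<longrightarrow> valid \<epsilon> d n (rows (reals s' 8) d) (bits @ rest))) \<or>
          (ready d \<epsilon> n (Suc g) s2 \<and> outbits s2 = outbits s' \<and> reals s2 8 = reals s' 8 \<and>
          2 ^ 2 ^ g * \<delta> \<le> real d * real (modulus d g))"
        by blast
      have Lw: "\<Lambda> \<le> Lm" using L[OF Hg(1) r(1)] .
      have "n + d * 2 ^ g \<le> n0 + d * Hm" using i(4) Hg by (intro add_mono mult_left_mono) auto
      then have ww: "w \<le> wm" using r(2) by (intro W) auto
      have "n * d * (240 * (2 ^ g + \<Lambda> + w)) \<le> tb"
        unfolding tb_def using i(4) Hg Lw ww by (intro mult_mono add_mono) auto
      then have time: "k2 \<le> k' + tb" using r(3) by linarith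
      from alt show ?case
      proof
        assume "\<exists>n' bits. ready d \<epsilon> n' g s2 \<and> unit_rows n' d \<delta> (rows (reals s2 8) d) \<and> 2 * n' < n \<and>
          outbits s2 = outbits s' @ bits \<and> length bits \<le> n * (g + 3 * w + 3 * d * \<Lambda> + 4) \<and>
          (\<forall>rest. valid \<epsilon> d n' (rows (reals s2 8) d) rest \<longrightarrow> valid \<epsilon> d n (rows (reals s' 8) d) (bits @ rest))"
        then obtain n' b where b: "ready d \<epsilon> n' g s2" "unit_rows n' d \<delta> (rows (reals s2 8) d)" "2 * n' < n"
            "outbits s2 = outbits s' @ b" "length b \<le> n * (g + 3 * w + 3 * d * \<Lambda> + 4)"
            "\<And>rest. valid \<epsilon> d n' (rows (reals s2 8) d) rest \<Longrightarrow> valid \<epsilon> d n (rows (reals s' 8) d) (b @ rest)"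
          by blast
        have "2 ^ Suc it * (n' + 1) = 2 ^ it * (2 * n' + 2)" by simp
        also have "\<dots> \<le> 2 ^ it * (n + 1)" using b(3) by (intro mult_left_mono) auto
        also have "\<dots> \<le> (n0 + 1) * 2 ^ g" by (rule i(5))
        finally have it: "2 ^ Suc it * (n' + 1) \<le> (n0 + 1) * 2 ^ g" .
        have "n * (g + 3 * w + 3 * d * \<Lambda> + 4) \<le> n * c"
          unfolding c_def using Hg Lw ww by (intro mult_left_mono add_mono) auto
        moreover have "c * (2 * n') \<le> c * n" using b(3) by (intro mult_left_mono) auto
        ultimately have len: "length (bits @ b) + 2 * c * n' \<le> 2 * c * n0"
          using b(5) i(7) unfolding length_append by (simp only: mult.assoc mult.commute[of n] mult.left_commute[of c])
        have "I (Suc it) s2"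
          unfolding I_def
          by (intro exI[of _ n'] exI[of _ g] exI[of _ "bits @ b"] conjI)
            (use b i it len in auto)
        then show ?thesis using time by simp
      next
        assume f: "ready d \<epsilon> n (Suc g) s2 \<and> outbits s2 = outbits s' \<and> reals s2 8 = reals s' 8 \<and>
          2 ^ 2 ^ g * \<delta> \<le> real d * real (modulus d g)"
        have "I (Suc it) s2"
          unfolding I_def
          by (intro exI[of _ n] exI[of _ "Suc g"] exI[of _ bits] conjI)
            (use f i in \<open>auto simp: separation_fails_def\<close>)
        then show ?thesis using time by simp
      qed
    qed
    ultimately show ?case by blast
  next
    case (3 it s' k')
    from 3(1) obtain n g bits where i: "ready d \<epsilon> n g s'" "outbits s' = outbits s @ bits" "length bits + 2 * c * n \<le> 2 * c * n0"
        "\<And>rest. valid \<epsilon> d n (rows (reals s' 8) d) rest \<Longrightarrow> valid \<epsilon> d n0 ?U (bits @ rest)"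
      unfolding I_def by blast
    have "n \<le> 1" using 3(3) i(1) unfolding ready_def by simp
    then have "valid \<epsilon> d n0 ?U (bits @ [])" by (intro i(4) valid_last)
    then show ?case
      using i(2,3) bound[OF 3(1)] 3(4) unfolding c_def[symmetric] tb_def[symmetric]
      by (intro exI[of _ bits] exI[of _ it]) auto
  qed
qed

definition prepare :: com where
  "prepare = (NSet 2 (NCell 0 (NConst 0)) ;; NSet 3 (NCell 0 (NConst 1)) ;; scan ;; NSet 4 (V 5) ;; exponent ;;
     emit_unary 3 ;; emit_unary 2 ;; fill ;; NSet 10 (NConst 1) ;; NSet 11 (NConst 0) ;; NSet 12 (V 3))"

definition sketch :: com where
  "sketch = Cond (RLe (RNum 1) (RV 0)) Skip (prepare ;; main_loop)"

text \<open>The power of 2 is within a factor 2 of the radius or of its reciprocal. The lower bound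
  on \<open>F\<close> puts all points strictly inside a cube of side 1; the upper bound keeps the
  scaled minimum distance at 1 / (8 \<Phi>) or more.\<close>

lemma exponent_scale:
  assumes "exponent_ok R sg K e" "0 < R" "F = scale sg (pow_bits K e)"
  shows "2 * R < F" "F \<le> 8 * R"
proof -
  let ?P = "pow_bits K e"
  have P: "0 < ?P" by (rule pow_bits_pos)
  have "2 * R < F \<and> F \<le> 8 * R"
  proof (cases "1 \<le> R")
    case True
    then have "?P \<le> R" "R < 2 * ?P" "F = 4 * ?P"
      using assms unfolding exponent_ok_def scale_def Let_def by auto
    then show ?thesis using P by linarith
  next
    case False
    then have "?P \<le> 1 / R" "1 / R < 2 * ?P" "F = 4 / ?P"
      using assms unfolding exponent_ok_def scale_def Let_def by auto
    then have "R * ?P \<le> 1" "1 < 2 * (R * ?P)" using assms(2) by (simp_all add: field_simps)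
    then have "2 * R * ?P < 4" "4 \<le> 8 * R * ?P" by simp_all
    then show ?thesis unfolding \<open>F = 4 / ?P\<close> using P by (simp add: less_divide_eq divide_le_eq)
  qed
  then show "2 * R < F" "F \<le> 8 * R" by auto
qed

lemma wp_prepare:
  assumes s: "nats s 0 0 = n" "nats s 0 1 = d" and x: "\<And>i k. i < n \<Longrightarrow> k < d \<Longrightarrow> rows (reals s 1) d i k = x i k"
    and R: "\<And>R. radius_of n d x R \<Longrightarrow> 0 < R" and n: "0 < n" and out: "outbits s = []"
  shows "wp prepare (\<lambda>s' k'. \<exists>R sg K e F. radius_of n d x R \<and> exponent_ok R sg K e \<and> F = scale sg (pow_bits K e) \<and>
     ready d (reals s 0 0) n 0 s' \<and> (\<forall>i<n. \<forall>k<d. rows (reals s' 8) d i k = (x i k - x 0 k) / F + 1 / 2) \<and>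
     outbits s' = header_bits sg K e d n \<and>
     k' \<le> k + 12 * K + 12 * (n * d) + 11 * n + 3 * d + 45) s k"
  unfolding prepare_def wp_simps
proof (rule wp_use[OF wp_scan[where n = n and d = d]], goal_cases)
  case (3 s1 k1)
  define R where "R = reals s1 2 0"
  have rad: "radius_of n d (rows (reals s 1) d) R" and p: "nats s1 5 0 = n * d" and k1: "k1 \<le> k + 2 + 8 * (n * d) + 4 * n + 4"
    using 3(1) unfolding R_def by auto
  have rad': "radius_of n d x R"
  proof -
    have eq: "\<bar>rows (reals s 1) d i k - rows (reals s 1) d 0 k\<bar> = \<bar>x i k - x 0 k\<bar>" if "i < n" "k < d" for i k
      using x that n by simp
    show ?thesis using rad unfolding radius_of_def by (metis eq)
  qed
  have s1: "nats s1 2 0 = n" "nats s1 3 0 = d" "reals s1 1 = reals s 1" "reals s1 0 = reals s 0" "outbits s1 = []"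
    using s out by (simp_all add: same_nats[OF 3(2)] same_reals[OF 3(2)] same_outbits[OF 3(2)] set_cell_def)
  show ?case
    unfolding wp_simps
  proof (rule wp_use[OF wp_exponent[where R = R]], goal_cases)
    case (3 s2 k2)
    then obtain sg K e where E: "exponent_ok R sg K e" "reals s2 7 0 = scale sg (pow_bits K e)"
        "outbits s2 = sg # unary K @ map e [0..<K]" "k2 \<le> k1 + 1 + 12 * K + 20"
      using s1 by auto
    have s2: "nats s2 2 0 = n" "nats s2 3 0 = d" "nats s2 4 0 = n * d" "reals s2 1 = reals s 1" "reals s2 0 = reals s 0"
      using s1 p by (simp_all add: same_nats[OF 3(2)] same_reals[OF 3(2)] set_cell_def)
    show ?case
    proof (rule wp_use[OF wp_emit_unary[where g = d]], goal_cases)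
      case (3 s3 k3)
      have s3: "nats s3 2 0 = n" "nats s3 3 0 = d" "nats s3 4 0 = n * d" "reals s3 = reals s2"
        using s2 same_reals[OF 3(2)] by (simp_all add: same_nats[OF 3(2)] fun_eq_iff)
      have o3: "outbits s3 = sg # unary K @ map e [0..<K] @ unary d" "k3 \<le> k2 + 3 * d + 3" using 3 E by auto
      show ?case
      proof (rule wp_use[OF wp_emit_unary[where g = n]], goal_cases)
        case (3 s4 k4)
        have s4: "nats s4 2 0 = n" "nats s4 3 0 = d" "nats s4 4 0 = n * d" "reals s4 = reals s2"
          using s3 same_reals[OF 3(2)] by (simp_all add: same_nats[OF 3(2)] fun_eq_iff)
        have o4: "outbits s4 = header_bits sg K e d n" "k4 \<le> k3 + 3 * n + 3" using 3 o3 by (auto simp: header_bits_def)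
        show ?case
        proof (rule wp_use[OF wp_fill[where n = n and d = d and F = "reals s4 7 0"]], goal_cases)
          case (4 s5 k5)
          have s5: "nats s5 2 0 = n" "nats s5 3 0 = d" "nats s5 4 0 = n * d" "reals s5 0 = reals s 0"
            "outbits s5 = header_bits sg K e d n"
            using s4 s2 o4 by (simp_all add: same_nats[OF 4(2)] same_reals[OF 4(2)] same_outbits[OF 4(2)])
          have U: "\<forall>i<n. \<forall>k<d. rows (reals s5 8) d i k = (x i k - x 0 k) / scale sg (pow_bits K e) + 1 / 2"
            using 4(1) s4 s2 E(2) x n by simp
          have "k5 + 3 \<le> k + 12 * K + 12 * (n * d) + 11 * n + 3 * d + 45"
            using 4(1) o4 o3 E(4) k1 by simp
          then show ?case
            unfolding wp_simps
            by (intro exI[of _ R] exI[of _ sg] exI[of _ K] exI[of _ e] exI[of _ "scale sg (pow_bits K e)"] conjI)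
              (use rad' E(1) U s5 in \<open>simp_all add: ready_def set_cell_def\<close>)
        qed (use s4 in auto)
      qed (use s3 in auto)
    qed (use s2 in auto)
  qed (use R[OF rad'] R_def in auto)
qed (use s in \<open>auto simp: set_cell_def\<close>)

section \<open>Bounds\<close>

text \<open>Serves to remove the factor \<open>h\<close> from an inequality
  \<open>2 ^ h \<le> A * h\<close>.\<close>

lemma square_le_pow2: "(real h)\<^sup>2 \<le> 4 * 2 ^ h"
proof (induction h)
  case (Suc h)
  show ?case
  proof (cases "h < 3")
    case True
    then consider "h = 0" | "h = 1" | "h = 2" by linarith
    then show ?thesis by cases (auto simp: power2_eq_square)
  next
    case False
    then have h: "3 \<le> real h" by simp
    then have "3 * real h \<le> real h * real h" by (intro mult_right_mono) auto
    moreover have "(real (Suc h))\<^sup>2 = real h * real h + 2 * real h + 1"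
      by (simp add: power2_eq_square algebra_simps)
    ultimately have "(real (Suc h))\<^sup>2 \<le> 2 * (real h)\<^sup>2"
      using h unfolding power2_eq_square[of "real h"] by linarith
    with Suc show ?thesis by simp
  qed
qed simp

text \<open>The modulus itself grows with the number \<open>h\<close> of levels, so failure gives
  only \<open>2 ^ h \<le> A * h\<close> with \<open>A = 40 * \<Phi> * d\<^sup>2\<close>; squaring
  and \<open>square_le_pow2\<close> turn this into \<open>2 ^ h \<le> 4 * A\<^sup>2\<close>. In 40,
  the factor 8 comes from the scaling and 5 from
  \<open>4 * d * h + 1 \<le> 5 * d * h\<close>.\<close>

lemma level_bound:
  assumes f: "separation_fails d \<delta> g" and d: "1 \<le> d" and Phi: "1 \<le> \<Phi>" and \<delta>: "1 \<le> 8 * \<Phi> * \<delta>"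
  shows "2 * 2 ^ g \<le> 28 + 4 * log 2 \<Phi> + 8 * log 2 (real d)"
proof -
  define h :: nat where "h = 2 ^ g"
  define A where "A = 40 * \<Phi> * (real d)\<^sup>2"
  have h: "1 \<le> real h" unfolding h_def by simp
  have d': "1 \<le> real d" using d by simp
  have A: "0 < A" unfolding A_def using d Phi by simp
  have "2 ^ h * \<delta> \<le> real d * (4 * real d * real h + 1)"
    using f unfolding separation_fails_def modulus_def h_def by (simp add: add.commute)
  also have "\<dots> \<le> real d * (4 * real d * real h + real d * real h)"
    using mult_mono[OF d' h] d' by (intro mult_left_mono add_left_mono) auto
  also have "\<dots> = 5 * (real d)\<^sup>2 * real h" by (simp add: power2_eq_square)
  finally have 1: "2 ^ h * \<delta> \<le> 5 * (real d)\<^sup>2 * real h" .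
  have "2 ^ h * 1 \<le> 2 ^ h * (8 * \<Phi> * \<delta>)" using \<delta> by (intro mult_left_mono) auto
  also have "\<dots> = 8 * \<Phi> * (2 ^ h * \<delta>)" by simp
  also have "\<dots> \<le> 8 * \<Phi> * (5 * (real d)\<^sup>2 * real h)" using 1 Phi by (intro mult_left_mono) auto
  also have "\<dots> = A * real h" unfolding A_def by simp
  finally have 2: "2 ^ h \<le> A * real h" by simp
  have "2 ^ h * 2 ^ h \<le> (A * real h) * (A * real h)" using 2 by (intro mult_mono) (use A in auto)
  also have "\<dots> = A\<^sup>2 * (real h)\<^sup>2" by (simp add: power2_eq_square)
  also have "\<dots> \<le> A\<^sup>2 * (4 * 2 ^ h)" using square_le_pow2[of h] by (intro mult_left_mono) auto
  finally have 3: "(2::real) ^ h \<le> 4 * A\<^sup>2" by simp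
  have "real h = log 2 (2 ^ h)" by simp
  also have "\<dots> \<le> log 2 (4 * A\<^sup>2)" using 3 A by (intro log_mono) auto
  also have "\<dots> = 2 + 2 * log 2 A"
    using A log_pow_cancel[of 2 2] by (simp add: log_mult log_nat_power)
  also have "log 2 A = log 2 40 + log 2 \<Phi> + 2 * log 2 (real d)"
    unfolding A_def using Phi d by (simp add: log_mult log_nat_power)
  also have "log 2 40 \<le> (6::real)"
    by (subst log_le_iff) auto
  finally have "real h \<le> 14 + 2 * log 2 \<Phi> + 4 * log 2 (real d)" by simp
  then show ?thesis unfolding h_def by simp
qed

lemma lg_ge: "1 \<le> lg y" "log 2 y \<le> lg y"
  unfolding lg_def by auto

lemma log2_le_self: "1 \<le> d \<Longrightarrow> log 2 (real d) \<le> real d"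
  using less_exp[of d] by (subst log_le_iff) (auto simp: powr_realpow intro: less_imp_le)

text \<open>For \<epsilon> < 1, dividing by \<epsilon> only increases the argument of the logarithm,
  so the logarithms of \<open>d\<close>, of \<open>lg \<Phi>\<close> and of 1 / \<epsilon> are all
  dominated by the single quantity \<open>l0\<close>.\<close>

lemma lambda_facts:
  assumes d: "1 \<le> d" and Phi: "1 \<le> \<Phi>" and e: "0 < \<epsilon>" "\<epsilon> < 1"
  defines "A \<equiv> real d * lg \<Phi> / \<epsilon>" and "l0 \<equiv> lambda_bound d \<Phi> \<epsilon>"
  shows "1 \<le> l0" "log 2 (real d) \<le> l0" "real d * lg \<Phi> \<le> A" "log 2 A \<le> l0" "1 \<le> A" "real d \<le> A" "1 / \<epsilon> \<le> A"
proof -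
  have dl: "1 \<le> real d * lg \<Phi>" "real d \<le> real d * lg \<Phi>"
    using d lg_ge(1)[of \<Phi>] mult_mono[of 1 "real d" 1 "lg \<Phi>"] mult_left_mono[of 1 "lg \<Phi>" "real d"] by auto
  then have p: "0 < real d * lg \<Phi>" by linarith
  have "real d * lg \<Phi> * \<epsilon> \<le> real d * lg \<Phi> * 1" using p e by (intro mult_left_mono) auto
  then show A: "real d * lg \<Phi> \<le> A" unfolding A_def using e by (simp add: le_divide_eq)
  show "1 \<le> l0" unfolding l0_def lambda_bound_def by (rule lg_ge)
  show lA: "log 2 A \<le> l0" unfolding l0_def lambda_bound_def A_def by (rule lg_ge)
  show "1 \<le> A" "real d \<le> A" using A dl by auto
  then show "log 2 (real d) \<le> l0" using lA d by (auto intro: order_trans[OF log_mono])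
  show "1 / \<epsilon> \<le> A" unfolding A_def using dl e by (simp add: divide_right_mono)
qed

lemma pointset_facts:
  assumes n: "2 \<le> n" and ps: "pointset n d x"
  shows "1 \<le> d" "0 < min_dist n d x" "1 \<le> aspect_ratio n d x"
    "\<And>i j. i < n \<Longrightarrow> j < n \<Longrightarrow> i \<noteq> j \<Longrightarrow> min_dist n d x \<le> pdist d (x i) (x j) \<and>
       pdist d (x i) (x j) \<le> aspect_ratio n d x * min_dist n d x"
proof -
  let ?P = "pair_dists n d x"
  have fin: "finite ?P"
  proof (rule finite_subset)
    show "?P \<subseteq> (\<lambda>(i, j). pdist d (x i) (x j)) ` ({..<n} \<times> {..<n})" unfolding pair_dists_def by auto
  qed auto
  have in1: "pdist d (x i) (x j) \<in> ?P" if "i < j" "j < n" for i j using that unfolding pair_dists_def by auto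
  have ne: "?P \<noteq> {}" using in1[of 0 1] n by auto
  show d: "1 \<le> d"
    using ps n unfolding pointset_def by (metis One_nat_def Suc_leI Suc_le_lessD gr0I less_one not_less_zero numeral_2_eq_2)
  have pos: "0 < y" if y: "y \<in> ?P" for y
  proof -
    obtain i j where ij: "i < j" "j < n" "y = pdist d (x i) (x j)" using y unfolding pair_dists_def by blast
    then obtain k where k: "k < d" "x i k \<noteq> x j k" using ps unfolding pointset_def by blast
    have "0 < (\<Sum>k<d. (x i k - x j k)\<^sup>2)"
      by (rule sum_pos2[of _ k]) (use k in auto)
    then show ?thesis unfolding ij(3) pdist_def L2_set_def by simp
  qed
  show m: "0 < min_dist n d x" unfolding min_dist_def by (rule pos) (rule Min_in[OF fin ne])
  have sym: "pdist d p q = pdist d q p" for p q by (simp add: pdist_def L2_set_def power2_commute)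
  have P: "pdist d (x i) (x j) \<in> ?P" if "i < n" "j < n" "i \<noteq> j" for i j
    using in1[of i j] in1[of j i] that sym by (metis nat_neq_iff)
  have mx: "Max ?P = aspect_ratio n d x * min_dist n d x" unfolding aspect_ratio_def using m by simp
  show "min_dist n d x \<le> pdist d (x i) (x j) \<and> pdist d (x i) (x j) \<le> aspect_ratio n d x * min_dist n d x"
    if "i < n" "j < n" "i \<noteq> j" for i j
    using Min_le[OF fin P[OF that]] Max_ge[OF fin P[OF that]] unfolding mx min_dist_def[symmetric] by simp
  have "min_dist n d x \<le> Max ?P" unfolding min_dist_def using fin ne by (intro Max_ge Min_in) auto
  then show "1 \<le> aspect_ratio n d x" unfolding aspect_ratio_def using m by simp
qed

lemma radius_facts:
  assumes n: "2 \<le> n" and ps: "pointset n d x" and R: "radius_of n d x R"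
  shows "0 < R" "R \<le> aspect_ratio n d x * min_dist n d x" "min_dist n d x \<le> real d * R"
proof -
  obtain k where k: "k < d" "x 0 k \<noteq> x 1 k" using ps n unfolding pointset_def by (metis One_nat_def lessI less_2_cases_iff less_le_trans zero_less_one)
  have le: "\<bar>x i k - x 0 k\<bar> \<le> R" if "i < n" "k < d" for i k using R that unfolding radius_of_def by blast
  show R0: "0 < R" using le[of 1 k] k n by simp
  then obtain i k' where i: "i < n" "k' < d" "R = \<bar>x i k' - x 0 k'\<bar>" using R unfolding radius_of_def by auto
  then have "i \<noteq> 0" using R0 by (cases i) auto
  have "R \<le> pdist d (x i) (x 0)"
    unfolding i(3) pdist_def using member_le_L2_set[of "{..<d}" k' "\<lambda>k. \<bar>x i k - x 0 k\<bar>"] i(2)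
    by (simp add: L2_set_def)
  then show "R \<le> aspect_ratio n d x * min_dist n d x"
    using pointset_facts(4)[OF n ps, of i 0] i \<open>i \<noteq> 0\<close> n by simp
  have "min_dist n d x \<le> pdist d (x 1) (x 0)" using pointset_facts(4)[OF n ps, of 1 0] n by simp
  also have "\<dots> \<le> sqrt (real d) * R"
    unfolding pdist_def by (rule L2_set_le_const) (use le n R0 in auto)
  also have "\<dots> \<le> real d * R"
    by (rule mult_right_mono[OF sqrt_nat_le]) (use R0 in simp)
  finally show "min_dist n d x \<le> real d * R" .
qed

text \<open>The logarithms of the radius and of the minimum distance differ by at most log \<Phi> +
  log d. Bounding the sum of these contributions by a product lets the second logarithm split into
  \<open>scale_bits\<close> and a part dominated by \<Lambda>.\<close>

lemma exponent_length:
  assumes n: "2 \<le> n" and ps: "pointset n d x" and R: "radius_of n d x R" and E: "exponent_ok R sg K e"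
    and l0: "1 \<le> l0" "log 2 (real d * lg (aspect_ratio n d x)) \<le> l0"
  shows "real K \<le> scale_bits (min_dist n d x) + 4 * l0"
proof (cases "K = 0")
  case True
  then show ?thesis using l0 unfolding scale_bits_def by simp
next
  case False
  let ?m = "min_dist n d x" and ?F = "aspect_ratio n d x"
  note pf = pointset_facts[OF n ps] and rf = radius_facts[OF n ps R]
  define v where "v = (if 1 \<le> R then R else 1 / R)"
  have v: "2 ^ 2 ^ (K - 1) \<le> v" using E False unfolding exponent_ok_def v_def Let_def by simp
  have v0: "0 < v" unfolding v_def using rf by simp
  have lv: "log 2 v \<le> \<bar>log 2 R\<bar>" unfolding v_def using rf(1) by (auto simp: log_divide)
  have d0: "0 < real d" "1 \<le> real d" using pf(1) by auto
  have d1: "0 \<le> log 2 (real d)" using d0 by simp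
  have F1: "0 \<le> log 2 ?F" using pf(3) by simp
  have "log 2 R \<le> log 2 (?F * ?m)" using rf(1,2) by (intro log_mono) auto
  also have "\<dots> = log 2 ?F + log 2 ?m" using pf(2,3) by (subst log_mult) auto
  finally have up: "log 2 R \<le> log 2 ?F + log 2 ?m" .
  have "log 2 ?m \<le> log 2 (real d * R)" using rf(3) pf(2) by (intro log_mono) auto
  also have "\<dots> = log 2 (real d) + log 2 R" using d0 rf(1) by (subst log_mult) auto
  finally have lo: "log 2 ?m \<le> log 2 (real d) + log 2 R" .
  define a where "a = \<bar>log 2 ?m\<bar>"
  have "\<bar>log 2 R\<bar> \<le> a + log 2 ?F + log 2 (real d)"
    using up lo d1 F1 unfolding a_def by linarith
  also have "\<dots> \<le> a + 2 * (real d * lg ?F)"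
  proof -
    have "1 * lg ?F \<le> real d * lg ?F" "real d * 1 \<le> real d * lg ?F"
      using d0 lg_ge(1)[of ?F] by (auto intro!: mult_right_mono mult_left_mono)
    then show ?thesis using lg_ge(2)[of ?F] log2_le_self[OF pf(1)] by linarith
  qed
  also have "\<dots> \<le> (1 + a) * (2 * (real d * lg ?F))"
  proof -
    have "1 * 1 \<le> real d * lg ?F" using d0 lg_ge(1)[of ?F] by (intro mult_mono) auto
    then have "a * 1 \<le> a * (2 * (real d * lg ?F))" unfolding a_def by (intro mult_left_mono) auto
    then show ?thesis by (simp add: algebra_simps)
  qed
  finally have bR: "\<bar>log 2 R\<bar> \<le> (1 + a) * (2 * (real d * lg ?F))" .
  have dl: "0 < real d * lg ?F" using d0 lg_ge(1)[of ?F] by simp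
  have a1: "0 < 1 + a" unfolding a_def by simp
  have "(2::real) ^ (K - 1) = log 2 (2 ^ 2 ^ (K - 1))" by simp
  also have "\<dots> \<le> log 2 v" using v v0 by (intro log_mono) auto
  also have "\<dots> \<le> (1 + a) * (2 * (real d * lg ?F))" using lv bR by linarith
  finally have "log 2 (2 ^ (K - 1)) \<le> log 2 ((1 + a) * (2 * (real d * lg ?F)))" by (intro log_mono) auto
  also have "\<dots> = scale_bits ?m + 1 + log 2 (real d * lg ?F)"
  proof -
    have "log 2 ((1 + a) * (2 * B)) = log 2 (1 + a) + 1 + log 2 B" if "0 < B" for B
      using that a1 by (simp add: log_mult)
    from this[OF dl] show ?thesis unfolding scale_bits_def a_def .
  qed
  finally have "real (K - 1) \<le> scale_bits ?m + 1 + l0" using l0(2) by simp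
  then show ?thesis using False l0(1) by (simp add: of_nat_diff)
qed

lemma log2_const: "log 2 40 \<le> (6::real)" "log 2 64 = (6::real)" "log 2 800 \<le> (10::real)" "log 2 128 = (7::real)"
proof -
  show "log 2 40 \<le> (6::real)" "log 2 800 \<le> (10::real)" by (subst log_le_iff; auto)+
  show "log 2 64 = (6::real)" using log_pow_cancel[of 2 6] by simp
  show "log 2 128 = (7::real)" using log_pow_cancel[of 2 7] by simp
qed

lemma nat_floor_le: "0 \<le> a \<Longrightarrow> real (nat \<lfloor>a\<rfloor>) \<le> a"
  by simp

section \<open>Explicit bounds in terms of \<Phi>, \<epsilon> and the scale\<close>

locale sketch_bounds =
  fixes n d :: nat and \<Phi> \<epsilon> \<sigma> :: real
  assumes n: "2 \<le> n" and d: "1 \<le> d" and Phi: "1 \<le> \<Phi>" and eps: "0 < \<epsilon>" "\<epsilon> < 1" and sigma: "0 \<le> \<sigma>"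
begin

definition l0 :: real where "l0 = lambda_bound d \<Phi> \<epsilon>"
definition LL :: real where "LL = log 2 \<Phi> + l0"
text \<open>The two bounds on the number of levels serve different ends: the sum
  \<open>36 * LL\<close> for the running time, and the multiple of \<open>d * lg \<Phi>\<close>
  wherever a logarithm of the number of levels is compared with \<open>l0\<close>.\<close>

definition Hmax :: nat where "Hmax = nat \<lfloor>min (36 * LL) (40 * (real d * lg \<Phi>))\<rfloor>"
definition gmax :: nat where "gmax = nat \<lfloor>7 * l0\<rfloor>"
definition Lmax :: nat where "Lmax = nat \<lfloor>15 * l0\<rfloor>"
definition wmax :: nat where "wmax = nat \<lfloor>9 * l0 + log 2 (real n)\<rfloor>"
definition TT :: real where "TT = real n * real d * LL + \<sigma>"

lemma l0_facts: "1 \<le> l0" "log 2 (real d) \<le> l0" "0 \<le> log 2 \<Phi>" "1 \<le> LL" "l0 \<le> LL" "1 \<le> real d * lg \<Phi>"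
  "log 2 (real d * lg \<Phi>) \<le> l0"
proof -
  note lf = lambda_facts[OF d Phi eps]
  show l: "1 \<le> l0" "log 2 (real d) \<le> l0" using lf unfolding l0_def by auto
  show p: "0 \<le> log 2 \<Phi>" using Phi by simp
  show "1 \<le> LL" "l0 \<le> LL" unfolding LL_def using l p by auto
  have "1 * 1 \<le> real d * lg \<Phi>" using d lg_ge(1)[of \<Phi>] by (intro mult_mono) auto
  then show dl: "1 \<le> real d * lg \<Phi>" by simp
  have "log 2 (real d * lg \<Phi>) \<le> log 2 (real d * lg \<Phi> / \<epsilon>)" using dl lf(3) by (intro log_mono) auto
  then show "log 2 (real d * lg \<Phi>) \<le> l0" using lf(4) unfolding l0_def by linarith
qed

lemma max_le: "real Hmax \<le> 36 * LL" "real Hmax \<le> 40 * (real d * lg \<Phi>)" "real gmax \<le> 7 * l0"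
  "real Lmax \<le> 15 * l0" "real wmax \<le> 9 * l0 + log 2 (real n)"
proof -
  have "real Hmax \<le> min (36 * LL) (40 * (real d * lg \<Phi>))"
    unfolding Hmax_def using l0_facts by (intro nat_floor_le) auto
  then show "real Hmax \<le> 36 * LL" "real Hmax \<le> 40 * (real d * lg \<Phi>)" by auto
  show "real gmax \<le> 7 * l0" "real Lmax \<le> 15 * l0" "real wmax \<le> 9 * l0 + log 2 (real n)"
    unfolding gmax_def Lmax_def wmax_def using l0_facts n by (auto intro!: nat_floor_le)
qed

text \<open>Exponent \<open>g\<close> is reached only after a failure at \<open>g - 1\<close>, hence
  the factor 2 in \<open>level_bound\<close>. Of its coefficients, 28 + 8 gives 36 and 28 + 4 + 8
  gives 40. In \<open>gmax\<close>, 7 is 6 for log 40 plus 1.\<close>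

lemma level_max:
  assumes g: "g = 0 \<or> separation_fails d \<delta> (g - 1)" and \<delta>: "1 \<le> 8 * \<Phi> * \<delta>"
  shows "2 ^ g \<le> Hmax \<and> g \<le> gmax"
proof -
  have dl: "real d \<le> real d * lg \<Phi>" "lg \<Phi> \<le> real d * lg \<Phi>"
    using d lg_ge(1)[of \<Phi>] by (auto intro: mult_left_mono[of 1 _ "real d", simplified] mult_right_mono[of 1 _ "lg \<Phi>", simplified])
  have b: "(2::real) ^ g \<le> 28 + 4 * log 2 \<Phi> + 8 * log 2 (real d)"
  proof (cases "g = 0")
    case True
    then show ?thesis using l0_facts d by simp
  next
    case False
    then obtain g' where "g = Suc g'" by (cases g) auto
    then show ?thesis using level_bound[OF _ d Phi \<delta>, of g'] g by simp
  qed
  have "G \<le> 28 + 4 * a + 8 * b \<Longrightarrow> 1 \<le> c \<Longrightarrow> b \<le> c \<Longrightarrow> 0 \<le> a \<Longrightarrow> G \<le> 36 * (a + c)" for G a b c :: real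
    by (simp add: algebra_simps)
  from this[OF b l0_facts(1-3)] have 1: "(2::real) ^ g \<le> 36 * LL" unfolding LL_def .
  have 2: "(2::real) ^ g \<le> 40 * (real d * lg \<Phi>)"
    using b dl lg_ge(2)[of \<Phi>] log2_le_self[OF d] l0_facts by linarith
  have "real (2 ^ g) \<le> min (36 * LL) (40 * (real d * lg \<Phi>))" using 1 2 by simp
  then have H: "2 ^ g \<le> Hmax" unfolding Hmax_def by (rule le_nat_floor)
  have "real g = log 2 (2 ^ g)" by simp
  also have "\<dots> \<le> log 2 (40 * (real d * lg \<Phi>))" using 2 by (intro log_mono) auto
  also have "\<dots> = log 2 40 + log 2 (real d * lg \<Phi>)" using l0_facts(6) by (subst log_mult) auto
  also have "\<dots> \<le> 7 * l0" using log2_const(1) l0_facts by linarith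
  finally have "g \<le> gmax" unfolding gmax_def by (rule le_nat_floor)
  with H show ?thesis ..
qed

text \<open>Everything is measured in \<open>A = d * lg \<Phi> / \<epsilon>\<close>: the modulus is
  at most 200 A^2, and d and 1 / \<epsilon> are at most A each, so 2^(\<Lambda>-1) is below 800 A^4.
  This makes 10 + 4 l0 for \<Lambda> - 1, hence 15 l0 for \<Lambda>.\<close>

lemma precision_max:
  assumes g: "2 ^ g \<le> Hmax" and p: "precise d \<epsilon> g \<Lambda>"
  shows "\<Lambda> \<le> Lmax"
proof (cases "\<Lambda> = 0")
  case False
  define A where "A = real d * lg \<Phi> / \<epsilon>"
  note lf = lambda_facts[OF d Phi eps, folded A_def l0_def]
  have A: "0 < A" "0 \<le> A" using lf(5) by auto
  have H1: "(2::real) ^ g \<le> real Hmax" using g by (metis of_nat_le_iff of_nat_numeral of_nat_power)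
  have "real (modulus d g) \<le> 5 * real d * 2 ^ g"
  proof -
    have "1 * 1 \<le> real d * 2 ^ g" using d by (intro mult_mono) auto
    then show ?thesis unfolding modulus_def by simp
  qed
  also have "\<dots> \<le> 5 * real d * (40 * (real d * lg \<Phi>))"
    using order_trans[OF H1 max_le(2)] by (intro mult_left_mono) auto
  also have "\<dots> \<le> 5 * A * (40 * A)" using lf A l0_facts(6) by (intro mult_mono) auto
  finally have M: "real (modulus d g) \<le> 200 * A\<^sup>2" by (simp add: power2_eq_square)
  have "2 ^ (\<Lambda> - 1) * \<epsilon> < 4 * real (modulus d g) * real d" using p False unfolding precise_def by simp
  also have "\<dots> \<le> 4 * (200 * A\<^sup>2) * A" using lf(6) M A by (intro mult_mono) auto
  finally have "2 ^ (\<Lambda> - 1) < 800 * A ^ 3 * (1 / \<epsilon>)"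
    using eps by (simp add: less_divide_eq power2_eq_square power3_eq_cube mult.assoc)
  also have "\<dots> \<le> 800 * A ^ 3 * A" using lf(7) A by (intro mult_left_mono) auto
  also have "\<dots> = 800 * A ^ 4" by (simp add: power3_eq_cube power4_eq_xxxx)
  finally have "log 2 (2 ^ (\<Lambda> - 1)) \<le> log 2 (800 * A ^ 4)" by (intro log_mono) auto
  also have "\<dots> = log 2 800 + 4 * log 2 A" using A by (simp add: log_mult log_nat_power)
  finally have "real (\<Lambda> - 1) \<le> 10 + 4 * l0" using log2_const(3) lf(4) by simp
  then have "real \<Lambda> \<le> 15 * l0" using False l0_facts(1) by (simp add: of_nat_diff)
  then show ?thesis unfolding Lmax_def by (rule le_nat_floor)
qed simp

lemma width_max:
  assumes w: "0 < w \<longrightarrow> 2 ^ (w - 1) < n + d * Hmax"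
  shows "w \<le> wmax"
proof (cases "w = 0")
  case False
  define A where "A = real d * lg \<Phi> / \<epsilon>"
  note lf = lambda_facts[OF d Phi eps, folded A_def l0_def]
  have A: "0 < A" "1 \<le> A\<^sup>2" using lf(5) by (auto simp: one_le_power)
  have n1: "1 \<le> real n" using n by simp
  have "2 ^ (w - 1) < n + d * Hmax" using w False by simp
  then have "(2::real) ^ (w - 1) < real n + real d * real Hmax"
    by (metis of_nat_add of_nat_less_iff of_nat_mult of_nat_numeral of_nat_power)
  also have "real d * real Hmax \<le> A * (40 * A)"
    using max_le(2) lf(3,6) A by (intro mult_mono) auto
  also have "real n + A * (40 * A) \<le> real n * A\<^sup>2 + 40 * (real n * A\<^sup>2)"
  proof (intro add_mono)
    show "real n \<le> real n * A\<^sup>2" using A(2) n1 by simp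
    show "A * (40 * A) \<le> 40 * (real n * A\<^sup>2)" using n1 mult_right_mono[of 1 "real n" "A\<^sup>2"] by (simp add: power2_eq_square mult_ac)
  qed
  \<comment> \<open>41 is rounded up to a power of 2, with logarithm 6.\<close>
  also have "\<dots> \<le> 64 * (real n * A\<^sup>2)" using n1 by simp
  finally have "log 2 (2 ^ (w - 1)) \<le> log 2 (64 * (real n * A\<^sup>2))" by (intro log_mono) auto
  also have "\<dots> = log 2 64 + log 2 (real n) + 2 * log 2 A" using A n1 by (simp add: log_mult log_nat_power)
  finally have "real (w - 1) \<le> 6 + log 2 (real n) + 2 * l0" using log2_const(2) lf(4) by simp
  then have "real w \<le> 9 * l0 + log 2 (real n)" using False l0_facts(1) by (simp add: of_nat_diff)
  then show ?thesis unfolding wmax_def by (rule le_nat_floor)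
qed simp

lemma products: "real n \<le> real n * real d * l0" "real d \<le> real n * real d * l0" "l0 \<le> real n * real d * l0"
  "1 \<le> real n * real d * l0" "real n * real d * l0 \<le> real n * real d * LL" "1 \<le> TT" "real n * real d * LL \<le> TT"
  "LL \<le> TT" "real n \<le> TT" "real n * real d \<le> TT"
proof -
  have nd: "1 \<le> real n" "1 \<le> real d" "1 \<le> real n * real d" "real n \<le> real n * real d" "real d \<le> real n * real d"
    using n d mult_mono[of 1 "real n" 1 "real d"] by auto
  note l = l0_facts
  have p: "real n * real d \<le> real n * real d * l0" using l(1) nd mult_left_mono[of 1 l0 "real n * real d"] by simp
  then show "real n \<le> real n * real d * l0" "real d \<le> real n * real d * l0" "1 \<le> real n * real d * l0" using nd by linarith+
  show "l0 \<le> real n * real d * l0" using l(1) nd(3) mult_right_mono[of 1 "real n * real d" l0] by simp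
  show q: "real n * real d * l0 \<le> real n * real d * LL" using l nd by (intro mult_left_mono) auto
  show T: "real n * real d * LL \<le> TT" unfolding TT_def using sigma by simp
  then show "1 \<le> TT" "real n \<le> TT" "real n * real d \<le> TT" using p q nd by linarith+
  have "LL \<le> real n * real d * LL" using l nd(3) mult_right_mono[of 1 "real n * real d" LL] by simp
  then show "LL \<le> TT" using T by linarith
qed

text \<open>The factor 2 in the bound on \<open>b\<close> is the sum of the geometric series of the
  rounds. The leading coefficient is 166 from the rounds plus 14 from the header, rounded up to
  200.\<close>

lemma size_bound:
  assumes K: "real K \<le> \<sigma> + 4 * l0" and b: "b \<le> 2 * (gmax + 3 * wmax + 3 * d * Lmax + 4) * n"
  shows "real (2 * K + d + n + 4 + b) \<le> 200 * (real n * real d * l0 + real n * log 2 (real n) + \<sigma>)"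
proof -
  define P where "P = real n * real d * l0"
  note pr = products[folded P_def]
  have "real b \<le> real (2 * (gmax + 3 * wmax + 3 * d * Lmax + 4) * n)" using b by (rule of_nat_mono)
  also have "\<dots> = 2 * (real gmax + 3 * real wmax + 3 * (real d * real Lmax) + 4) * real n" by simp
  also have "\<dots> \<le> 2 * (7 * l0 + 3 * (9 * l0 + log 2 (real n)) + 3 * (real d * (15 * l0)) + 4 * l0) * real n"
    using max_le l0_facts by (intro mult_right_mono mult_left_mono add_mono) auto
  also have "\<dots> = 76 * (real n * l0) + 6 * (real n * log 2 (real n)) + 90 * P" unfolding P_def by (simp add: algebra_simps)
  also have "real n * l0 \<le> P"
    unfolding P_def using d l0_facts(1) mult_left_mono[of 1 "real d" "real n * l0"] by (simp add: mult_ac)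
  finally have "real b \<le> 166 * P + 6 * (real n * log 2 (real n))" by simp
  moreover have "0 \<le> real n * log 2 (real n)" using n by simp
  ultimately have "2 * real K + real d + real n + 4 + real b \<le> 200 * (P + real n * log 2 (real n) + \<sigma>)"
    using K pr sigma unfolding distrib_left by linarith
  then show ?thesis unfolding P_def by simp
qed

text \<open>One logarithmic factor counts the passes, as \<open>2 ^ it\<close> is at most 128 (2 +
  TT)^2. The other one absorbs the log n in the width of the binary fields, so that a single pass
  costs O(TT q).\<close>

lemma time_bound:
  assumes K: "real K \<le> \<sigma> + 4 * l0" and it: "2 ^ it \<le> (n + 1) * Hmax"
    and t: "t \<le> 12 * K + 12 * (n * d) + 11 * n + 3 * d + 50 + it * (n * d * (240 * (Hmax + Lmax + wmax)) + 1)"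
  shows "real t \<le> 140000 * TT * log 2 (2 + TT) ^ 2"
proof -
  define q where "q = log 2 (2 + TT)"
  note pr = products and ml = max_le and l = l0_facts
  have T0: "1 \<le> TT" by (rule pr)
  have q1: "1 \<le> q" unfolding q_def using T0 by (subst le_log_iff) auto
  have Tq: "TT \<le> TT * q" "TT * q \<le> TT * q * q" using mult_left_mono[OF q1, of TT] mult_left_mono[OF q1, of "TT * q"] T0 q1 by auto
  have ln: "log 2 (real n) \<le> q" unfolding q_def using pr n by (intro log_mono) auto
  have "(2::real) ^ it \<le> real ((n + 1) * Hmax)" using it by (metis of_nat_le_iff of_nat_numeral of_nat_power)
  also have "\<dots> = (real n + 1) * real Hmax" by (simp add: algebra_simps)
  also have "\<dots> \<le> (2 * TT) * (36 * TT)"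
    using pr ml T0 l by (intro mult_mono) auto
  also have "\<dots> \<le> 128 * (2 + TT)\<^sup>2"
    using T0 by (simp add: power2_eq_square algebra_simps)
  finally have "log 2 (2 ^ it) \<le> log 2 (128 * (2 + TT)\<^sup>2)" by (intro log_mono) auto
  also have "\<dots> = log 2 128 + 2 * q" unfolding q_def using T0 by (simp add: log_mult log_nat_power)
  finally have it': "real it \<le> 9 * q" using q1 log2_const(4) by simp
  have "real (n * d * (240 * (Hmax + Lmax + wmax)) + 1) = real n * real d * (240 * (real Hmax + real Lmax + real wmax)) + 1"
    by simp
  also have "\<dots> \<le> real n * real d * (240 * (36 * LL + 15 * LL + (9 * LL + q))) + 1"
    using ml l ln by (intro add_mono mult_left_mono) auto
  also have "\<dots> = 14400 * (real n * real d * LL) + 240 * (real n * real d * q) + 1" by (simp add: algebra_simps)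
  also have "\<dots> \<le> 14641 * (TT * q)"
  proof -
    have "real n * real d * q \<le> TT * q" using pr q1 by (intro mult_right_mono) auto
    then show ?thesis using pr Tq T0 by linarith
  qed
  finally have body: "real (n * d * (240 * (Hmax + Lmax + wmax)) + 1) \<le> 14641 * (TT * q)" .
  have "real it * real (n * d * (240 * (Hmax + Lmax + wmax)) + 1) \<le> (9 * q) * (14641 * (TT * q))"
    using it' body q1 T0 by (intro mult_mono) auto
  also have "\<dots> = 131769 * (TT * q * q)" by simp
  finally have main: "real it * real (n * d * (240 * (Hmax + Lmax + wmax)) + 1) \<le> 131769 * (TT * q * q)" .
  have "real t \<le> real (12 * K + 12 * (n * d) + 11 * n + 3 * d + 50 + it * (n * d * (240 * (Hmax + Lmax + wmax)) + 1))"
    using t by (rule of_nat_mono)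
  also have "\<dots> = 12 * real K + 12 * (real n * real d) + 11 * real n + 3 * real d + 50 +
      real it * real (n * d * (240 * (Hmax + Lmax + wmax)) + 1)"
    by (simp only: of_nat_add of_nat_mult of_nat_numeral of_nat_1)
  also have "\<dots> \<le> 140000 * (TT * q * q)"
  proof -
    have "\<sigma> \<le> TT" unfolding TT_def using l by simp
    then show ?thesis using main K pr Tq T0 l by linarith
  qed
  finally show ?thesis unfolding q_def by (simp add: power2_eq_square)
qed

end

section \<open>Correctness of the complete sketch\<close>

lemma sketch_input_rows: "i < n \<Longrightarrow> k < d \<Longrightarrow> rows (reals (sketch_input n d \<epsilon> x \<omega>) 1) d i k = x i k"
proof -
  assume i: "i < n" and k: "k < d"
  have "i * d + k < (i + 1) * d" using k by simp
  also have "\<dots> \<le> n * d" using i by (intro mult_right_mono) auto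
  finally show ?thesis using k unfolding rows_def sketch_input_def by simp
qed

lemma good_sketchI:
  assumes "\<And>i j. i < n \<Longrightarrow> j < n \<Longrightarrow> i \<noteq> j \<Longrightarrow>
    \<exists>v. recovers recover b i j v \<and> \<bar>v - pdist d (x i) (x j)\<bar> \<le> \<epsilon> * pdist d (x i) (x j)"
  shows "good_sketch recover b n d x \<epsilon>"
  unfolding good_sketch_def
proof (intro allI impI)
  fix i j assume ij: "i < n" "j < n"
  show "\<exists>v. recovers recover b i j v \<and>
      v \<in> {(1 - \<epsilon>) * pdist d (x i) (x j)..(1 + \<epsilon>) * pdist d (x i) (x j)}"
  proof (cases "i = j")
    case True
    have "pdist d (x j) (x j) = 0" by (simp add: pdist_def L2_set_def)
    then show ?thesis using recover_same[of b j] True by auto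
  next
    case False
    obtain v where v: "recovers recover b i j v" "\<bar>v - pdist d (x i) (x j)\<bar> \<le> \<epsilon> * pdist d (x i) (x j)"
      using assms[OF ij False] by blast
    then have "v \<in> {(1 - \<epsilon>) * pdist d (x i) (x j)..(1 + \<epsilon>) * pdist d (x i) (x j)}"
      by (auto simp: abs_le_iff algebra_simps)
    with v(1) show ?thesis by blast
  qed
qed

text \<open>As 1 - \<epsilon> \<le> 0, the interval around every true distance contains 0, the
  answer to the empty sketch. The two steps are the test and \<open>Skip\<close>.\<close>

lemma sketch_large_eps:
  assumes "1 \<le> \<epsilon>"
  shows "runs sketch (sketch_input n d \<epsilon> x \<omega>) 2 (sketch_input n d \<epsilon> x \<omega>)"
    "good_sketch recover (outbits (sketch_input n d \<epsilon> x \<omega>)) n d x \<epsilon>"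
proof -
  let ?s = "sketch_input n d \<epsilon> x \<omega>"
  have "bval (RLe (RNum 1) (RV 0)) ?s" using assms by (simp add: sketch_input_def)
  from runs.CondTrue[OF this runs.Skip] show "runs sketch ?s 2 ?s"
    unfolding sketch_def by (simp add: numeral_2_eq_2)
  have "0 \<le> pdist d p q" for p q by (simp add: pdist_def)
  then have b: "(1 - \<epsilon>) * pdist d p q \<le> 0 \<and> 0 \<le> (1 + \<epsilon>) * pdist d p q" for p q
    using assms by (auto simp: mult_nonpos_nonneg)
  have "outbits ?s = []" by (simp add: sketch_input_def)
  then show "good_sketch recover (outbits ?s) n d x \<epsilon>"
    unfolding good_sketch_def using b recover_empty by (metis atLeastAtMost_iff)
qed

lemma sketch_small_eps:
  assumes n: "2 \<le> n" and ps: "pointset n d x" and eps: "0 < \<epsilon>" "\<epsilon> < 1"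
  defines "\<Phi> \<equiv> aspect_ratio n d x" and "\<sigma> \<equiv> scale_bits (min_dist n d x)"
  defines "l \<equiv> lambda_bound d \<Phi> \<epsilon>"
  defines "T \<equiv> real n * real d * (log 2 \<Phi> + l) + \<sigma>"
  shows "\<exists>t s. runs sketch (sketch_input n d \<epsilon> x \<omega>) t s \<and>
     real t \<le> 140000 * T * log 2 (2 + T) ^ 2 \<and>
     real (length (outbits s)) \<le> 200 * (real n * real d * l + real n * log 2 (real n) + \<sigma>) \<and>
     good_sketch recover (outbits s) n d x \<epsilon>"
proof -
  let ?s = "sketch_input n d \<epsilon> x \<omega>"
  define m where "m = min_dist n d x"
  note pf = pointset_facts[OF n ps, folded \<Phi>_def m_def]
  have sig: "0 \<le> \<sigma>" unfolding \<sigma>_def scale_bits_def by simp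
  interpret sketch_bounds n d \<Phi> \<epsilon> \<sigma> using n pf(1,3) eps sig by unfold_locales
  have l0: "l0 = l" and TT: "TT = T" unfolding l0_def TT_def LL_def l_def T_def by auto
  let ?Hm = "Hmax" and ?gm = "gmax" and ?Lm = "Lmax" and ?wm = "wmax"
  let ?Q = "\<lambda>s' t. real t \<le> 140000 * T * log 2 (2 + T) ^ 2 \<and>
     real (length (outbits s')) \<le> 200 * (real n * real d * l + real n * log 2 (real n) + \<sigma>) \<and>
     good_sketch recover (outbits s') n d x \<epsilon>"
  have e0: "reals ?s 0 0 = \<epsilon>" by (simp add: sketch_input_def)
  have "wp prepare (wp main_loop ?Q) ?s 1"
  proof (rule wp_use[OF wp_prepare[where n = n and d = d and x = x]], goal_cases)
    case (7 s1 k1)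
    then obtain R sg K e F where R: "radius_of n d x R" and E: "exponent_ok R sg K e" and F: "F = scale sg (pow_bits K e)"
      and rd: "ready d \<epsilon> n 0 s1" and U: "\<forall>i<n. \<forall>k<d. rows (reals s1 8) d i k = (x i k - x 0 k) / F + 1 / 2"
      and out: "outbits s1 = header_bits sg K e d n"
      and k1: "k1 \<le> 1 + 12 * K + 12 * (n * d) + 11 * n + 3 * d + 45"
      unfolding e0 by blast
    note rf = radius_facts[OF n ps R, folded \<Phi>_def m_def]
    have Fb: "2 * R < F" "F \<le> 8 * R" using exponent_scale[OF E rf(1) F] by auto
    have F0: "0 < F" using Fb rf(1) by linarith
    have pd: "pdist d (rows (reals s1 8) d i) (rows (reals s1 8) d j) = pdist d (x i) (x j) / F" if "i < n" "j < n" for i j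
      by (rule pdist_scale[OF F0]) (use U that in \<open>auto simp: diff_divide_distrib\<close>)
    define \<delta> where "\<delta> = m / F"
    have \<delta>: "1 \<le> 8 * \<Phi> * \<delta>" unfolding \<delta>_def using Fb rf(2) F0 by (simp add: le_divide_eq)
    have un: "unit_rows n d \<delta> (rows (reals s1 8) d)"
      unfolding unit_rows_def
    proof (intro conjI allI impI)
      fix i k assume ik: "i < n" "k < d"
      have "\<bar>x i k - x 0 k\<bar> \<le> R" using R ik unfolding radius_of_def by blast
      then have "- F < 2 * (x i k - x 0 k)" "2 * (x i k - x 0 k) < F" using Fb by (auto simp: abs_le_iff)
      then have "- 1 / 2 < (x i k - x 0 k) / F" "(x i k - x 0 k) / F < 1 / 2"
        using F0 by (simp_all add: less_divide_eq divide_less_eq)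
      moreover have "rows (reals s1 8) d i k = (x i k - x 0 k) / F + 1 / 2" using U ik by blast
      ultimately show "0 \<le> rows (reals s1 8) d i k" "rows (reals s1 8) d i k < 1" by linarith+
    next
      fix i j assume "i < n" "j < n" "i \<noteq> j"
      then show "\<delta> \<le> pdist d (rows (reals s1 8) d i) (rows (reals s1 8) d j)"
        unfolding \<delta>_def using pd pf(4) F0 by (simp add: divide_right_mono)
    qed
    have K: "real K \<le> \<sigma> + 4 * l"
      unfolding \<sigma>_def by (rule exponent_length[OF n ps R E])
        (use l0_facts \<Phi>_def l0 in auto)
    have d0: "0 < d" using pf(1) by simp
    show ?case
    proof (rule wp_mono[OF wp_main_loop[OF rd un d0 eps(1), where Hm = ?Hm and gm = ?gm and Lm = ?Lm and wm = ?wm]], goal_cases)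
      case (1 g)
      then show ?case by (rule level_max[OF _ \<delta>])
    next
      case (2 g \<Lambda>)
      then show ?case by (rule precision_max)
    next
      case (3 w)
      then show ?case by (rule width_max)
    next
      case (4 s2 k2)
      then obtain bits it where b: "outbits s2 = outbits s1 @ bits" "valid \<epsilon> d n (rows (reals s1 8) d) bits"
          "length bits \<le> 2 * (?gm + 3 * ?wm + 3 * d * ?Lm + 4) * n" "2 ^ it \<le> (n + 1) * ?Hm"
          "k2 \<le> k1 + it * (n * d * (240 * (?Hm + ?Lm + ?wm)) + 1) + 1" by blast
      have "k2 \<le> 12 * K + 12 * (n * d) + 11 * n + 3 * d + 50 + it * (n * d * (240 * (?Hm + ?Lm + ?wm)) + 1)"
        using b(5) k1 by linarith
      from time_bound[unfolded l0 TT, OF K b(4) this]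
      have t: "real k2 \<le> 140000 * T * log 2 (2 + T) ^ 2" .
      have "length (outbits s2) = 2 * K + d + n + 4 + length bits"
        unfolding b(1) out header_bits_def by simp
      with size_bound[unfolded l0, OF K b(3)]
      have l: "real (length (outbits s2)) \<le> 200 * (real n * real d * l + real n * log 2 (real n) + \<sigma>)"
        by simp
      have g: "good_sketch recover (outbits s2) n d x \<epsilon>"
      proof (rule good_sketchI)
        fix i j assume ij: "i < n" "j < n" "i \<noteq> j"
        have "F * pdist d (rows (reals s1 8) d i) (rows (reals s1 8) d j) = pdist d (x i) (x j)"
          using pd ij F0 by simp
        with recover_valid[OF _ b(2) ij F, of "outbits s2"]
        show "\<exists>v. recovers recover (outbits s2) i j v \<and> \<bar>v - pdist d (x i) (x j)\<bar> \<le> \<epsilon> * pdist d (x i) (x j)"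
          unfolding b(1) out by simp
      qed
      from t l g show ?case by blast
    qed
  qed (use n ps radius_facts sketch_input_rows in \<open>auto simp: sketch_input_def set_cell_def\<close>)
  moreover have "\<not> bval (RLe (RNum 1) (RV 0)) ?s" using eps e0 by simp
  ultimately have "wp sketch ?Q ?s 0" unfolding sketch_def wp_Cond wp_Seq by simp
  then show ?thesis unfolding wp_def by auto
qed

theorem theorem2:
  fixes c :: nat
  shows "\<exists>(sketch :: com) (recover :: com) (C :: real) (K :: real) (a :: nat). C > 0 \<and> K > 0 \<and>
    (\<forall>(n :: nat) (d :: nat) (x :: nat \<Rightarrow> nat \<Rightarrow> real) (\<epsilon> :: real).
      n \<ge> 2 \<and> pointset n d x \<and> \<epsilon> > 0 \<longrightarrow>
      (let \<Phi> = aspect_ratio n d x;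
           \<Lambda> = C * lambda_bound d \<Phi> \<epsilon>;
           L = log 2 \<Phi> + \<Lambda>;
           \<sigma> = scale_bits (min_dist n d x);
           T = real n * real d * L + \<sigma>
       in (\<forall>\<omega>. \<exists>t s. runs sketch (sketch_input n d \<epsilon> x \<omega>) t s \<and>
             real t \<le> K * T * log 2 (2 + T) ^ a \<and>
             real (length (outbits s)) \<le> K * (real n * real d * \<Lambda> + real n * log 2 (real n) + \<sigma>)) \<and>
          measure coin_flips {\<omega> \<in> space coin_flips.
             \<exists>t s. runs sketch (sketch_input n d \<epsilon> x \<omega>) t s \<and> good_sketch recover (outbits s) n d x \<epsilon>}
            \<ge> 1 - 1 / real n ^ c))"
proof -
  \<comment> \<open>Holds for every sequence of coins. The factor 1 is the witness for
    \<open>C\<close>, written out to match the goal after instantiation.\<close>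
  have main: "\<exists>t s. runs sketch (sketch_input n d \<epsilon> x \<omega>) t s \<and>
      real t \<le> 140000 * (real n * real d * (log 2 (aspect_ratio n d x) + 1 * lambda_bound d (aspect_ratio n d x) \<epsilon>) +
        scale_bits (min_dist n d x)) * log 2 (2 + (real n * real d * (log 2 (aspect_ratio n d x) +
        1 * lambda_bound d (aspect_ratio n d x) \<epsilon>) + scale_bits (min_dist n d x))) ^ 2 \<and>
      real (length (outbits s)) \<le> 140000 * (real n * real d * (1 * lambda_bound d (aspect_ratio n d x) \<epsilon>) +
        real n * log 2 (real n) + scale_bits (min_dist n d x)) \<and>
      good_sketch recover (outbits s) n d x \<epsilon>"
    if n: "2 \<le> n" and ps: "pointset n d x" and e: "0 < \<epsilon>" for n d x \<epsilon> \<omega>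
  proof -
    define \<Phi> where "\<Phi> = aspect_ratio n d x"
    define l where "l = lambda_bound d \<Phi> \<epsilon>"
    define \<sigma> where "\<sigma> = scale_bits (min_dist n d x)"
    define T where "T = real n * real d * (log 2 \<Phi> + l) + \<sigma>"
    define P where "P = real n * real d * l + real n * log 2 (real n) + \<sigma>"
    note fold = mult_1 \<Phi>_def[symmetric] l_def[symmetric] \<sigma>_def[symmetric] T_def[symmetric] P_def[symmetric]
    note pf = pointset_facts[OF n ps, folded \<Phi>_def]
    have l1: "1 \<le> l" unfolding l_def lambda_bound_def by (rule lg_ge)
    have sig: "0 \<le> \<sigma>" unfolding \<sigma>_def scale_bits_def by simp
    have P0: "0 \<le> P" unfolding P_def using sig l1 n by simp
    show ?thesis
    proof (cases "\<epsilon> < 1")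
      case True
      with sketch_small_eps[OF n ps e True, of \<omega>, folded \<Phi>_def \<sigma>_def, folded l_def, folded T_def] obtain t s where
        "runs sketch (sketch_input n d \<epsilon> x \<omega>) t s" "real t \<le> 140000 * T * log 2 (2 + T) ^ 2"
        "real (length (outbits s)) \<le> 200 * P" "good_sketch recover (outbits s) n d x \<epsilon>"
        unfolding P_def by auto
      moreover from this(3) have "real (length (outbits s)) \<le> 140000 * P" using P0 by linarith
      ultimately show ?thesis unfolding fold by blast
    next
      case False
      \<comment> \<open>For \<epsilon> \<ge> 1 the time bound has to cover the two steps of the
        trivial run, which follows from \<open>T \<ge> 1\<close>.\<close>
      have nd: "1 * 1 \<le> real n * real d" using n pf(1) by (intro mult_mono) auto
      have "0 \<le> log 2 \<Phi>" using pf(3) by simp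
      then have "1 * 1 \<le> (real n * real d) * (log 2 \<Phi> + l)" using nd l1 by (intro mult_mono) auto
      then have T1: "1 \<le> T" unfolding T_def using sig by simp
      then have "1 \<le> log 2 (2 + T)" by (subst le_log_iff) auto
      then have "1 * 1 \<le> T * log 2 (2 + T) ^ 2" using T1 by (intro mult_mono one_le_power) auto
      then have "real 2 \<le> 140000 * T * log 2 (2 + T) ^ 2" by simp
      moreover have "real (length (outbits (sketch_input n d \<epsilon> x \<omega>))) \<le> 140000 * P"
        using P0 by (simp add: sketch_input_def)
      ultimately show ?thesis
        using sketch_large_eps[of \<epsilon> n d x \<omega>] False unfolding fold not_less by blast
    qed
  qed
  interpret prob_space coin_flips
    unfolding coin_flips_def by (intro prob_space.prob_space_stream_space prob_space_measure_pmf)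
  \<comment> \<open>The event of success is the whole space, which also settles its
    measurability.\<close>
  have "{\<omega> \<in> space coin_flips. \<exists>t s. runs sketch (sketch_input n d \<epsilon> x \<omega>) t s \<and>
      good_sketch recover (outbits s) n d x \<epsilon>} = space coin_flips"
    if "2 \<le> n" "pointset n d x" "0 < \<epsilon>" for n d x \<epsilon>
    using main[OF that] by blast
  then have prob: "1 - 1 / real n ^ c \<le> measure coin_flips {\<omega> \<in> space coin_flips.
      \<exists>t s. runs sketch (sketch_input n d \<epsilon> x \<omega>) t s \<and> good_sketch recover (outbits s) n d x \<epsilon>}"
    if "2 \<le> n" "pointset n d x" "0 < \<epsilon>" for n d x \<epsilon>
    using that by (simp add: prob_space)
  show ?thesis
    unfolding Let_def
  proof (rule exI[of _ sketch], rule exI[of _ recover], rule exI[of _ 1], rule exI[of _ 140000],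
      rule exI[of _ 2], intro conjI allI impI; (elim conjE)?)
    fix n d x \<epsilon> \<omega>
    assume a: "2 \<le> n" "pointset n d x" "0 < (\<epsilon>::real)"
    from main[OF a, of \<omega>] show "\<exists>t s. runs sketch (sketch_input n d \<epsilon> x \<omega>) t s \<and>
      real t \<le> 140000 * (real n * real d * (log 2 (aspect_ratio n d x) + 1 * lambda_bound d (aspect_ratio n d x) \<epsilon>) +
        scale_bits (min_dist n d x)) * log 2 (2 + (real n * real d * (log 2 (aspect_ratio n d x) +
        1 * lambda_bound d (aspect_ratio n d x) \<epsilon>) + scale_bits (min_dist n d x))) ^ 2 \<and>
      real (length (outbits s)) \<le> 140000 * (real n * real d * (1 * lambda_bound d (aspect_ratio n d x) \<epsilon>) +
        real n * log 2 (real n) + scale_bits (min_dist n d x))"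
      by blast
  qed (simp_all only: zero_less_one zero_less_numeral prob)
qed

end
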